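(* Let $\mathbb D\subset\mathbb C$ be a simply connected domain, $z_*\in\mathbb D$, and let $\eta$ be a holomorphic potential on $\mathbb D$. Let $C$ be the solution of $\mathrm dC=C\eta$, $C(z_*,\lambda)=\mathrm{Id}$. Put $\omega_0=\begin{pmatrix}0&\lambda^{-1}\\-\lambda&0\end{pmatrix}$, and let $\mathbb D_1\subset \mathbb D$ (resp. $\mathbb D_2\subset\mathbb D$) be the open set of points $z$ such that $C(z,\cdot)\in \Lambda \mathrm{SL}_2\mathbb C_{\sigma,\tau_4}\cdot\Lambda^+\mathrm{SL}_2\mathbb C_\sigma$ (resp. $C(z,\cdot)\in \Lambda \mathrm{SL}_2\mathbb C_{\sigma,\tau_4}\cdot\omega_0\cdot\Lambda^+\mathrm{SL}_2\mathbb C_\sigma$). Let $C=\Phi V_+$ on $\mathbb D_1$ and $C=\Phi\,\omega_0V_+$ on $\mathbb D_2$ be the corresponding (smooth in $z$) Iwasawa decompositions, with $\Phi$ taking values in $\Lambda \mathrm{SL}_2\mathbb C_{\sigma,\tau_4}$ and $V_+$ in $\Lambda^+\mathrm{SL}_2\mathbb C_\sigma$. Then, up to a $\lambda$-independent diagonal gauge $D=\mathrm{diag}(e^{i\theta},e^{-i\theta})\in\mathrm U_1$ multiplied from the right (with $\theta$ a real function of $z$) and a change of coordinates, the matrix $\Phi$ on $\mathbb D_1$ and the matrix $\Phi\,\omega_0$ on $\mathbb D_2$ are extended frames of some constant mean curvature surface in $\mathbb H^3$ with mean curvature $0\le H<1$.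
   Context: Loop groups: $\sigma=\mathrm{Ad}(\mathrm{diag}(1,-1))$; $\Lambda \mathrm{SL}_2\mathbb C_\sigma$ is the Banach Lie group of loops $g:S^1\to\mathrm{SL}_2\mathbb C$ with entries in the Wiener algebra (absolutely convergent Fourier series) and $g(-\lambda)=\sigma g(\lambda)$; $\Lambda^+\mathrm{SL}_2\mathbb C_\sigma$ is the subgroup of loops extending holomorphically to $|\lambda|<1$. $\Lambda\mathfrak{sl}_2\mathbb C_\sigma$ is the Lie algebra of $\Lambda \mathrm{SL}_2\mathbb C_\sigma$. With $\mathscr R=\mathrm{diag}(1/\sqrt i,\sqrt i)$ and $g^*=\bar g^t$, put $\tau_4(g)(\lambda)=\mathrm{Ad}(\mathscr R)\{g(i/\bar\lambda)\}^{*-1}$ and $\Lambda \mathrm{SL}_2\mathbb C_{\sigma,\tau_4}=\{g\in\Lambda \mathrm{SL}_2\mathbb C_\sigma : \tau_4(g)=g\}$. A holomorphic potential is a $\Lambda\mathfrak{sl}_2\mathbb C_\sigma$-valued 1-form $\eta=\sum_{j\ge -1}\lambda^j\eta_j$ on $\mathbb D$, where the $\eta_j$ are $\lambda$-independent holomorphic 1-forms, diagonal for even $j$ and off-diagonal for odd $j$, such that $\lambda\eta$ is holomorphic in $z\in\mathbb D$ and $\lambda\in\mathbb C$, and the upper right entry of $\eta_{-1}$ does not vanish on $\mathbb D$. $\mathbb H^3=\{\xi\in\mathrm{Her}_2\mathbb C:\det\xi=1,\ \mathrm{tr}\,\xi>0\}$, inside the space $\mathrm{Her}_2\mathbb C$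 of Hermitian $2\times2$ matrices with Lorentzian scalar product determined by $\langle\xi,\xi\rangle=-\det\xi$. Extended frame ($0\le H<1$): a map $\Psi$ from an open set of $\mathbb C$ to $\Lambda \mathrm{SL}_2\mathbb C_\sigma$, extending holomorphically to $\lambda\in\mathbb C^\times$, with $\Psi^{-1}\mathrm d\Psi=U\,\mathrm dz+V\,\mathrm d\bar z$, $$U=\begin{pmatrix}u_z/4&-\frac12\lambda^{-1}\mathscr He^{u/2}\\ \lambda^{-1}\mathscr Qe^{-u/2}&-u_z/4\end{pmatrix},\quad V=\begin{pmatrix}-u_{\bar z}/4&-\lambda\overline{\mathscr Q}e^{-u/2}\\ \frac12\lambda\mathscr He^{u/2}&u_{\bar z}/4\end{pmatrix},$$ where $u$ is a real function, $\mathscr Q=-iQ$ with $Q$ holomorphic, and $\mathscr H=ie^{-q}(\tanh q+1)=i/\cosh q$ for some $q\ge0$. The associated surface of mean curvature $H=\tanh q$ is given by the Sym formula $f=\Psi\,\mathrm{diag}(e^{-q/2},e^{q/2})\,\Psi^*$ evaluated at $|\lambda|=e^{-q/2}$; its metric is $e^u\mathrm dz\mathrm d\bar z$, and for $\lambda=e^{-q/2}$ its Hopf differential is $Q\,\mathrm dz^2$. *)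

theory Defs
  imports "HOL-Complex_Analysis.Complex_Analysis"
begin

text \<open>This infix would make every use of \<open>$\<close> on vectors ambiguous.\<close>
no_notation fps_nth (infixl \<open>$\<close> 75)

section \<open>The Wiener algebra as a normed space\<close>

text \<open>An element of the Wiener algebra is represented by its absolutely summable family of
  Fourier coefficients; the norm is the sum of the absolute values of the coefficients.\<close>

typedef wiener = "{a :: int \<Rightarrow> complex. (\<lambda>n. norm (a n)) summable_on UNIV}"
  morphisms fourier_coeff Abs_wiener
  by (rule exI[of _ "\<lambda>_. 0"]) simp

lemma summable_fourier_coeff: "(\<lambda>n. norm (fourier_coeff a n)) summable_on UNIV"
  using fourier_coeff[of a] by simp

lemma wiener_eqI: "(\<And>n. fourier_coeff a n = fourier_coeff b n) \<Longrightarrow> a = b"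
  by (metis ext fourier_coeff_inject)

instantiation wiener :: real_vector
begin

definition zero_wiener :: wiener where
  "0 = Abs_wiener (\<lambda>_. 0)"
definition plus_wiener :: "wiener \<Rightarrow> wiener \<Rightarrow> wiener" where
  "a + b = Abs_wiener (\<lambda>n. fourier_coeff a n + fourier_coeff b n)"
definition uminus_wiener :: "wiener \<Rightarrow> wiener" where
  "- a = Abs_wiener (\<lambda>n. - fourier_coeff a n)"
definition minus_wiener :: "wiener \<Rightarrow> wiener \<Rightarrow> wiener" where
  "a - b = Abs_wiener (\<lambda>n. fourier_coeff a n - fourier_coeff b n)"
definition scaleR_wiener :: "real \<Rightarrow> wiener \<Rightarrow> wiener" where
  "r *\<^sub>R a = Abs_wiener (\<lambda>n. r *\<^sub>R fourier_coeff a n)"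

lemma fourier_coeff_zero: "fourier_coeff 0 n = 0"
  by (simp add: zero_wiener_def Abs_wiener_inverse)

lemma fourier_coeff_add: "fourier_coeff (a + b) n = fourier_coeff a n + fourier_coeff b n"
proof -
  have "(\<lambda>n. norm (fourier_coeff a n + fourier_coeff b n)) summable_on UNIV"
    by (rule summable_on_comparison_test
          [OF summable_on_add[OF summable_fourier_coeff[of a] summable_fourier_coeff[of b]]])
       (auto intro: norm_triangle_ineq)
  then show ?thesis by (simp add: plus_wiener_def Abs_wiener_inverse)
qed

lemma fourier_coeff_uminus: "fourier_coeff (- a) n = - fourier_coeff a n"
  by (simp add: uminus_wiener_def Abs_wiener_inverse summable_fourier_coeff)

lemma fourier_coeff_diff: "fourier_coeff (a - b) n = fourier_coeff a n - fourier_coeff b n"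
proof -
  have "(\<lambda>n. norm (fourier_coeff a n - fourier_coeff b n)) summable_on UNIV"
    by (rule summable_on_comparison_test
          [OF summable_on_add[OF summable_fourier_coeff[of a] summable_fourier_coeff[of b]]])
       (auto intro: norm_triangle_ineq4)
  then show ?thesis by (simp add: minus_wiener_def Abs_wiener_inverse)
qed

lemma fourier_coeff_scaleR: "fourier_coeff (r *\<^sub>R a) n = r *\<^sub>R fourier_coeff a n"
  by (simp add: scaleR_wiener_def Abs_wiener_inverse summable_fourier_coeff
      summable_on_cmult_right)

instance
proof
  fix a b c :: wiener and r s :: real
  show "a + b + c = a + (b + c)" "a + b = b + a" "0 + a = a" "- a + a = 0" "a - b = a + - b"
    by (rule wiener_eqI; simp add: fourier_coeff_add fourier_coeff_zero fourier_coeff_uminus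
          fourier_coeff_diff)+
  show "r *\<^sub>R (a + b) = r *\<^sub>R a + r *\<^sub>R b" "(r + s) *\<^sub>R a = r *\<^sub>R a + s *\<^sub>R a"
    "r *\<^sub>R s *\<^sub>R a = (r * s) *\<^sub>R a" "1 *\<^sub>R a = a"
    by (rule wiener_eqI; simp add: fourier_coeff_add fourier_coeff_scaleR algebra_simps)+
qed

end

instantiation wiener :: real_normed_vector
begin

definition norm_wiener :: "wiener \<Rightarrow> real" where
  "norm_wiener a = (\<Sum>\<^sub>\<infinity>n. norm (fourier_coeff a n))"
definition dist_wiener :: "wiener \<Rightarrow> wiener \<Rightarrow> real" where
  "dist_wiener a b = norm (a - b)"
definition sgn_wiener :: "wiener \<Rightarrow> wiener" where
  "sgn_wiener a = inverse (norm a) *\<^sub>R a"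
definition uniformity_wiener :: "(wiener \<times> wiener) filter" where
  "uniformity_wiener = (INF e\<in>{0<..}. principal {(x, y). dist x y < e})"
definition open_wiener :: "wiener set \<Rightarrow> bool" where
  "open_wiener U = (\<forall>x\<in>U. \<forall>\<^sub>F (x', y) in uniformity. x' = x \<longrightarrow> y \<in> U)"

instance
proof
  fix a b :: wiener and r :: real
  show "dist a b = norm (a - b)" by (rule dist_wiener_def)
  show "sgn a = inverse (norm a) *\<^sub>R a" by (rule sgn_wiener_def)
  show "uniformity = (INF e\<in>{0<..}. principal {(x :: wiener, y). dist x y < e})"
    by (rule uniformity_wiener_def)
  show "open U = (\<forall>x\<in>U. \<forall>\<^sub>F (x', y) in uniformity. x' = x \<longrightarrow> y \<in> U)" for U :: "wiener set"
    by (rule open_wiener_def)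
  show "(norm a = 0) = (a = 0)"
  proof
    assume "norm a = 0"
    then have "norm (fourier_coeff a n) = 0" for n
      using nonneg_infsum_le_0D[of "\<lambda>n. norm (fourier_coeff a n)" UNIV n]
      by (simp add: norm_wiener_def summable_fourier_coeff)
    then show "a = 0" by (intro wiener_eqI) (simp add: fourier_coeff_zero)
  qed (simp add: norm_wiener_def fourier_coeff_zero)
  have "norm (a + b) \<le> (\<Sum>\<^sub>\<infinity>n. norm (fourier_coeff a n) + norm (fourier_coeff b n))"
    unfolding norm_wiener_def
    by (rule infsum_mono)
       (auto simp: fourier_coeff_add
             intro: summable_fourier_coeff[of "a + b", unfolded fourier_coeff_add]
               summable_on_add summable_fourier_coeff norm_triangle_ineq)
  also have "\<dots> = norm a + norm b"
    unfolding norm_wiener_def by (rule infsum_add) (rule summable_fourier_coeff)+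
  finally show "norm (a + b) \<le> norm a + norm b" .
  show "norm (r *\<^sub>R a) = \<bar>r\<bar> * norm a"
    by (simp add: norm_wiener_def fourier_coeff_scaleR infsum_cmult_right')
qed

end

definition wiener_eval :: "wiener \<Rightarrow> complex \<Rightarrow> complex" where
  "wiener_eval a lam = (\<Sum>\<^sub>\<infinity>n. fourier_coeff a n * lam powi n)"


section \<open>Two by two matrices and loop groups\<close>

type_synonym mat2 = "complex^2^2"

text \<open>The Banach space of matrix valued loops with entries in the Wiener algebra.\<close>
type_synonym loop = "wiener^2^2"

definition mat22 :: "complex \<Rightarrow> complex \<Rightarrow> complex \<Rightarrow> complex \<Rightarrow> mat2" where
  "mat22 a b c d = vector [vector [a, b], vector [c, d]]"

definition adj :: "mat2 \<Rightarrow> mat2" where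
  "adj A = (\<chi> i j. cnj (A $ j $ i))"

definition cscale :: "complex \<Rightarrow> mat2 \<Rightarrow> mat2" where
  "cscale c A = (\<chi> i j. c * A $ i $ j)"

definition Ad :: "mat2 \<Rightarrow> mat2 \<Rightarrow> mat2" where
  "Ad P A = P ** A ** matrix_inv P"

definition loop_eval :: "loop \<Rightarrow> complex \<Rightarrow> mat2" where
  "loop_eval g lam = (\<chi> i j. wiener_eval (g $ i $ j) lam)"

definition sigma :: "mat2 \<Rightarrow> mat2" where
  "sigma = Ad (mat22 1 0 0 (-1))"

definition LSL :: "loop set" where
  "LSL = {g. \<forall>lam\<in>sphere 0 1. det (loop_eval g lam) = 1
                \<and> loop_eval g (- lam) = sigma (loop_eval g lam)}"

definition LSL_plus :: "loop set" where
  "LSL_plus = {g \<in> LSL. \<exists>G :: complex \<Rightarrow> mat2. \<forall>i j.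
      continuous_on (cball 0 1) (\<lambda>lam. G lam $ i $ j) \<and>
      (\<lambda>lam. G lam $ i $ j) holomorphic_on ball 0 1 \<and>
      (\<forall>lam\<in>sphere 0 1. G lam = loop_eval g lam)}"

definition Rmat :: mat2 where
  "Rmat = mat22 (1 / csqrt \<i>) 0 0 (csqrt \<i>)"

definition tau4 :: "(complex \<Rightarrow> mat2) \<Rightarrow> complex \<Rightarrow> mat2" where
  "tau4 g lam = Ad Rmat (matrix_inv (adj (g (\<i> / cnj lam))))"

definition LSL_tau4 :: "loop set" where
  "LSL_tau4 = {g \<in> LSL. \<forall>lam\<in>sphere 0 1. tau4 (loop_eval g) lam = loop_eval g lam}"

definition omega0 :: "complex \<Rightarrow> mat2" where
  "omega0 lam = mat22 0 (inverse lam) (- lam) 0"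


section \<open>Smooth maps on open subsets of the plane\<close>

definition dx :: "(complex \<Rightarrow> 'a::real_normed_vector) \<Rightarrow> complex \<Rightarrow> 'a" where
  "dx f z = frechet_derivative f (at z) 1"

definition dy :: "(complex \<Rightarrow> 'a::real_normed_vector) \<Rightarrow> complex \<Rightarrow> 'a" where
  "dy f z = frechet_derivative f (at z) \<i>"

fun Ck_on :: "nat \<Rightarrow> complex set \<Rightarrow> (complex \<Rightarrow> 'a::real_normed_vector) \<Rightarrow> bool" where
  "Ck_on 0 S f = continuous_on S f"
| "Ck_on (Suc k) S f =
     ((\<forall>z\<in>S. f differentiable (at z)) \<and> Ck_on k S (dx f) \<and> Ck_on k S (dy f))"

text \<open>Intended for open sets only: the derivatives are two-sided ones.\<close>
definition smooth_on :: "complex set \<Rightarrow> (complex \<Rightarrow> 'a::real_normed_vector) \<Rightarrow> bool" where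
  "smooth_on S f \<longleftrightarrow> (\<forall>k. Ck_on k S f)"


section \<open>Holomorphic potentials\<close>

definition holomorphic2_on :: "(complex \<times> complex \<Rightarrow> complex) \<Rightarrow> (complex \<times> complex) set \<Rightarrow> bool"
  where
  "holomorphic2_on f S \<longleftrightarrow>
     (\<forall>p\<in>S. \<exists>a b. (f has_derivative (\<lambda>h. a * fst h + b * snd h)) (at p))"

text \<open>A potential is given by the coefficient matrices of its components,
  \<open>\<eta>\<^sub>j = e j z dz\<close>; only the values \<open>e j\<close> with \<open>j \<ge> - 1\<close> are relevant.
  The following is the coefficient matrix of \<open>lam\<eta>\<close>, as a power series in \<open>lam\<close>, and of \<open>\<eta>\<close>.\<close>

definition lambda_eta :: "(int \<Rightarrow> complex \<Rightarrow> mat2) \<Rightarrow> complex \<Rightarrow> complex \<Rightarrow> mat2" where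
  "lambda_eta e z lam = (\<chi> r s. \<Sum>n. lam ^ n * e (int n - 1) z $ r $ s)"

definition eta :: "(int \<Rightarrow> complex \<Rightarrow> mat2) \<Rightarrow> complex \<Rightarrow> complex \<Rightarrow> mat2" where
  "eta e z lam = cscale (inverse lam) (lambda_eta e z lam)"

definition holomorphic_potential :: "complex set \<Rightarrow> (int \<Rightarrow> complex \<Rightarrow> mat2) \<Rightarrow> bool" where
  "holomorphic_potential D e \<longleftrightarrow>
     (\<forall>j\<ge>-1. (\<forall>r s. (\<lambda>z. e j z $ r $ s) holomorphic_on D) \<and>
        (\<forall>z\<in>D. trace (e j z) = 0 \<and>
           (even j \<longrightarrow> e j z $ 1 $ 2 = 0 \<and> e j z $ 2 $ 1 = 0) \<and>
           (odd j \<longrightarrow> e j z $ 1 $ 1 = 0 \<and> e j z $ 2 $ 2 = 0))) \<and>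
     (\<forall>r s. (\<forall>z\<in>D. \<forall>lam. summable (\<lambda>n. lam ^ n * e (int n - 1) z $ r $ s)) \<and>
        holomorphic2_on (\<lambda>(z, lam). lambda_eta e z lam $ r $ s) (D \<times> UNIV)) \<and>
     (\<forall>z\<in>D. e (-1) z $ 1 $ 2 \<noteq> 0)"


section \<open>Surfaces in hyperbolic space\<close>

text \<open>Polarisation of \<open>\<langle>\<xi>,\<xi>\<rangle> = - det \<xi>\<close>; the determinants are real on Hermitian matrices.\<close>
definition lorentz :: "mat2 \<Rightarrow> mat2 \<Rightarrow> real" where
  "lorentz X Y = Re (det X + det Y - det (X + Y)) / 2"

definition Her2 :: "mat2 set" where
  "Her2 = {X. adj X = X}"

definition H3 :: "mat2 set" where
  "H3 = {X \<in> Her2. det X = 1 \<and> Re (trace X) > 0}"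

definition H3_immersion :: "complex set \<Rightarrow> (complex \<Rightarrow> mat2) \<Rightarrow> bool" where
  "H3_immersion W f \<longleftrightarrow> smooth_on W f \<and>
     (\<forall>z\<in>W. f z \<in> H3 \<and> inj (frechet_derivative f (at z)))"

definition unit_normal :: "complex set \<Rightarrow> (complex \<Rightarrow> mat2) \<Rightarrow> (complex \<Rightarrow> mat2) \<Rightarrow> bool" where
  "unit_normal W f N \<longleftrightarrow> smooth_on W N \<and>
     (\<forall>z\<in>W. N z \<in> Her2 \<and> lorentz (N z) (N z) = 1 \<and> lorentz (N z) (f z) = 0 \<and>
        lorentz (N z) (dx f z) = 0 \<and> lorentz (N z) (dy f z) = 0)"

text \<open>The second fundamental form of \<open>f\<close> in \<open>H3\<close> is \<open>\<langle>d\<^sup>2f, N\<rangle>\<close> since \<open>N\<close> is orthogonal to \<open>f\<close>.\<close>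
definition mean_curvature :: "(complex \<Rightarrow> mat2) \<Rightarrow> (complex \<Rightarrow> mat2) \<Rightarrow> complex \<Rightarrow> real" where
  "mean_curvature f N z =
     (let E = lorentz (dx f z) (dx f z); F = lorentz (dx f z) (dy f z);
          G = lorentz (dy f z) (dy f z);
          l = lorentz (dx (dx f) z) (N z); m = lorentz (dx (dy f) z) (N z);
          n = lorentz (dy (dy f) z) (N z)
      in (E * n - 2 * F * m + G * l) / (2 * (E * G - F\<^sup>2)))"

text \<open>The coefficient \<open>\<langle>f\<^sub>z\<^sub>z, N\<rangle>\<close> of the Hopf differential, with
  \<open>4 f\<^sub>z\<^sub>z = f\<^sub>x\<^sub>x - f\<^sub>y\<^sub>y - 2 \<i> f\<^sub>x\<^sub>y\<close>.\<close>
definition hopf :: "(complex \<Rightarrow> mat2) \<Rightarrow> (complex \<Rightarrow> mat2) \<Rightarrow> complex \<Rightarrow> complex" where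
  "hopf f N z = (of_real (lorentz (dx (dx f) z) (N z) - lorentz (dy (dy f) z) (N z))
     - 2 * \<i> * of_real (lorentz (dx (dy f) z) (N z))) / 4"

text \<open>The induced metric is \<open>e\<^sup>u dz d\<close>\<open>z\<close>-bar, that is \<open>e\<^sup>u (dx\<^sup>2 + dy\<^sup>2)\<close>.\<close>
definition conformal_metric :: "complex set \<Rightarrow> (complex \<Rightarrow> mat2) \<Rightarrow> (complex \<Rightarrow> real) \<Rightarrow> bool" where
  "conformal_metric W f u \<longleftrightarrow>
     (\<forall>z\<in>W. lorentz (dx f z) (dx f z) = exp (u z) \<and> lorentz (dy f z) (dy f z) = exp (u z) \<and>
        lorentz (dx f z) (dy f z) = 0)"


section \<open>Extended frames\<close>

text \<open>\<open>u\<^sub>z\<close> for a real function \<open>u\<close>; the other Wirtinger derivative is its conjugate.\<close>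
definition dz_real :: "(complex \<Rightarrow> real) \<Rightarrow> complex \<Rightarrow> complex" where
  "dz_real u z = (of_real (dx u z) - \<i> * of_real (dy u z)) / 2"

definition calH :: "real \<Rightarrow> complex" where
  "calH q = \<i> * of_real (exp (- q) * (tanh q + 1))"

definition frame_U :: "real \<Rightarrow> (complex \<Rightarrow> real) \<Rightarrow> (complex \<Rightarrow> complex) \<Rightarrow> complex \<Rightarrow> complex \<Rightarrow> mat2"
  where
  "frame_U q u Q z lam = mat22
     (dz_real u z / 4)                                (- (1/2) * inverse lam * calH q * of_real (exp (u z / 2)))
     (inverse lam * (- \<i> * Q z) * of_real (exp (- u z / 2)))  (- dz_real u z / 4)"

definition frame_V :: "real \<Rightarrow> (complex \<Rightarrow> real) \<Rightarrow> (complex \<Rightarrow> complex) \<Rightarrow> complex \<Rightarrow> complex \<Rightarrow> mat2"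
  where
  "frame_V q u Q z lam = mat22
     (- cnj (dz_real u z) / 4)                        (- lam * cnj (- \<i> * Q z) * of_real (exp (- u z / 2)))
     ((1/2) * lam * calH q * of_real (exp (u z / 2)))        (cnj (dz_real u z) / 4)"

text \<open>A frame \<open>Psi z lam\<close> is given together with its extension to all \<open>lam \<noteq> 0\<close>; its restriction
  to the unit circle is the loop. The last clause is
  \<open>d Psi = Psi (U dz + V d\<close>\<open>z\<close>-bar\<open>)\<close>.\<close>
definition extended_frame :: "real \<Rightarrow> complex set \<Rightarrow> (complex \<Rightarrow> real) \<Rightarrow> (complex \<Rightarrow> complex) \<Rightarrow>
    (complex \<Rightarrow> complex \<Rightarrow> mat2) \<Rightarrow> bool" where
  "extended_frame q W u Q Psi \<longleftrightarrow>
     q \<ge> 0 \<and> open W \<and> smooth_on W u \<and> Q holomorphic_on W \<and>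
     (\<forall>z\<in>W. \<exists>g\<in>LSL. \<forall>lam\<in>sphere 0 1. Psi z lam = loop_eval g lam) \<and>
     (\<forall>z\<in>W. \<forall>r s. (\<lambda>lam. Psi z lam $ r $ s) holomorphic_on - {0}) \<and>
     (\<forall>lam. lam \<noteq> 0 \<longrightarrow> (\<forall>z\<in>W.
        ((\<lambda>z. Psi z lam) has_derivative
          (\<lambda>h. Psi z lam ** (cscale h (frame_U q u Q z lam) + cscale (cnj h) (frame_V q u Q z lam))))
        (at z)))"

definition sym_formula :: "real \<Rightarrow> (complex \<Rightarrow> complex \<Rightarrow> mat2) \<Rightarrow> complex \<Rightarrow> complex \<Rightarrow> mat2" where
  "sym_formula q Psi lam z =
     Psi z lam ** mat22 (of_real (exp (- q / 2))) 0 0 (of_real (exp (q / 2))) ** adj (Psi z lam)"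

text \<open>\<open>Psi\<close> is an extended frame, and the associated surfaces have constant mean curvature
  \<open>H = tanh q\<close>, metric \<open>e\<^sup>u dz d\<close>\<open>z\<close>-bar and, at \<open>lam = e\<close> to the \<open>- q / 2\<close>,
  Hopf differential \<open>Q dz\<^sup>2\<close>.\<close>
definition extended_frame_of_cmc_surface ::
    "real \<Rightarrow> complex set \<Rightarrow> (complex \<Rightarrow> complex \<Rightarrow> mat2) \<Rightarrow> bool" where
  "extended_frame_of_cmc_surface H W Psi \<longleftrightarrow>
     (\<exists>q u Q. H = tanh q \<and> extended_frame q W u Q Psi \<and>
        (\<forall>lam. norm lam = exp (- q / 2) \<longrightarrow>
           H3_immersion W (sym_formula q Psi lam) \<and>
           conformal_metric W (sym_formula q Psi lam) u \<and>
           (\<exists>N. unit_normal W (sym_formula q Psi lam) N \<and>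
              (\<forall>z\<in>W. mean_curvature (sym_formula q Psi lam) N z = H \<and>
                 (lam = of_real (exp (- q / 2)) \<longrightarrow> hopf (sym_formula q Psi lam) N z = Q z)))))"

text \<open>Up to a right gauge by \<open>diag(e\<close> to the \<open>\<i>\<theta>, e\<close> to the \<open>-\<i>\<theta>)\<close> and a conformal change of
  coordinates \<open>w\<close>, the map \<open>F\<close> from \<open>S\<close> to the loop group is an extended frame.
  The gauge is smooth; \<open>\<theta>\<close> itself is not required to be continuous, since a smooth map
  to the circle group has in general no continuous logarithm on a domain that is not
  simply connected.\<close>
definition cmc_frame_up_to_gauge ::
    "real \<Rightarrow> complex set \<Rightarrow> (complex \<Rightarrow> complex \<Rightarrow> mat2) \<Rightarrow> bool" where
  "cmc_frame_up_to_gauge H S F \<longleftrightarrow>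
     (\<exists>(\<theta> :: complex \<Rightarrow> real) w Psi.
        smooth_on S (\<lambda>z. cis (\<theta> z)) \<and> w holomorphic_on S \<and> inj_on w S \<and>
        (\<forall>z\<in>S. \<forall>lam\<in>sphere 0 1.
           Psi (w z) lam = F z lam ** mat22 (cis (\<theta> z)) 0 0 (cis (- \<theta> z))) \<and>
        extended_frame_of_cmc_surface H (w ` S) Psi)"

end

theory Submission
  imports Defs
begin

text \<open>
  In both cells the first Iwasawa factor has the form \<open>\<Psi> = C V\<^sub>+\<^sup>-\<^sup>1\<close>, where
  \<open>\<Psi>\<close> is \<open>\<Phi>\<close> or \<open>\<Phi> \<omega>\<^sub>0\<close>. Its Maurer-Cartan form
  \<open>V\<^sub>+ \<eta> V\<^sub>+\<^sup>-\<^sup>1 - dV\<^sub>+ V\<^sub>+\<^sup>-\<^sup>1\<close> has at most a simple pole at \<open>\<lambda> = 0\<close>. On the unit circle it is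
  fixed by the involution that \<open>\<tau>\<^sub>4\<close> induces on the Lie algebra: this also holds in the second cell,
  since \<open>\<omega>\<^sub>0\<close> is fixed by \<open>\<tau>\<^sub>4\<close> up to sign. By reflection in the circle the form extends to the whole
  sphere with a simple pole at infinity, so it only contains the powers \<open>-1\<close>, \<open>0\<close>, \<open>1\<close> of \<open>\<lambda>\<close>
  (\<open>laurent_polynomial_of_reflection\<close>, \<open>lambda_form_laurent\<close>), and the coefficient of \<open>\<lambda>\<close> is determined by
  that of \<open>1 / \<lambda>\<close>.

  The leading coefficient is that of \<open>\<eta>\<close> conjugated by \<open>V\<^sub>+\<close> at \<open>\<lambda> = 0\<close>, which is diagonal. Write \<open>v\<close> for its
  first entry, and \<open>a\<close>, \<open>b\<close> for the upper right and lower left entry of the leading coefficient of \<open>\<eta>\<close>.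
  The upper right entry is then \<open>a v\<^sup>2\<close>. A diagonal unitary gauge gives it a constant phase, its modulus
  defines the metric \<open>u\<close>, and the product of the two off-diagonal entries shows that
  \<open>Q = - 2 a b\<close>. The gauge is smooth because \<open>a\<close> has a holomorphic square root on the simply
  connected domain. The term of order \<open>0\<close> is diagonal; reality together with the complex linearity
  of \<open>\<eta>\<close> forces it to be \<open>u\<^sub>z / 4\<close> in the \<open>dz\<close> direction (\<open>lambda_form_diag_linear_term\<close>). So the
  gauged frame satisfies the equation of an extended frame with respect to the coordinate \<open>z\<close> itself
  (\<open>form_eq_frame_form\<close>).

  The frame extends to all \<open>\<lambda> \<noteq> 0\<close>: inside the disc by \<open>C V\<^sub>+\<^sup>-\<^sup>1\<close>, as \<open>C\<close> depends holomorphically on \<open>\<lambda>\<close>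
  (\<open>linear_ode_holomorphic_in_parameter\<close>), outside by reflection, and the two parts paste across the
  circle.

  The parameter \<open>q\<close> is chosen to be \<open>0\<close>, that is \<open>H = 0\<close>. The Sym formula then is \<open>\<Psi> \<Psi>\<^sup>*\<close> on the unit
  circle, and a direct computation shows that it is a conformal minimal immersion with metric \<open>u\<close>,
  normal \<open>\<Psi> diag(1, -1) \<Psi>\<^sup>*\<close> and Hopf differential \<open>Q\<close> at \<open>\<lambda> = 1\<close> (\<open>minimal_surface_of_frame\<close>).
\<close>

section \<open>Smooth maps on open sets of the plane\<close>

lemma Ck_on_cong:
  assumes "open S" "\<And>z. z \<in> S \<Longrightarrow> f z = g z" "Ck_on k S f"
  shows "Ck_on k S g"
  using assms(2,3)
proof (induction k arbitrary: f g)
  case 0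
  then show ?case by (simp cong: continuous_on_cong)
next
  case (Suc k)
  have der: "(g has_derivative frechet_derivative f (at z)) (at z)" if "z \<in> S" for z
  proof -
    have "(f has_derivative frechet_derivative f (at z)) (at z)"
      using Suc.prems(2) that by (simp add: frechet_derivative_works)
    then show ?thesis
      using has_derivative_transform_within_open[OF _ assms(1) that] Suc.prems(1) by blast
  qed
  then have eq: "frechet_derivative g (at z) = frechet_derivative f (at z)" if "z \<in> S" for z
    using frechet_derivative_at[OF der[OF that]] by simp
  have "Ck_on k S (dx g)"
    by (rule Suc.IH[of "dx f"]) (use Suc.prems(2) eq in \<open>auto simp: dx_def[abs_def]\<close>)
  moreover have "Ck_on k S (dy g)"
    by (rule Suc.IH[of "dy f"]) (use Suc.prems(2) eq in \<open>auto simp: dy_def[abs_def]\<close>)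
  ultimately show ?case
    using der by (auto simp: differentiable_def)
qed

lemma dx_eq: "(f has_derivative f') (at z) \<Longrightarrow> dx f z = f' 1"
  by (simp add: dx_def frechet_derivative_at[symmetric])

lemma dy_eq: "(f has_derivative f') (at z) \<Longrightarrow> dy f z = f' \<i>"
  by (simp add: dy_def frechet_derivative_at[symmetric])

text \<open>Derivatives are mostly known in closed form on an open set; this rule lets the closed form
  take the place of the Frechet derivative, which is what makes induction on the order work.\<close>
lemma Ck_on_SucI:
  assumes "open S" "\<And>z. z \<in> S \<Longrightarrow> (f has_derivative f' z) (at z)"
    and "Ck_on k S (\<lambda>z. f' z 1)" "Ck_on k S (\<lambda>z. f' z \<i>)"
  shows "Ck_on (Suc k) S f"
proof -
  have "Ck_on k S (dx f)"
    by (rule Ck_on_cong[OF assms(1) _ assms(3)]) (simp add: dx_eq[OF assms(2)])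
  moreover have "Ck_on k S (dy f)"
    by (rule Ck_on_cong[OF assms(1) _ assms(4)]) (simp add: dy_eq[OF assms(2)])
  ultimately show ?thesis
    using assms(2) by (auto simp: differentiable_def)
qed

lemma Ck_on_SucD: "Ck_on (Suc k) S f \<Longrightarrow> Ck_on k S f"
proof (induction k arbitrary: f)
  case 0
  then show ?case
    by (simp add: continuous_at_imp_continuous_on differentiable_imp_continuous_within)
next
  case (Suc k)
  have "Ck_on k S (dx f)" "Ck_on k S (dy f)"
    using Suc.IH[of "dx f"] Suc.IH[of "dy f"] Ck_on.simps(2)[of "Suc k" S f] Suc.prems by blast+
  moreover have "\<forall>z\<in>S. f differentiable (at z)"
    using Ck_on.simps(2)[of "Suc k" S f] Suc.prems by blast
  ultimately show ?case by (simp only: Ck_on.simps)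
qed

lemma Ck_on_Suc_has_derivative:
  "Ck_on (Suc k) S f \<Longrightarrow> z \<in> S \<Longrightarrow> (f has_derivative frechet_derivative f (at z)) (at z)"
  by (simp add: frechet_derivative_works)

lemma Ck_on_continuous: "Ck_on k S f \<Longrightarrow> continuous_on S f"
proof (induction k)
  case (Suc k)
  then show ?case using Ck_on_SucD[OF Suc.prems] by blast
qed simp

lemma Ck_on_bounded_linear:
  assumes "open S" "bounded_linear T" "Ck_on k S f"
  shows "Ck_on k S (\<lambda>z. T (f z))"
  using assms(3)
proof (induction k arbitrary: f)
  case 0
  then show ?case
    using assms(2) by (simp add: bounded_linear.continuous_on)
next
  case (Suc k)
  show ?case
  proof (rule Ck_on_SucI[OF assms(1)])
    show "((\<lambda>z. T (f z)) has_derivative (\<lambda>h. T (frechet_derivative f (at z) h))) (at z)"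
      if "z \<in> S" for z
      using bounded_linear.has_derivative[OF assms(2) Ck_on_Suc_has_derivative[OF Suc.prems that]] .
    show "Ck_on k S (\<lambda>z. T (frechet_derivative f (at z) 1))"
      using Suc.IH[of "dx f"] Suc.prems by (simp add: dx_def[abs_def])
    show "Ck_on k S (\<lambda>z. T (frechet_derivative f (at z) \<i>))"
      using Suc.IH[of "dy f"] Suc.prems by (simp add: dy_def[abs_def])
  qed
qed

lemma Ck_on_add:
  assumes "open S" "Ck_on k S f" "Ck_on k S g"
  shows "Ck_on k S (\<lambda>z. f z + g z)"
  using assms(2,3)
proof (induction k arbitrary: f g)
  case 0
  then show ?case by (simp add: continuous_on_add)
next
  case (Suc k)
  show ?case
  proof (rule Ck_on_SucI[OF assms(1)])
    show "((\<lambda>z. f z + g z) has_derivative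
        (\<lambda>h. frechet_derivative f (at z) h + frechet_derivative g (at z) h)) (at z)"
      if "z \<in> S" for z
      using has_derivative_add[OF Ck_on_Suc_has_derivative[OF Suc.prems(1) that]
          Ck_on_Suc_has_derivative[OF Suc.prems(2) that]] .
  qed (use Suc.IH[of "dx f" "dx g"] Suc.IH[of "dy f" "dy g"] Suc.prems
        in \<open>simp_all add: dx_def[abs_def] dy_def[abs_def]\<close>)
qed

lemma Ck_on_bounded_bilinear:
  assumes "open S" "bounded_bilinear B" "Ck_on k S f" "Ck_on k S g"
  shows "Ck_on k S (\<lambda>z. B (f z) (g z))"
  using assms(3,4)
proof (induction k arbitrary: f g)
  case 0
  then show ?case
    using bounded_bilinear.continuous_on[OF assms(2)] by simp
next
  case (Suc k)
  have f: "Ck_on k S f" and g: "Ck_on k S g"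
    using Ck_on_SucD[OF Suc.prems(1)] Ck_on_SucD[OF Suc.prems(2)] .
  show ?case
  proof (rule Ck_on_SucI[OF assms(1)])
    show "((\<lambda>z. B (f z) (g z)) has_derivative
        (\<lambda>h. B (f z) (frechet_derivative g (at z) h) + B (frechet_derivative f (at z) h) (g z))) (at z)"
      if "z \<in> S" for z
      using bounded_bilinear.FDERIV[OF assms(2) Ck_on_Suc_has_derivative[OF Suc.prems(1) that]
          Ck_on_Suc_has_derivative[OF Suc.prems(2) that]] .
    show "Ck_on k S (\<lambda>z. B (f z) (frechet_derivative g (at z) 1) +
        B (frechet_derivative f (at z) 1) (g z))"
      using Suc.IH[of f "dx g"] Suc.IH[of "dx f" g] Suc.prems f g
      by (intro Ck_on_add[OF assms(1)]) (simp_all add: dx_def[abs_def])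
    show "Ck_on k S (\<lambda>z. B (f z) (frechet_derivative g (at z) \<i>) +
        B (frechet_derivative f (at z) \<i>) (g z))"
      using Suc.IH[of f "dy g"] Suc.IH[of "dy f" g] Suc.prems f g
      by (intro Ck_on_add[OF assms(1)]) (simp_all add: dy_def[abs_def])
  qed
qed

lemma smooth_onI: "(\<And>k. Ck_on k S f) \<Longrightarrow> smooth_on S f"
  unfolding smooth_on_def by (rule allI)

lemma smooth_onD: "smooth_on S f \<Longrightarrow> Ck_on k S f"
  unfolding smooth_on_def by (rule spec)

lemma smooth_on_bounded_linear:
  "open S \<Longrightarrow> bounded_linear T \<Longrightarrow> smooth_on S f \<Longrightarrow> smooth_on S (\<lambda>z. T (f z))"
  by (rule smooth_onI, rule Ck_on_bounded_linear[of S T _ f], assumption, assumption, rule smooth_onD)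

lemma smooth_on_bounded_bilinear:
  "open S \<Longrightarrow> bounded_bilinear B \<Longrightarrow> smooth_on S f \<Longrightarrow> smooth_on S g \<Longrightarrow>
    smooth_on S (\<lambda>z. B (f z) (g z))"
  by (rule smooth_onI, rule Ck_on_bounded_bilinear[of S B _ f g], assumption, assumption)
    (rule smooth_onD, assumption)+

lemma smooth_on_cong:
  "open S \<Longrightarrow> (\<And>z. z \<in> S \<Longrightarrow> f z = g z) \<Longrightarrow> smooth_on S f \<Longrightarrow> smooth_on S g"
  by (rule smooth_onI, rule Ck_on_cong[of S f g], assumption, assumption, rule smooth_onD)

lemma smooth_on_has_derivative:
  "smooth_on S f \<Longrightarrow> z \<in> S \<Longrightarrow> (f has_derivative frechet_derivative f (at z)) (at z)"
  by (rule Ck_on_Suc_has_derivative[OF smooth_onD])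

lemma smooth_on_const:
  assumes "open S" shows "smooth_on S (\<lambda>z. c :: 'b::real_normed_vector)"
proof -
  have "Ck_on k S (\<lambda>z. c)" for k and c :: "'b::real_normed_vector"
  proof (induction k arbitrary: c)
    case (Suc k)
    show ?case
      by (rule Ck_on_SucI[OF assms, where f' = "\<lambda>z h. 0"]) (use Suc[of 0] in \<open>simp_all\<close>)
  qed simp
  then show ?thesis by (rule smooth_onI)
qed

lemma smooth_on_holomorphic:
  assumes "open S" "f holomorphic_on S" shows "smooth_on S f"
proof -
  have "Ck_on k S f" for k
    using assms(2)
  proof (induction k arbitrary: f)
    case 0
    then show ?case by (simp add: holomorphic_on_imp_continuous_on)
  next
    case (Suc k)
    have d: "deriv f holomorphic_on S"
      using Suc.prems assms(1) by (simp add: holomorphic_deriv)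
    show ?case
    proof (rule Ck_on_SucI[OF assms(1)])
      show "(f has_derivative (\<lambda>h. deriv f z * h)) (at z)" if "z \<in> S" for z
        using holomorphic_derivI[OF Suc.prems assms(1) that]
        by (simp add: has_field_derivative_def)
      show "Ck_on k S (\<lambda>z. deriv f z * 1)" "Ck_on k S (\<lambda>z. deriv f z * \<i>)"
        by (rule Suc.IH, intro holomorphic_intros d)+
    qed
  qed
  then show ?thesis by (rule smooth_onI)
qed

text \<open>The derivative of \<open>exp \<circ> f\<close> contains \<open>exp \<circ> f\<close> itself, so smoothness comes by bootstrapping
  from order \<open>k\<close> to order \<open>k + 1\<close>; the same happens for the reciprocal.\<close>
lemma smooth_on_exp:
  fixes f :: "complex \<Rightarrow> real"
  assumes "open S" "smooth_on S f" shows "smooth_on S (\<lambda>z. exp (f z))"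
proof -
  have f: "Ck_on k S f" for k by (rule smooth_onD[OF assms(2)])
  have "Ck_on k S (\<lambda>z. exp (f z))" for k
  proof (induction k)
    case 0
    then show ?case using Ck_on_continuous[OF f] by (simp add: continuous_on_exp)
  next
    case (Suc k)
    show ?case
    proof (rule Ck_on_SucI[OF assms(1)])
      show "((\<lambda>z. exp (f z)) has_derivative (\<lambda>h. exp (f z) * frechet_derivative f (at z) h)) (at z)"
        if "z \<in> S" for z
        using smooth_on_has_derivative[OF assms(2) that] by (auto intro!: derivative_eq_intros)
      show "Ck_on k S (\<lambda>z. exp (f z) * frechet_derivative f (at z) 1)"
        by (rule Ck_on_bounded_bilinear[OF assms(1) bounded_bilinear_mult Suc])
          (use f[of "Suc k"] in \<open>simp add: dx_def[abs_def]\<close>)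
      show "Ck_on k S (\<lambda>z. exp (f z) * frechet_derivative f (at z) \<i>)"
        by (rule Ck_on_bounded_bilinear[OF assms(1) bounded_bilinear_mult Suc])
          (use f[of "Suc k"] in \<open>simp add: dy_def[abs_def]\<close>)
    qed
  qed
  then show ?thesis by (rule smooth_onI)
qed

lemma smooth_on_inverse:
  fixes f :: "complex \<Rightarrow> real"
  assumes "open S" "smooth_on S f" "\<And>z. z \<in> S \<Longrightarrow> f z \<noteq> 0"
  shows "smooth_on S (\<lambda>z. inverse (f z))"
proof -
  have f: "Ck_on k S f" for k by (rule smooth_onD[OF assms(2)])
  have "Ck_on k S (\<lambda>z. inverse (f z))" for k
  proof (induction k)
    case 0
    then show ?case using Ck_on_continuous[OF f] assms(3) by (simp add: continuous_on_inverse)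
  next
    case (Suc k)
    show ?case
    proof (rule Ck_on_SucI[OF assms(1)])
      show "((\<lambda>z. inverse (f z)) has_derivative
          (\<lambda>h. - (inverse (f z) * (frechet_derivative f (at z) h * inverse (f z))))) (at z)"
        if "z \<in> S" for z
        using smooth_on_has_derivative[OF assms(2) that] assms(3)[OF that]
        by (auto intro!: derivative_eq_intros)
      show "Ck_on k S (\<lambda>z. - (inverse (f z) * (frechet_derivative f (at z) 1 * inverse (f z))))"
        by (intro Ck_on_bounded_linear[OF assms(1) bounded_linear_minus[OF bounded_linear_ident]]
            Ck_on_bounded_bilinear[OF assms(1) bounded_bilinear_mult] Suc)
          (use f[of "Suc k"] in \<open>simp add: dx_def[abs_def]\<close>)
      show "Ck_on k S (\<lambda>z. - (inverse (f z) * (frechet_derivative f (at z) \<i> * inverse (f z))))"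
        by (intro Ck_on_bounded_linear[OF assms(1) bounded_linear_minus[OF bounded_linear_ident]]
            Ck_on_bounded_bilinear[OF assms(1) bounded_bilinear_mult] Suc)
          (use f[of "Suc k"] in \<open>simp add: dy_def[abs_def]\<close>)
    qed
  qed
  then show ?thesis by (rule smooth_onI)
qed

lemma smooth_on_ln:
  fixes f :: "complex \<Rightarrow> real"
  assumes "open S" "smooth_on S f" "\<And>z. z \<in> S \<Longrightarrow> f z > 0"
  shows "smooth_on S (\<lambda>z. ln (f z))"
proof -
  have f: "Ck_on k S f" for k by (rule smooth_onD[OF assms(2)])
  have nz: "f z \<noteq> 0" if "z \<in> S" for z using assms(3)[OF that] by simp
  have inv: "Ck_on k S (\<lambda>z. inverse (f z))" for k
    by (rule smooth_onD[OF smooth_on_inverse[OF assms(1,2) nz]])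
  have "Ck_on k S (\<lambda>z. ln (f z))" for k
  proof (cases k)
    case 0
    then show ?thesis using Ck_on_continuous[OF f] nz by (simp add: continuous_on_ln)
  next
    case (Suc m)
    have "Ck_on (Suc m) S (\<lambda>z. ln (f z))"
    proof (rule Ck_on_SucI[OF assms(1)])
      show "((\<lambda>z. ln (f z)) has_derivative
          (\<lambda>h. inverse (f z) * frechet_derivative f (at z) h)) (at z)"
        if "z \<in> S" for z
        using smooth_on_has_derivative[OF assms(2) that] assms(3)[OF that]
        by (auto intro!: derivative_eq_intros simp: divide_inverse)
      show "Ck_on m S (\<lambda>z. inverse (f z) * frechet_derivative f (at z) 1)"
        by (rule Ck_on_bounded_bilinear[OF assms(1) bounded_bilinear_mult inv])
          (use f[of "Suc m"] in \<open>simp add: dx_def[abs_def]\<close>)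
      show "Ck_on m S (\<lambda>z. inverse (f z) * frechet_derivative f (at z) \<i>)"
        by (rule Ck_on_bounded_bilinear[OF assms(1) bounded_bilinear_mult inv])
          (use f[of "Suc m"] in \<open>simp add: dy_def[abs_def]\<close>)
    qed
    then show ?thesis by (simp add: Suc)
  qed
  then show ?thesis by (rule smooth_onI)
qed

section \<open>Two by two matrices\<close>

lemma mat22_nth [simp]:
  "mat22 a b c d $ 1 $ 1 = a" "mat22 a b c d $ 1 $ 2 = b"
  "mat22 a b c d $ 2 $ 1 = c" "mat22 a b c d $ 2 $ 2 = d"
  by (simp_all add: mat22_def)

lemma mat2_eq_iff:
  "(A :: mat2) = B \<longleftrightarrow> A $ 1 $ 1 = B $ 1 $ 1 \<and> A $ 1 $ 2 = B $ 1 $ 2 \<and>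
     A $ 2 $ 1 = B $ 2 $ 1 \<and> A $ 2 $ 2 = B $ 2 $ 2"
  by (auto simp: vec_eq_iff forall_2)

lemma mult22_nth: "((A :: mat2) ** B) $ i $ j = A $ i $ 1 * B $ 1 $ j + A $ i $ 2 * B $ 2 $ j"
  by (simp add: matrix_matrix_mult_def sum_2)

lemma mat1_nth [simp]:
  "(mat 1 :: mat2) $ 1 $ 1 = 1" "(mat 1 :: mat2) $ 1 $ 2 = 0"
  "(mat 1 :: mat2) $ 2 $ 1 = 0" "(mat 1 :: mat2) $ 2 $ 2 = 1"
  by (simp_all add: mat_def)

lemma cscale_nth [simp]: "cscale c A $ i $ j = c * A $ i $ j"
  by (simp add: cscale_def)

lemma adj_nth [simp]: "adj A $ i $ j = cnj (A $ j $ i)"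
  by (simp add: adj_def)

lemma det22: "det (A :: mat2) = A $ 1 $ 1 * A $ 2 $ 2 - A $ 1 $ 2 * A $ 2 $ 1"
  by (rule det_2)

text \<open>On matrices of determinant \<open>1\<close> this is the inverse. Unlike the inverse it is linear, so that
  derivatives and holomorphy pass through it without a side condition.\<close>
definition adjugate :: "mat2 \<Rightarrow> mat2" where
  "adjugate A = mat22 (A $ 2 $ 2) (- A $ 1 $ 2) (- A $ 2 $ 1) (A $ 1 $ 1)"

lemma adjugate_nth [simp]:
  "adjugate A $ 1 $ 1 = A $ 2 $ 2" "adjugate A $ 1 $ 2 = - A $ 1 $ 2"
  "adjugate A $ 2 $ 1 = - A $ 2 $ 1" "adjugate A $ 2 $ 2 = A $ 1 $ 1"
  by (simp_all add: adjugate_def)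

lemma mult_adjugate:
  assumes "det A = 1" shows "A ** adjugate A = mat 1" "adjugate A ** A = mat 1"
  using assms by (auto simp: mat2_eq_iff mult22_nth det22 algebra_simps)

lemma adj_mult: "adj (A ** B) = adj B ** adj A"
  by (simp add: mat2_eq_iff mult22_nth algebra_simps)

lemma matrix_inv_eq_adjugate:
  assumes "det A = 1" shows "matrix_inv A = adjugate A"
  unfolding matrix_inv_def
proof (rule some_equality)
  show "A ** adjugate A = mat 1 \<and> adjugate A ** A = mat 1"
    using mult_adjugate[OF assms] by simp
  show "X = adjugate A" if "A ** X = mat 1 \<and> X ** A = mat 1" for X
    using that mult_adjugate[OF assms] by (metis matrix_mul_assoc matrix_mul_lid matrix_mul_rid)
qed

lemma mat2_left_cancel:
  fixes A X Y :: mat2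
  assumes "det A = 1" "A ** X = A ** Y" shows "X = Y"
  using assms mult_adjugate[OF assms(1)] by (metis matrix_mul_assoc matrix_mul_lid)

lemma bounded_bilinear_mat2_mult: "bounded_bilinear ((**) :: mat2 \<Rightarrow> mat2 \<Rightarrow> mat2)"
  unfolding bilinear_conv_bounded_bilinear[symmetric] bilinear_def
  by (auto intro!: linearI simp: mat2_eq_iff mult22_nth algebra_simps)

lemma bounded_linear_adj: "bounded_linear adj"
  unfolding linear_conv_bounded_linear[symmetric]
  by (auto intro!: linearI simp: mat2_eq_iff)

lemma bounded_linear_adjugate: "bounded_linear adjugate"
  unfolding linear_conv_bounded_linear[symmetric]
  by (auto intro!: linearI simp: mat2_eq_iff)

lemma bounded_linear_mat2_nth: "bounded_linear (\<lambda>A :: mat2. A $ i $ j)"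
  unfolding linear_conv_bounded_linear[symmetric]
  by (auto intro!: linearI)

lemma has_derivative_mat2I:
  fixes f :: "'a::real_normed_vector \<Rightarrow> mat2"
  assumes "\<And>i j. ((\<lambda>x. f x $ i $ j) has_derivative (\<lambda>h. f' h $ i $ j)) (at z)"
  shows "(f has_derivative f') (at z)"
proof -
  have v: "((\<lambda>x. \<chi> i. g x i) has_derivative (\<lambda>h. \<chi> i. g' h i)) (at z)"
    if g: "\<And>i. ((\<lambda>x. g x i) has_derivative (\<lambda>h. g' h i)) (at z)"
    for g :: "'a \<Rightarrow> 2 \<Rightarrow> 'b::euclidean_space" and g'
  proof -
    have "((\<lambda>x. (\<chi> i. g x i) \<bullet> b) has_derivative (\<lambda>h. (\<chi> i. g' h i) \<bullet> b)) (at z)" for b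
      unfolding inner_vec_def sum_2 vec_lambda_beta
      by (intro has_derivative_add has_derivative_inner_left g)
    then show ?thesis
      using has_derivative_componentwise_within[of "\<lambda>x. \<chi> i. g x i" _ z UNIV] by blast
  qed
  have "((\<lambda>x. \<chi> i. \<chi> j. f x $ i $ j) has_derivative (\<lambda>h. \<chi> i. \<chi> j. f' h $ i $ j)) (at z)"
    by (rule v, rule v, rule assms)
  then show ?thesis by simp
qed

text \<open>The involution \<open>tau4\<close> is evaluation at \<open>\<i> / cnj lam\<close> followed by this map on matrices of
  determinant \<open>1\<close>. It is multiplicative and real linear; linearity lets the same map act on the
  derivative of a frame, where on trace free matrices it is the involution of the Lie algebra.\<close>
definition reflect :: "mat2 \<Rightarrow> mat2" where
  "reflect X = mat22 (cnj (X $ 2 $ 2)) (\<i> * cnj (X $ 2 $ 1)) (- \<i> * cnj (X $ 1 $ 2)) (cnj (X $ 1 $ 1))"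

lemma reflect_nth [simp]:
  "reflect X $ 1 $ 1 = cnj (X $ 2 $ 2)" "reflect X $ 1 $ 2 = \<i> * cnj (X $ 2 $ 1)"
  "reflect X $ 2 $ 1 = - \<i> * cnj (X $ 1 $ 2)" "reflect X $ 2 $ 2 = cnj (X $ 1 $ 1)"
  by (simp_all add: reflect_def)

lemma reflect_mult: "reflect (X ** Y) = reflect X ** reflect Y"
  by (simp add: mat2_eq_iff mult22_nth algebra_simps)

lemma bounded_linear_reflect: "bounded_linear reflect"
  unfolding linear_conv_bounded_linear[symmetric]
  by (auto intro!: linearI simp: mat2_eq_iff algebra_simps)

lemma Ad_Rmat: "Ad Rmat X = mat22 (X $ 1 $ 1) (- \<i> * X $ 1 $ 2) (\<i> * X $ 2 $ 1) (X $ 2 $ 2)"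
proof -
  have sq: "csqrt \<i> * csqrt \<i> = \<i>"
    using power2_csqrt[of \<i>] by (simp add: power2_eq_square)
  then have nz: "csqrt \<i> \<noteq> 0" by (metis mult_zero_left complex_i_not_zero)
  have d: "det Rmat = 1" using nz by (simp add: Rmat_def det22 del: csqrt_ii)
  have conj: "1 / r * x * r = x" "1 / r * x * (1 / r) = - \<i> * x" "r * x * r = \<i> * x"
    "r * x * (1 / r) = x"
    if "r * r = \<i>" "r \<noteq> 0" for r x :: complex
  proof -
    have "1 / r * x * (1 / r) = x / (r * r)" by simp
    then show "1 / r * x * (1 / r) = - \<i> * x" unfolding that by (simp add: divide_inverse)
    show "r * x * r = \<i> * x" unfolding that(1)[symmetric] by simp
  qed (use that in simp_all)
  show ?thesis
    unfolding Ad_def matrix_inv_eq_adjugate[OF d]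
    by (simp add: mat2_eq_iff mult22_nth Rmat_def conj[OF sq nz] del: csqrt_ii times_divide_eq_left
        times_divide_eq_right mult_1_left)
qed

lemma tau4_eq_reflect:
  assumes "det (g (\<i> / cnj lam)) = 1"
  shows "tau4 g lam = reflect (g (\<i> / cnj lam))"
proof -
  have "det (adj (g (\<i> / cnj lam))) = cnj (det (g (\<i> / cnj lam)))"
    by (simp add: det22 mult.commute)
  then have "det (adj (g (\<i> / cnj lam))) = 1" using assms by simp
  then show ?thesis
    by (simp add: tau4_def matrix_inv_eq_adjugate Ad_Rmat mat2_eq_iff)
qed

lemma sigma_eq: "sigma X = mat22 (X $ 1 $ 1) (- X $ 1 $ 2) (- X $ 2 $ 1) (X $ 2 $ 2)"
proof -
  have "matrix_inv (mat22 1 0 0 (-1)) = mat22 1 0 0 (-1)"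
    unfolding matrix_inv_def
  proof (rule some_equality)
    show "mat22 1 0 0 (-1) ** mat22 1 0 0 (-1) = mat 1 \<and> mat22 1 0 0 (-1) ** mat22 1 0 0 (-1) = mat 1"
      by (simp add: mat2_eq_iff mult22_nth)
    show "X = mat22 1 0 0 (-1)"
      if "mat22 1 0 0 (-1) ** X = mat 1 \<and> X ** mat22 1 0 0 (-1) = mat 1" for X
      using that by (auto simp add: mat2_eq_iff mult22_nth minus_equation_iff)
  qed
  then show ?thesis
    by (simp add: sigma_def Ad_def mat2_eq_iff mult22_nth)
qed

lemma sigma_mult: "sigma (X ** Y) = sigma X ** sigma Y"
  by (simp add: sigma_eq mat2_eq_iff mult22_nth algebra_simps)

lemma bounded_linear_sigma: "bounded_linear sigma"
  unfolding linear_conv_bounded_linear[symmetric]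
  by (auto intro!: linearI simp: sigma_eq mat2_eq_iff algebra_simps)

section \<open>Holomorphic functions on the two sides of the unit circle\<close>

text \<open>The exponential map turns the circle into a straight line, across which continuous
  functions that are holomorphic on both sides are holomorphic.\<close>
lemma holomorphic_on_paste_across_circle:
  assumes A: "continuous_on (cball 0 1 - {0}) A" "A holomorphic_on ball 0 1 - {0}"
    and B: "continuous_on {w. 1 \<le> norm w} B" "B holomorphic_on {w. 1 < norm w}"
    and eq: "\<And>w. norm w = 1 \<Longrightarrow> A w = B w"
  shows "(\<lambda>w. if norm w \<le> 1 then A w else B w) holomorphic_on - {0}"
proof -
  define E where "E = (\<lambda>w. if norm w \<le> 1 then A w else B w)"
  have contE: "continuous_on (- {0}) E"
  proof -
    have "continuous_on ((cball 0 1 - {0}) \<union> {w. 1 \<le> norm w}) E"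
      unfolding E_def
    proof (rule continuous_on_cases_local)
      show "closedin (top_of_set (cball 0 1 - {0} \<union> {w. 1 \<le> norm w})) (cball 0 1 - {0})"
        by (rule closedin_subset_trans[of "- {0}"])
          (auto simp: closedin_closed Compl_eq_Diff_UNIV intro!: exI[of _ "cball 0 1"])
      show "closedin (top_of_set (cball 0 1 - {0} \<union> {w. 1 \<le> norm w})) {w. 1 \<le> norm w}"
        by (auto simp: closedin_closed intro!: exI[of _ "{w. 1 \<le> norm w}"] closed_Collect_le
            continuous_intros)
    qed (use A B eq in auto)
    moreover have "- {0} = (cball 0 1 - {0}) \<union> {w :: complex. 1 \<le> norm w}"
      by (auto simp: not_le)
    ultimately show ?thesis by simp
  qed
  have hol: "(E \<circ> exp) holomorphic_on UNIV"
  proof (rule holomorphic_on_paste_across_line[where d = "1 :: complex" and k = 0])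
    have "(A \<circ> exp) holomorphic_on {z. Re z < 0}"
      by (rule holomorphic_on_compose_gen[OF _ A(2)]) (auto intro: holomorphic_intros)
    then show "E \<circ> exp holomorphic_on UNIV \<inter> {z. 1 \<bullet> z < 0}"
      by (rule holomorphic_transform[THEN holomorphic_on_subset]) (auto simp: E_def inner_complex_def)
    have "(B \<circ> exp) holomorphic_on {z. Re z > 0}"
      by (rule holomorphic_on_compose_gen[OF _ B(2)]) (auto intro: holomorphic_intros)
    then show "E \<circ> exp holomorphic_on UNIV \<inter> {z. 0 < 1 \<bullet> z}"
      by (rule holomorphic_transform[THEN holomorphic_on_subset]) (auto simp: E_def inner_complex_def)
    show "continuous_on UNIV (E \<circ> exp)"
      by (rule continuous_on_compose, intro continuous_intros)
        (rule continuous_on_subset[OF contE], auto)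
  qed auto
  have "E field_differentiable (at w)" if w: "w \<noteq> 0" for w
  proof -
    define c where "c = (if w \<in> \<real>\<^sub>\<le>\<^sub>0 then - 1 else 1 :: complex)"
    have c: "c \<noteq> 0" "c * c = 1" "w * c \<notin> \<real>\<^sub>\<le>\<^sub>0"
      using w by (auto simp: c_def complex_nonpos_Reals_iff complex_eq_iff)
    define l where "l = (\<lambda>v. Ln (v * c) + Ln c)"
    have ex: "exp (l v) = v" if "v \<noteq> 0" for v
      using that c by (simp add: l_def exp_add mult.assoc)
    define T where "T = {v. v * c \<notin> \<real>\<^sub>\<le>\<^sub>0}"
    have T: "open T" unfolding T_def
      using open_vimage[of "- \<real>\<^sub>\<le>\<^sub>0" "\<lambda>v. v * c"]
      by (simp add: vimage_def open_Compl continuous_intros)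
    have "l holomorphic_on T"
      unfolding l_def by (intro holomorphic_intros) (auto simp: T_def)
    then have "((E \<circ> exp) \<circ> l) holomorphic_on T"
      by (rule holomorphic_on_compose_gen[OF _ hol]) auto
    moreover have "((E \<circ> exp) \<circ> l) v = E v" if "v \<in> T" for v
    proof -
      have "v \<noteq> 0" using that by (auto simp: T_def)
      then show ?thesis using ex[of v] by simp
    qed
    ultimately have "E holomorphic_on T"
      by (rule holomorphic_transform)
    moreover have "w \<in> T" using c by (simp add: T_def)
    ultimately show ?thesis
      using T holomorphic_on_imp_differentiable_at by blast
  qed
  then show ?thesis
    unfolding E_def[symmetric] by (simp add: holomorphic_on_def field_differentiable_at_within)
qed

text \<open>The two functions are the restrictions of an entire function and of its transform under
  inversion; being bounded, it is constant.\<close>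
lemma disc_functions_matching_by_inversion:
  assumes A: "continuous_on (cball 0 1) A" "A holomorphic_on ball 0 1"
    and b: "continuous_on (cball 0 1) b" "b holomorphic_on ball 0 1"
    and eq: "\<And>w. norm w = 1 \<Longrightarrow> A w = b (inverse w)"
  shows "\<forall>w\<in>cball 0 1. A w = b 0 \<and> b w = b 0"
proof -
  define E where "E = (\<lambda>w. if norm w \<le> 1 then A w else b (inverse w))"
  have inv: "inverse ` {w :: complex. 1 \<le> norm w} \<subseteq> cball 0 1"
    "inverse ` {w :: complex. 1 < norm w} \<subseteq> ball 0 1"
    by (auto simp: norm_inverse inverse_le_1_iff inverse_less_1_iff)
  have "E holomorphic_on - {0}"
    unfolding E_def
  proof (rule holomorphic_on_paste_across_circle)
    show "continuous_on {w. 1 \<le> norm w} (\<lambda>w. b (inverse w))"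
      by (rule continuous_on_compose2[OF b(1) _ inv(1)]) (auto intro!: continuous_intros)
    have "(b \<circ> inverse) holomorphic_on {w. 1 < norm w}"
      by (rule holomorphic_on_compose_gen[OF _ b(2)])
        (use inv in \<open>auto intro!: holomorphic_intros\<close>)
    then show "(\<lambda>w. b (inverse w)) holomorphic_on {w. 1 < norm w}" by (simp add: comp_def)
  qed (use A eq in \<open>auto intro: continuous_on_subset holomorphic_on_subset\<close>)
  moreover have "E holomorphic_on ball 0 1"
    by (rule holomorphic_transform[OF A(2)]) (auto simp: E_def)
  ultimately have "E holomorphic_on (- {0} \<union> ball 0 1)"
    by (intro holomorphic_on_Un) (auto simp: open_Compl)
  moreover have "- {0} \<union> ball 0 1 = (UNIV :: complex set)" by auto
  ultimately have "E holomorphic_on UNIV" by simp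
  moreover have "bounded (range E)"
  proof (rule bounded_subset)
    show "bounded (A ` cball 0 1 \<union> b ` cball 0 1)"
      using compact_continuous_image[OF A(1)] compact_continuous_image[OF b(1)]
      by (simp add: compact_imp_bounded)
    show "range E \<subseteq> A ` cball 0 1 \<union> b ` cball 0 1"
    proof
      fix y assume "y \<in> range E"
      then obtain x where "y = E x" by auto
      then show "y \<in> A ` cball 0 1 \<union> b ` cball 0 1"
        using inv(2) by (cases "norm x \<le> 1") (auto simp: E_def not_le image_subset_iff)
    qed
  qed
  ultimately obtain c where c: "\<And>w. E w = c"
    using Liouville_theorem[of E] by (auto simp: constant_on_def)
  have Ac: "A w = c" if "norm w \<le> 1" for w
    using c[of w] that by (simp add: E_def)
  have bc: "b w = c" if "norm w \<le> 1" "w \<noteq> 0" for w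
  proof (cases "norm w = 1")
    case True
    then show ?thesis using eq[of "inverse w"] Ac[of "inverse w"] by (simp add: norm_inverse)
  next
    case False
    then have "norm (inverse w) > 1" using that by (simp add: norm_inverse one_less_inverse_iff)
    then show ?thesis using c[of "inverse w"] by (simp add: E_def)
  qed
  have "b 0 = c"
  proof -
    have "(b \<longlongrightarrow> b 0) (at 0)"
      using b(2) holomorphic_on_imp_differentiable_at[of b "ball 0 1" 0]
        field_differentiable_imp_continuous_at isCont_def by fastforce
    moreover have "(b \<longlongrightarrow> c) (at 0)"
      by (rule tendsto_eventually)
        (auto simp: eventually_at bc intro!: exI[of _ 1])
    ultimately show ?thesis using LIM_unique by blast
  qed
  then show ?thesis using Ac bc by (metis mem_cball_0)
qed

lemma disc_functions_eq_if_eq_on_circle: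
  assumes "continuous_on (cball 0 1) A" "A holomorphic_on ball 0 1"
    and "continuous_on (cball 0 1) B" "B holomorphic_on ball 0 1"
    and eq: "\<And>w. norm w = 1 \<Longrightarrow> A w = B w" and w: "norm w \<le> 1"
  shows "A w = B w"
proof -
  have "\<forall>w\<in>cball 0 1. A w - B w = 0 \<and> 0 = (0 :: complex)"
    by (rule disc_functions_matching_by_inversion)
      (use assms in \<open>auto intro!: continuous_intros holomorphic_intros\<close>)
  then show ?thesis using w by simp
qed

text \<open>Dividing out the constant term does not affect continuity up to the boundary, because the
  quotient differs from an ordinary quotient only at the centre.\<close>
lemma difference_quotient_at_0:
  assumes "continuous_on (cball 0 1) P" "P holomorphic_on ball 0 1"
  obtains p where "continuous_on (cball 0 1) p" "p holomorphic_on ball 0 1"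
    "\<And>w. w \<in> cball 0 1 \<Longrightarrow> P w = P 0 + w * p w" "p 0 = deriv P 0"
proof -
  define p where "p = (\<lambda>w. if w = 0 then deriv P 0 else (P w - P 0) / w)"
  have "p holomorphic_on ball 0 1 \<longleftrightarrow> (\<lambda>w. if w = 0 then deriv P 0
      else (P w / w) - P 0 / (w - 0)) holomorphic_on ball 0 1"
    by (rule holomorphic_cong) (auto simp: p_def diff_divide_distrib)
  then have hol: "p holomorphic_on ball 0 1"
    using pole_theorem_open[OF assms(2), of 0 "\<lambda>w. P w / w"] by simp
  have "continuous_on {w. 1/2 \<le> norm w \<and> norm w \<le> 1} (\<lambda>w. (P w - P 0) / w)"
    by (auto intro!: continuous_intros continuous_on_subset[OF assms(1)])
  then have "continuous_on {w. 1/2 \<le> norm w \<and> norm w \<le> 1} p"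
    by (rule continuous_on_eq) (auto simp: p_def)
  moreover have "continuous_on (cball 0 (1/2)) p"
    by (rule continuous_on_subset[OF holomorphic_on_imp_continuous_on[OF hol]]) auto
  moreover have "closed {w :: complex. 1/2 \<le> norm w \<and> norm w \<le> 1}"
    by (intro closed_Collect_conj closed_Collect_le continuous_intros)
  ultimately have "continuous_on (cball 0 (1/2) \<union> {w. 1/2 \<le> norm w \<and> norm w \<le> 1}) p"
    by (intro continuous_on_closed_Un) auto
  moreover have "cball 0 (1/2) \<union> {w :: complex. 1/2 \<le> norm w \<and> norm w \<le> 1} = cball 0 1"
    by auto
  ultimately have "continuous_on (cball 0 1) p" by simp
  then show ?thesis
    by (rule that[OF _ hol]) (auto simp: p_def)
qed

lemma disc_function_cnj_cnj:
  assumes "continuous_on (cball 0 1) q" "q holomorphic_on ball 0 1"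
  shows "continuous_on (cball 0 1) (\<lambda>w. cnj (q (\<i> * cnj w)))"
    and "(\<lambda>w. cnj (q (\<i> * cnj w))) holomorphic_on ball 0 1"
proof -
  show "continuous_on (cball 0 1) (\<lambda>w. cnj (q (\<i> * cnj w)))"
    by (intro continuous_intros continuous_on_compose2[OF assms(1)]) (auto simp: norm_mult)
  have "q \<circ> (\<lambda>w. \<i> * w) holomorphic_on ball 0 1"
    by (rule holomorphic_on_compose_gen[OF _ assms(2)])
      (auto intro!: holomorphic_intros simp: norm_mult)
  moreover have "cnj ` ball 0 1 = ball 0 1"
    by (auto simp: in_image_cnj_iff)
  ultimately show "(\<lambda>w. cnj (q (\<i> * cnj w))) holomorphic_on ball 0 1"
    using holomorphic_on_compose_cnj_cnj[of "q \<circ> (\<lambda>w. \<i> * w)" "ball 0 1"] by (simp add: comp_def)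
qed

text \<open>The function \<open>P w / w\<close> is meromorphic on the disc with at most a simple pole at \<open>0\<close>, and its boundary values are
  given by the conjugates of another such function, so it continues by reflection to the sphere with at
  most a simple pole at infinity. Hence it has only the powers \<open>-1\<close>, \<open>0\<close>, \<open>1\<close> of \<open>w\<close>, and the coefficient
  at infinity is the reflected one at \<open>0\<close>. The factor \<open>\<i>\<close> in the argument is the rotation that \<open>tau4\<close>
  performs on the circle.\<close>
lemma laurent_polynomial_of_reflection:
  assumes P: "continuous_on (cball 0 1) P" "P holomorphic_on ball 0 1"
    and Q: "continuous_on (cball 0 1) Q" "Q holomorphic_on ball 0 1"
    and eq: "\<And>w. norm w = 1 \<Longrightarrow> P w / w = k * cnj (Q (\<i> * w) / (\<i> * w))"
    and w: "norm w \<le> 1"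
  shows "P w = P 0 + deriv P 0 * w + \<i> * k * cnj (Q 0) * w\<^sup>2"
proof -
  obtain p where p: "continuous_on (cball 0 1) p" "p holomorphic_on ball 0 1"
    "\<And>w. w \<in> cball 0 1 \<Longrightarrow> P w = P 0 + w * p w" "p 0 = deriv P 0"
    by (rule difference_quotient_at_0[OF P]) (rule that)
  obtain q where q: "continuous_on (cball 0 1) q" "q holomorphic_on ball 0 1"
    "\<And>w. w \<in> cball 0 1 \<Longrightarrow> Q w = Q 0 + w * q w"
    by (rule difference_quotient_at_0[OF Q]) (rule that)
  define A where "A = (\<lambda>w. p w - \<i> * k * cnj (Q 0) * w)"
  define b where "b = (\<lambda>w. k * cnj (q (\<i> * cnj w)) - P 0 * w)"
  have "\<forall>w\<in>cball 0 1. A w = b 0 \<and> b w = b 0"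
  proof (rule disc_functions_matching_by_inversion)
    show "A w = b (inverse w)" if w: "norm w = 1" for w
    proof -
      have nz: "w \<noteq> 0" using w by auto
      have inv: "cnj (inverse w) = w"
        using w nz complex_norm_square[of w] by (simp add: field_simps)
      then have cw: "cnj w = inverse w" by (metis complex_cnj_cnj)
      have Pw: "P w / w = P 0 / w + p w"
        using p(3)[of w] w nz by (simp add: field_simps)
      have "Q (\<i> * w) / (\<i> * w) = Q 0 / (\<i> * w) + q (\<i> * w)"
        using q(3)[of "\<i> * w"] w nz by (simp add: norm_mult field_simps)
      then have "cnj (Q (\<i> * w) / (\<i> * w)) = cnj (Q 0) * \<i> * w + cnj (q (\<i> * w))"
        using nz by (simp add: cw divide_inverse)
      then have "P 0 / w + p w = k * (cnj (Q 0) * \<i> * w + cnj (q (\<i> * w)))"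
        using eq[OF w] Pw by simp
      moreover have "b (inverse w) = k * cnj (q (\<i> * w)) - P 0 / w"
        unfolding b_def inv by (simp add: divide_inverse)
      moreover have "p w = k * (cnj (Q 0) * \<i> * w + cnj (q (\<i> * w))) - P 0 / w"
        using calculation(1) by (metis add_diff_cancel_left')
      ultimately show ?thesis
        by (simp add: A_def distrib_left mult.commute mult.left_commute)
    qed
    show "continuous_on (cball 0 1) A" "A holomorphic_on ball 0 1"
      unfolding A_def by (intro continuous_intros holomorphic_intros p(1,2))+
    show "continuous_on (cball 0 1) b" "b holomorphic_on ball 0 1"
      unfolding b_def by (intro continuous_intros holomorphic_intros disc_function_cnj_cnj q(1,2))+
  qed
  then have all: "A v = b 0" if "v \<in> cball 0 1" for v
    using that by blast
  have "A w = A 0"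
    using all[of w] all[of 0] w by simp
  then have "p w - \<i> * k * cnj (Q 0) * w = deriv P 0"
    by (simp add: A_def p(4))
  then have pw: "p w = deriv P 0 + \<i> * k * cnj (Q 0) * w"
    by (simp only: diff_eq_eq)
  have "P w = P 0 + w * p w" by (rule p(3)) (use w in simp)
  also have "\<dots> = P 0 + deriv P 0 * w + \<i> * k * cnj (Q 0) * w\<^sup>2"
    unfolding pw by (simp add: distrib_left power2_eq_square mult.commute mult.left_commute)
  finally show ?thesis .
qed

section \<open>Linear differential equations depending holomorphically on a parameter\<close>

text \<open>Cauchy's formula represents the derivative in the parameter as an integral that is continuous
  in all variables, which justifies differentiation under the integral sign.\<close>
lemma holomorphic_on_integral_parameter:
  fixes F :: "complex \<Rightarrow> real \<Rightarrow> complex"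
  assumes "open L" and cont: "continuous_on (L \<times> {0..1}) (\<lambda>(l, t). F l t)"
    and hol: "\<And>t. t \<in> {0..1} \<Longrightarrow> (\<lambda>l. F l t) holomorphic_on L"
  shows "(\<lambda>l. integral {0..1} (F l)) holomorphic_on L"
proof -
  have "(\<lambda>l. integral {0..1} (F l)) field_differentiable (at l0)" if l0: "l0 \<in> L" for l0
  proof -
    obtain r where r: "r > 0" "cball l0 r \<subseteq> L"
      using assms(1) l0 open_contains_cball by blast
    define F' where "F' = (\<lambda>l t. 1 / (2 * of_real pi * \<i>) *
      contour_integral (circlepath l0 r) (\<lambda>u. F u t / (u - l)\<^sup>2))"
    have der: "((\<lambda>l. F l t) has_field_derivative F' l t) (at l)"
      if "l \<in> ball l0 r" "t \<in> {0..1}" for l t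
      unfolding F'_def
    proof (rule Cauchy_derivative_integral_circlepath)
      show "continuous_on (cball l0 r) (\<lambda>l. F l t)"
        using holomorphic_on_imp_continuous_on[OF hol[OF that(2)]] r(2) continuous_on_subset by blast
      show "(\<lambda>l. F l t) holomorphic_on ball l0 r"
        using holomorphic_on_subset[OF hol[OF that(2)]] r(2) ball_subset_cball by blast
    qed (use that in auto)
    define c where "c = (\<lambda>s :: real. l0 + of_real r * exp (2 * of_real pi * \<i> * of_real s))"
    have c: "norm (c s - l0) = r" "c s \<in> L" for s
    proof -
      have "norm (exp (2 * of_real pi * \<i> * of_real s)) = 1" by simp
      then show n: "norm (c s - l0) = r" using r(1) by (simp add: c_def norm_mult)
      then show "c s \<in> L" using r(2) by (auto simp: dist_norm norm_minus_commute)
    qed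
    have contc: "continuous_on UNIV c"
      unfolding c_def by (intro continuous_intros)
    have "continuous_on (ball l0 r \<times> {0..1}) (\<lambda>x. integral (cbox 0 1)
        (\<lambda>s. F (c s) (snd x) / (c s - fst x)\<^sup>2 * (2 * pi * \<i> * r * exp (2 * of_real pi * \<i> * s))))"
    proof (rule integral_continuous_on_param)
      have Fc: "continuous_on ((ball l0 r \<times> {0..1}) \<times> cbox 0 1) (\<lambda>y. F (c (snd y)) (snd (fst y)))"
        by (rule continuous_on_compose2[OF cont, of _ "\<lambda>y. (c (snd y), snd (fst y))", simplified])
          (auto intro!: continuous_intros continuous_on_compose2[OF contc] c(2))
      have "c s \<noteq> l" if "l \<in> ball l0 r" for s l
        using c(1)[of s] that by (auto simp: dist_norm norm_minus_commute)
      then show "continuous_on ((ball l0 r \<times> {0..1}) \<times> cbox 0 1) (\<lambda>(x, s). F (c s) (snd x) /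
          (c s - fst x)\<^sup>2 * (2 * pi * \<i> * r * exp (2 * of_real pi * \<i> * s)))"
        unfolding split_beta
        by (intro continuous_intros Fc) (auto simp: c_def[abs_def] intro!: continuous_intros)
    qed
    then have contF': "continuous_on (ball l0 r \<times> cbox 0 1) (\<lambda>(l, t). F' l t)"
      unfolding F'_def split_beta contour_integral_integral circlepath[abs_def]
        vector_derivative_circlepath[unfolded circlepath]
      by (intro continuous_intros) (simp add: c_def)
    have "(\<lambda>l. integral (cbox 0 1) (F l)) holomorphic_on ball l0 r"
    proof (rule leibniz_rule_holomorphic[OF _ _ contF'])
      show "((\<lambda>x. F x t) has_field_derivative F' l t) (at l within ball l0 r)"
        if "l \<in> ball l0 r" "t \<in> cbox 0 1" for l t
        using der[of l t] that by (auto intro: has_field_derivative_at_within)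
      show "F l integrable_on cbox 0 1" if "l \<in> ball l0 r" for l
      proof (rule integrable_continuous)
        have "l \<in> L" using that r(2) by auto
        then show "continuous_on (cbox 0 1) (F l)"
          by (intro continuous_on_compose2[OF cont, of _ "\<lambda>t. (l, t)", simplified])
            (auto intro!: continuous_intros)
      qed
    qed auto
    then show ?thesis
      using r(1) holomorphic_on_imp_differentiable_at[of _ "ball l0 r" l0] by simp
  qed
  then show ?thesis
    by (simp add: holomorphic_on_def field_differentiable_at_within)
qed

text \<open>Iterates for one row of a matrix solution; \<open>c l j\<close> is its value at \<open>z1\<close> for the parameter \<open>l\<close>,
  and the integral is taken along the segment from \<open>z1\<close> to \<open>z\<close>.\<close>
primrec picard_iterate ::
    "(complex \<Rightarrow> complex \<Rightarrow> mat2) \<Rightarrow> (complex \<Rightarrow> 2 \<Rightarrow> complex) \<Rightarrow> complex \<Rightarrow> nat \<Rightarrow>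
     complex \<Rightarrow> complex \<Rightarrow> 2 \<Rightarrow> complex" where
  "picard_iterate A c z1 0 = (\<lambda>z l j. c l j)"
| "picard_iterate A c z1 (Suc n) = (\<lambda>z l j. c l j + (z - z1) * integral {0..1} (\<lambda>t.
     \<Sum>k\<in>UNIV. picard_iterate A c z1 n (z1 + of_real t * (z - z1)) l k *
       A (z1 + of_real t * (z - z1)) l $ k $ j))"

text \<open>On a region that is small relative to the size of \<open>A\<close>, the Picard iterates converge
  geometrically and locally uniformly in the parameter, and each of them is holomorphic in it.\<close>
lemma linear_ode_holomorphic_in_parameter_local:
  fixes X :: "complex \<Rightarrow> complex \<Rightarrow> 2 \<Rightarrow> complex" and A :: "complex \<Rightarrow> complex \<Rightarrow> mat2"
  assumes S: "convex S" "z1 \<in> S" and L: "open L"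
    and contA: "\<And>i j. continuous_on (S \<times> L) (\<lambda>(z, l). A z l $ i $ j)"
    and holA: "\<And>z i j. z \<in> S \<Longrightarrow> (\<lambda>l. A z l $ i $ j) holomorphic_on L"
    and M: "\<And>z l i j. z \<in> S \<Longrightarrow> l \<in> L \<Longrightarrow> norm (A z l $ i $ j) \<le> M"
    and small: "\<And>z. z \<in> S \<Longrightarrow> norm (z - z1) * (4 * M) \<le> 1"
    and ode: "\<And>z l j. z \<in> S \<Longrightarrow> l \<in> L \<Longrightarrow>
      ((\<lambda>z. X z l j) has_field_derivative (\<Sum>k\<in>UNIV. X z l k * A z l $ k $ j)) (at z)"
    and init: "\<And>j. (\<lambda>l. X z1 l j) holomorphic_on L"
    and bdd: "\<And>l. l \<in> L \<Longrightarrow> \<exists>E. \<forall>z\<in>S. \<forall>j. norm (X z l j - X z1 l j) \<le> E"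
    and z: "z \<in> S"
  shows "(\<lambda>l. X z l j) holomorphic_on L"
proof -
  define P where "P = picard_iterate A (\<lambda>l j. X z1 l j) z1"
  define w where "w = (\<lambda>z (t :: real). z1 + of_real t * (z - z1))"
  have P0: "P 0 z l j = X z1 l j" for z l j by (simp add: P_def)
  have PS: "P (Suc n) z l j = X z1 l j + (z - z1) * integral {0..1} (\<lambda>t.
     \<Sum>k\<in>UNIV. P n (w z t) l k * A (w z t) l $ k $ j)" for n z l j
    by (simp add: P_def w_def)
  have wS: "w z t \<in> S" if "z \<in> S" "t \<in> {0..1}" for z t
  proof -
    have "w z t = (1 - t) *\<^sub>R z1 + t *\<^sub>R z"
      by (simp add: w_def scaleR_conv_of_real algebra_simps)
    then show ?thesis using S that by (simp add: convex_alt)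
  qed
  have contw: "continuous_on U (\<lambda>x. w (f x) (g x))"
    if "continuous_on U f" "continuous_on U g" for U :: "'b::topological_space set" and f g
    unfolding w_def using that by (intro continuous_intros)
  have contAw: "continuous_on ((S \<times> L) \<times> {0..1}) (\<lambda>y. A (w (fst (fst y)) (snd y)) (snd (fst y)) $ k $ j)"
    for k j
    by (rule continuous_on_compose2[OF contA, of _ "\<lambda>y. (w (fst (fst y)) (snd y), snd (fst y))", simplified])
      (auto intro!: continuous_intros contw wS)
  have contP: "continuous_on (S \<times> L) (\<lambda>x. P n (fst x) (snd x) j)" for n j
  proof (induction n arbitrary: j)
    case 0
    have "continuous_on (S \<times> L) (\<lambda>x. X z1 (snd x) j)"
      by (rule continuous_on_compose2[OF holomorphic_on_imp_continuous_on[OF init]])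
        (auto intro!: continuous_intros)
    then show ?case by (simp add: P0)
  next
    case (Suc n)
    have "continuous_on (S \<times> L) (\<lambda>x. integral (cbox 0 1) (\<lambda>t.
        \<Sum>k\<in>UNIV. P n (w (fst x) t) (snd x) k * A (w (fst x) t) (snd x) $ k $ j))"
    proof (rule integral_continuous_on_param)
      have "continuous_on ((S \<times> L) \<times> {0..1}) (\<lambda>y. P n (w (fst (fst y)) (snd y)) (snd (fst y)) k)" for k
        by (rule continuous_on_compose2[OF Suc.IH, of _ "\<lambda>y. (w (fst (fst y)) (snd y), snd (fst y))", simplified])
          (auto intro!: continuous_intros contw wS)
      then show "continuous_on ((S \<times> L) \<times> cbox 0 1) (\<lambda>(x, t).
          \<Sum>k\<in>UNIV. P n (w (fst x) t) (snd x) k * A (w (fst x) t) (snd x) $ k $ j)"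
        unfolding split_beta sum_2 by (intro continuous_on_add continuous_on_mult) (use contAw in simp_all)
    qed
    moreover have "continuous_on (S \<times> L) (\<lambda>x. X z1 (snd x) j)"
      by (rule continuous_on_compose2[OF holomorphic_on_imp_continuous_on[OF init]])
        (auto intro!: continuous_intros)
    ultimately show ?case
      unfolding PS by (intro continuous_intros) simp_all
  qed
  have contAt: "continuous_on {0..1} (\<lambda>t. A (w z t) l $ k $ j)" if "z \<in> S" "l \<in> L" for z l k j
    by (rule continuous_on_compose2[OF contA, of _ "\<lambda>t. (w z t, l)", simplified])
      (use that in \<open>auto intro!: continuous_intros contw wS\<close>)
  have contPt: "continuous_on {0..1} (\<lambda>t. P n (w z t) l k)" if "z \<in> S" "l \<in> L" for z l k n
    by (rule continuous_on_compose2[OF contP, of _ "\<lambda>t. (w z t, l)", simplified])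
      (use that in \<open>auto intro!: continuous_intros contw wS\<close>)
  have holP: "(\<lambda>l. P n z l j) holomorphic_on L" if "z \<in> S" for n z j
    using that
  proof (induction n arbitrary: z j)
    case 0
    then show ?case using init by (simp add: P0)
  next
    case (Suc n)
    have "(\<lambda>l. integral {0..1} (\<lambda>t. \<Sum>k\<in>UNIV. P n (w z t) l k * A (w z t) l $ k $ j)) holomorphic_on L"
    proof (rule holomorphic_on_integral_parameter[OF L])
      have "continuous_on (L \<times> {0..1}) (\<lambda>x. P n (w z (snd x)) (fst x) k)" for k
        by (rule continuous_on_compose2[OF contP, of _ "\<lambda>x. (w z (snd x), fst x)", simplified])
          (use Suc.prems in \<open>auto intro!: continuous_intros contw wS\<close>)
      moreover have "continuous_on (L \<times> {0..1}) (\<lambda>x. A (w z (snd x)) (fst x) $ k $ j)" for k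
        by (rule continuous_on_compose2[OF contA, of _ "\<lambda>x. (w z (snd x), fst x)", simplified])
          (use Suc.prems in \<open>auto intro!: continuous_intros contw wS\<close>)
      ultimately show "continuous_on (L \<times> {0..1})
          (\<lambda>(l, t). \<Sum>k\<in>UNIV. P n (w z t) l k * A (w z t) l $ k $ j)"
        unfolding split_beta sum_2 by (intro continuous_on_add continuous_on_mult)
    qed (auto intro!: holomorphic_intros Suc.IH holA wS Suc.prems)
    then show ?case
      unfolding PS by (intro holomorphic_intros init)
  qed
  have step: "norm ((z - z1) * integral {0..1} (\<lambda>t. \<Sum>k\<in>UNIV. g t k * A (w z t) l $ k $ j)) \<le> s / 2"
    if z: "z \<in> S" and l: "l \<in> L" and g: "\<And>k. continuous_on {0..1} (\<lambda>t. g t k)"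
      and s: "\<And>t k. t \<in> {0..1} \<Longrightarrow> norm (g t k) \<le> s" for z l g s j
  proof -
    have s0: "0 \<le> s" using order_trans[OF norm_ge_zero s[of 0 1]] by simp
    have "norm (\<Sum>k\<in>UNIV. g t k * A (w z t) l $ k $ j) \<le> 2 * (s * M)" if "t \<in> {0..1}" for t
    proof -
      have "norm (g t k * A (w z t) l $ k $ j) \<le> s * M" for k
        unfolding norm_mult using s[OF that] M[OF wS[OF z that] l] s0 by (intro mult_mono) auto
      then show ?thesis
        unfolding sum_2 by (smt (verit) norm_triangle_ineq)
    qed
    then have "norm (integral {0..1} (\<lambda>t. \<Sum>k\<in>UNIV. g t k * A (w z t) l $ k $ j)) \<le> 2 * (s * M) * (1 - 0)"
      by (intro integral_bound continuous_on_sum continuous_on_mult g contAt z l) auto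
    then have "norm (z - z1) * norm (integral {0..1} (\<lambda>t. \<Sum>k\<in>UNIV. g t k * A (w z t) l $ k $ j))
        \<le> norm (z - z1) * (2 * (s * M))"
      by (intro mult_left_mono) auto
    also have "\<dots> = s / 2 * (norm (z - z1) * (4 * M))" by (simp add: algebra_simps)
    also have "\<dots> \<le> s / 2 * 1"
      using small[OF z] s0 by (intro mult_left_mono) auto
    finally show ?thesis by (simp add: norm_mult)
  qed
  have contXt: "continuous_on {0..1} (\<lambda>t. X (w z t) l k)" if "z \<in> S" "l \<in> L" for z l k
  proof -
    have "continuous_on S (\<lambda>z. X z l k)"
      using ode[OF _ that(2)] by (meson DERIV_continuous continuous_at_imp_continuous_on)
    then show ?thesis
      by (rule continuous_on_compose2) (use that in \<open>auto intro!: continuous_intros contw wS\<close>)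
  qed
  have X_int: "X z l j = X z1 l j + (z - z1) * integral {0..1} (\<lambda>t.
      \<Sum>k\<in>UNIV. X (w z t) l k * A (w z t) l $ k $ j)" if z: "z \<in> S" and l: "l \<in> L" for z l j
  proof -
    have "((\<lambda>t. (z - z1) * (\<Sum>k\<in>UNIV. X (w z t) l k * A (w z t) l $ k $ j)) has_integral
        (X (w z 1) l j - X (w z 0) l j)) {0..1}"
    proof (rule fundamental_theorem_of_calculus)
      fix t :: real assume t: "t \<in> {0..1}"
      have "(w z has_vector_derivative (z - z1)) (at t)"
        unfolding w_def[abs_def] by (auto intro!: derivative_eq_intros)
      from field_vector_diff_chain_at[OF this ode[OF wS[OF z t] l]]
      show "((\<lambda>t. X (w z t) l j) has_vector_derivative
          (z - z1) * (\<Sum>k\<in>UNIV. X (w z t) l k * A (w z t) l $ k $ j)) (at t within {0..1})"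
        by (simp add: comp_def has_vector_derivative_at_within)
    qed simp
    from integral_unique[OF this] show ?thesis
      by (simp add: w_def)
  qed
  have err: "norm (X z l j - P n z l j) \<le> E / 2 ^ n"
    if l: "l \<in> L" and E: "\<And>z j. z \<in> S \<Longrightarrow> norm (X z l j - X z1 l j) \<le> E" and z: "z \<in> S"
    for z l j n E
    using z
  proof (induction n arbitrary: z j)
    case 0
    then show ?case using E by (simp add: P0)
  next
    case (Suc n)
    have i: "(\<lambda>t. \<Sum>k\<in>UNIV. f t k * A (w z t) l $ k $ j) integrable_on {0..1}"
      if "\<And>k. continuous_on {0..1} (\<lambda>t. f t k)" for f
      by (intro integrable_continuous_interval continuous_on_sum continuous_on_mult that contAt Suc.prems l)
    have "X z l j - P (Suc n) z l j = (z - z1) * (integral {0..1} (\<lambda>t.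
        \<Sum>k\<in>UNIV. X (w z t) l k * A (w z t) l $ k $ j) - integral {0..1} (\<lambda>t.
        \<Sum>k\<in>UNIV. P n (w z t) l k * A (w z t) l $ k $ j))"
      unfolding PS X_int[OF Suc.prems l, of j] by (simp add: right_diff_distrib)
    also have "\<dots> = (z - z1) * integral {0..1} (\<lambda>t.
        \<Sum>k\<in>UNIV. (X (w z t) l k - P n (w z t) l k) * A (w z t) l $ k $ j)"
      by (subst integral_diff[symmetric])
        (simp_all add: i contXt contPt Suc.prems l sum_subtractf left_diff_distrib)
    finally have eq: "X z l j - P (Suc n) z l j = (z - z1) * integral {0..1} (\<lambda>t.
        \<Sum>k\<in>UNIV. (X (w z t) l k - P n (w z t) l k) * A (w z t) l $ k $ j)" .
    have "norm (X z l j - P (Suc n) z l j) \<le> (E / 2 ^ n) / 2"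
      unfolding eq
    proof (rule step[OF Suc.prems l])
      show "continuous_on {0..1} (\<lambda>t. X (w z t) l k - P n (w z t) l k)" for k
        by (intro continuous_on_diff contXt contPt Suc.prems l)
      show "norm (X (w z t) l k - P n (w z t) l k) \<le> E / 2 ^ n" if "t \<in> {0..1}" for t k
        by (rule Suc.IH[OF wS[OF Suc.prems that]])
    qed
    then show ?case by (simp add: mult.commute)
  qed
  define m where "m = (\<lambda>l. norm (X z1 l 1) + norm (X z1 l 2))"
  have mX: "norm (X z1 l j) \<le> m l" for l j
    using exhaust_2[of j] by (auto simp: m_def)
  have Pm: "norm (P n z l j) \<le> 2 * m l" if "z \<in> S" "l \<in> L" for n z l j
    using that
  proof (induction n arbitrary: z j)
    case 0
    have "norm (X z1 l j) \<le> 2 * m l"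
      using mX[of l j] norm_ge_zero[of "X z1 l j"] by linarith
    then show ?case by (simp add: P0)
  next
    case (Suc n)
    have "norm (P (Suc n) z l j) \<le> m l + 2 * m l / 2"
      unfolding PS
    proof (intro norm_triangle_le add_mono mX step[OF Suc.prems])
      show "continuous_on {0..1} (\<lambda>t. P n (w z t) l k)" for k
        by (rule contPt[OF Suc.prems])
      show "norm (P n (w z t) l k) \<le> 2 * m l" if "t \<in> {0..1}" for t k
        by (rule Suc.IH[OF wS[OF Suc.prems(1) that] Suc.prems(2)])
    qed
    then show ?case by simp
  qed
  have Xm: "norm (X z l j) \<le> 2 * m l" if z: "z \<in> S" and l: "l \<in> L" for z l j
  proof -
    obtain E where E: "\<And>z j. z \<in> S \<Longrightarrow> norm (X z l j - X z1 l j) \<le> E"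
      using bdd[OF l] by blast
    have "(\<lambda>n. X z l j - P n z l j) \<longlonglongrightarrow> 0"
    proof (rule Lim_null_comparison)
      show "\<forall>\<^sub>F n in sequentially. norm (X z l j - P n z l j) \<le> E * (1 / 2) ^ n"
        using err[OF l E z] by (simp add: power_divide)
      show "(\<lambda>n. E * (1 / 2) ^ n) \<longlonglongrightarrow> 0"
        by (intro tendsto_mult_right_zero LIMSEQ_power_zero) simp
    qed
    then have "(\<lambda>n. X z l j - (X z l j - P n z l j)) \<longlonglongrightarrow> X z l j - 0"
      by (intro tendsto_intros)
    then have "(\<lambda>n. P n z l j) \<longlonglongrightarrow> X z l j" by simp
    then show ?thesis
      by (rule Lim_norm_ubound[OF sequentially_bot]) (simp add: Pm z l)
  qed
  have err2: "norm (X z l j - P n z l j) \<le> 3 * m l / 2 ^ n" if "l \<in> L" "z \<in> S" for z l j n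
  proof (rule err)
    show "norm (X z l j - X z1 l j) \<le> 3 * m l" if "z \<in> S" for z j
      using Xm[OF that \<open>l \<in> L\<close>, of j] mX[of l j] norm_triangle_ineq4[of "X z l j" "X z1 l j"] by linarith
  qed (use that in auto)
  show ?thesis
  proof (rule holomorphic_uniform_sequence[OF L])
    show "(\<lambda>l. P n z l j) holomorphic_on L" for n by (rule holP[OF z])
    fix l assume "l \<in> L"
    then obtain d where d: "d > 0" "cball l d \<subseteq> L"
      using L open_contains_cball by blast
    have "continuous_on (cball l d) m"
      unfolding m_def using d(2) continuous_on_subset[OF holomorphic_on_imp_continuous_on[OF init]]
      by (intro continuous_intros) auto
    then have "bounded (m ` cball l d)"
      by (intro compact_imp_bounded compact_continuous_image) auto
    then obtain K where K: "\<And>v. v \<in> cball l d \<Longrightarrow> m v \<le> K"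
      by (auto simp: bounded_iff) (metis abs_le_D1 mem_cball)
    have "uniform_limit (cball l d) (\<lambda>n l. P n z l j) (\<lambda>l. X z l j) sequentially"
    proof (rule uniform_limitI)
      fix e :: real assume "e > 0"
      have "(\<lambda>n. 3 * K * (1 / 2) ^ n) \<longlonglongrightarrow> 0"
        by (intro tendsto_mult_right_zero LIMSEQ_power_zero) simp
      then have "\<forall>\<^sub>F n in sequentially. 3 * K * (1 / 2) ^ n < e"
        using \<open>e > 0\<close> by (rule order_tendstoD)
      then show "\<forall>\<^sub>F n in sequentially. \<forall>x\<in>cball l d. dist (P n z x j) (X z x j) < e"
      proof (rule eventually_mono)
        fix n assume n: "3 * K * (1 / 2) ^ n < e"
        show "\<forall>x\<in>cball l d. dist (P n z x j) (X z x j) < e"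
        proof
          fix x assume x: "x \<in> cball l d"
          have "dist (P n z x j) (X z x j) \<le> 3 * m x / 2 ^ n"
            using err2[of x z j n] x d(2) z by (auto simp: dist_norm norm_minus_commute)
          also have "\<dots> \<le> 3 * K / 2 ^ n"
            using K[OF x] by (simp add: divide_right_mono)
          finally show "dist (P n z x j) (X z x j) < e"
            using n by (simp add: power_divide)
        qed
      qed
    qed
    then show "\<exists>d>0. cball l d \<subseteq> L \<and> uniform_limit (cball l d) (\<lambda>n l. P n z l j) (\<lambda>l. X z l j) sequentially"
      using d by blast
  qed
qed

text \<open>The size of the region in which the iteration converges depends only on a bound for \<open>A\<close>, hence
  it is uniform near each point. Holomorphy in the parameter therefore propagates from \<open>zs\<close> to all
  points of the connected set \<open>D\<close>.\<close>
lemma linear_ode_holomorphic_in_parameter: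
  fixes X A :: "complex \<Rightarrow> complex \<Rightarrow> mat2"
  assumes D: "open D" "connected D" and L: "open L"
    and contA: "\<And>i j. continuous_on (D \<times> L) (\<lambda>(z, l). A z l $ i $ j)"
    and holA: "\<And>z i j. z \<in> D \<Longrightarrow> (\<lambda>l. A z l $ i $ j) holomorphic_on L"
    and ode: "\<And>z l i j. z \<in> D \<Longrightarrow> l \<in> L \<Longrightarrow>
      ((\<lambda>z. X z l $ i $ j) has_field_derivative (X z l ** A z l) $ i $ j) (at z)"
    and zs: "zs \<in> D" and init: "\<And>i j. (\<lambda>l. X zs l $ i $ j) holomorphic_on L"
    and z: "z \<in> D"
  shows "(\<lambda>l. X z l $ i $ j) holomorphic_on L"
proof -
  have "(\<lambda>l. X z l $ i $ j) field_differentiable (at l0)" if l0: "l0 \<in> L" for l0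
  proof -
    obtain \<delta> where \<delta>: "\<delta> > 0" "cball l0 \<delta> \<subseteq> L"
      using L l0 open_contains_cball by blast
    define B where "B = ball l0 \<delta>"
    have BL: "B \<subseteq> L" using \<delta>(2) by (auto simp: B_def)
    define hol where "hol = (\<lambda>z. \<forall>i j. (\<lambda>l. X z l $ i $ j) holomorphic_on B)"
    have "hol z"
    proof (rule connected_induction_simple[OF D(2) zs z])
      show "hol zs" unfolding hol_def using init BL holomorphic_on_subset by blast
      fix a assume a: "a \<in> D"
      obtain \<rho> where \<rho>: "\<rho> > 0" "cball a \<rho> \<subseteq> D"
        using D(1) a open_contains_cball by blast
      have "bounded ((\<lambda>(z, l). A z l $ i $ j) ` (cball a \<rho> \<times> cball l0 \<delta>))" for i j
        by (intro compact_imp_bounded compact_continuous_image compact_Times compact_cball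
            continuous_on_subset[OF contA] Sigma_mono \<rho>(2) \<delta>(2))
      then have "\<forall>i j. \<exists>M. \<forall>z\<in>cball a \<rho>. \<forall>l\<in>cball l0 \<delta>. norm (A z l $ i $ j) \<le> M"
        unfolding bounded_iff by fastforce
      then obtain M' where M': "\<And>i j z l. z \<in> cball a \<rho> \<Longrightarrow> l \<in> cball l0 \<delta> \<Longrightarrow> norm (A z l $ i $ j) \<le> M' i j"
        by metis
      define M where "M = Max (range (\<lambda>(i, j). M' i j))"
      have M'M: "M' i j \<le> M" for i j
        unfolding M_def by (rule Max_ge) auto
      have M: "norm (A z l $ i $ j) \<le> M" if "z \<in> cball a \<rho>" "l \<in> cball l0 \<delta>" for z l i j
        using M'[OF that] M'M order_trans by blast
      have M0: "0 \<le> M"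
        using order_trans[OF norm_ge_zero M[of a l0 1 1]] \<rho>(1) \<delta>(1) by simp
      define r where "r = min \<rho> (1 / (8 * (M + 1)))"
      have r: "r > 0" "r \<le> \<rho>" "r * (8 * (M + 1)) \<le> 1"
        using \<rho>(1) M0 by (auto simp: r_def min_def field_simps)
      have "hol z" if z1: "z1 \<in> ball a r" and h1: "hol z1" and z: "z \<in> ball a r" for z1 z
        unfolding hol_def
      proof (intro allI)
        fix i j
        show "(\<lambda>l. X z l $ i $ j) holomorphic_on B"
        proof (rule linear_ode_holomorphic_in_parameter_local[where S = "ball a r" and ?z1.0 = z1 and
              X = "\<lambda>z l j. X z l $ i $ j" and A = A and M = M])
          have sub: "ball a r \<subseteq> cball a \<rho>" using r(2) by auto
          then have subD: "ball a r \<subseteq> D" using \<rho>(2) by blast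
          show "continuous_on (ball a r \<times> B) (\<lambda>(z, l). A z l $ i $ j)" for i j
            by (rule continuous_on_subset[OF contA]) (use subD BL in auto)
          show "(\<lambda>l. A z l $ i $ j) holomorphic_on B" if "z \<in> ball a r" for z i j
            using holA[of z i j] that subD BL holomorphic_on_subset by blast
          show "norm (A z l $ i $ j) \<le> M" if "z \<in> ball a r" "l \<in> B" for z l i j
            using M that sub by (auto simp: B_def)
          show "norm (z - z1) * (4 * M) \<le> 1" if "z \<in> ball a r" for z
          proof -
            have "norm (z - z1) \<le> 2 * r"
              using that z1 dist_triangle2[of z z1 a] by (simp add: dist_norm norm_minus_commute)
            then have "norm (z - z1) * (4 * M) \<le> 2 * r * (4 * (M + 1))"
              using M0 r(1) by (intro mult_mono) auto
            also have "\<dots> = r * (8 * (M + 1))" by simp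
            finally show ?thesis using r(3) by linarith
          qed
          show "((\<lambda>z. X z l $ i $ j) has_field_derivative (\<Sum>k\<in>UNIV. X z l $ i $ k * A z l $ k $ j)) (at z)"
            if "z \<in> ball a r" "l \<in> B" for z l j
          proof -
            have "z \<in> D" "l \<in> L" using that subD BL by blast+
            then show ?thesis using ode[of z l i j] by (simp add: mult22_nth sum_2)
          qed
          show "(\<lambda>l. X z1 l $ i $ j) holomorphic_on B" for j
            using h1 by (simp add: hol_def)
          show "\<exists>E. \<forall>z\<in>ball a r. \<forall>j. norm (X z l $ i $ j - X z1 l $ i $ j) \<le> E" if "l \<in> B" for l
          proof -
            have "continuous_on (cball a \<rho>) (\<lambda>z. X z l $ i $ j - X z1 l $ i $ j)" for j
            proof (intro continuous_on_diff continuous_on_const continuous_at_imp_continuous_on ballI)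
              fix v assume "v \<in> cball a \<rho>"
              then have "v \<in> D" "l \<in> L" using that BL \<rho>(2) by blast+
              then show "isCont (\<lambda>z. X z l $ i $ j) v" by (rule DERIV_isCont[OF ode])
            qed
            then have "bounded ((\<lambda>z. X z l $ i $ j - X z1 l $ i $ j) ` cball a \<rho>)" for j
              by (intro compact_imp_bounded compact_continuous_image) auto
            then have "\<forall>j. \<exists>E. \<forall>z\<in>cball a \<rho>. norm (X z l $ i $ j - X z1 l $ i $ j) \<le> E"
              unfolding bounded_iff by blast
            then obtain E where E: "\<And>j z. z \<in> cball a \<rho> \<Longrightarrow> norm (X z l $ i $ j - X z1 l $ i $ j) \<le> E j"
              by metis
            have "E j \<le> Max (range E)" for j by (rule Max_ge) auto
            then have "norm (X z l $ i $ j - X z1 l $ i $ j) \<le> Max (range E)" if "z \<in> ball a r" for z j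
              using order_trans[OF E[of z j]] that sub by blast
            then show ?thesis by blast
          qed
        qed (use z1 z in \<open>auto simp: B_def\<close>)
      qed
      moreover have "openin (top_of_set D) (ball a r)"
      proof (rule open_subset)
        have "ball a r \<subseteq> cball a \<rho>" using r(2) by auto
        then show "ball a r \<subseteq> D" using \<rho>(2) by blast
      qed simp
      moreover have "a \<in> ball a r" using r(1) by simp
      ultimately show "\<exists>T. openin (top_of_set D) T \<and> a \<in> T \<and> (\<forall>x\<in>T. \<forall>y\<in>T. hol x \<longrightarrow> hol y)"
        by blast
    qed
    then have "(\<lambda>l. X z l $ i $ j) holomorphic_on B" by (simp add: hol_def)
    then show ?thesis
      using \<delta>(1) holomorphic_on_imp_differentiable_at[of _ B l0] by (simp add: B_def)
  qed
  then show ?thesis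
    by (simp add: holomorphic_on_def field_differentiable_at_within)
qed

section \<open>Evaluation of loops\<close>

lemma summable_fourier_coeff_reindex:
  assumes "inj h"
  shows "summable (\<lambda>n :: nat. norm (fourier_coeff a (h n)))"
proof -
  have "(\<lambda>n. norm (fourier_coeff a n)) summable_on range h"
    by (rule summable_on_subset_banach[OF summable_fourier_coeff]) simp
  then have "(\<lambda>n. norm (fourier_coeff a (h n))) summable_on UNIV"
    using summable_on_reindex[OF assms, of "\<lambda>n. norm (fourier_coeff a n)"] by (simp add: comp_def)
  then show ?thesis
    by (simp add: summable_on_UNIV_nonneg_real_iff)
qed

lemma absolutely_summable_power_series:
  fixes c :: "nat \<Rightarrow> complex"
  assumes "summable (\<lambda>n. norm (c n))"
  shows "norm w \<le> 1 \<Longrightarrow> summable (\<lambda>n. norm (c n * w ^ n))"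
    and "continuous_on (cball 0 1) (\<lambda>w. \<Sum>n. c n * w ^ n)"
    and "(\<lambda>w. \<Sum>n. c n * w ^ n) holomorphic_on ball 0 1"
proof -
  have bd: "norm (c n * w ^ n) \<le> norm (c n)" if "norm w \<le> 1" for n w
    using that by (simp add: norm_mult norm_power mult_left_le power_le_one)
  show s: "summable (\<lambda>n. norm (c n * w ^ n))" if "norm w \<le> 1" for w
    by (rule summable_comparison_test'[OF assms, of 0]) (use bd that in simp)
  show "continuous_on (cball 0 1) (\<lambda>w. \<Sum>n. c n * w ^ n)"
  proof (rule uniform_limit_theorem)
    show "uniform_limit (cball 0 1) (\<lambda>n w. \<Sum>i<n. c i * w ^ i) (\<lambda>w. \<Sum>n. c n * w ^ n) sequentially"
      by (rule Weierstrass_m_test[OF _ assms]) (use bd in simp)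
  qed (auto intro!: always_eventually continuous_intros)
  show "(\<lambda>w. \<Sum>n. c n * w ^ n) holomorphic_on ball 0 1"
  proof (rule power_series_holomorphic)
    show "(\<lambda>n. c n * (w - 0) ^ n) sums (\<Sum>n. c n * w ^ n)" if "w \<in> ball 0 1" for w
      using summable_sums[OF summable_norm_cancel[OF s[of w]]] that by simp
  qed
qed

text \<open>The nonnegative part of the Fourier series, which makes sense on the closed disc. It is bounded
  and linear in the loop at every point of the disc, so smooth families of loops can be
  differentiated there, and not only on the circle.\<close>
definition plus_eval :: "wiener \<Rightarrow> complex \<Rightarrow> complex" where
  "plus_eval a lam = (\<Sum>n. fourier_coeff a (int n) * lam ^ n)"

lemma plus_eval_disc:
  shows "continuous_on (cball 0 1) (plus_eval a)" "plus_eval a holomorphic_on ball 0 1"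
  unfolding plus_eval_def[abs_def]
  by (rule absolutely_summable_power_series[OF summable_fourier_coeff_reindex[OF inj_of_nat]])+

lemma summable_plus_eval:
  "norm w \<le> 1 \<Longrightarrow> summable (\<lambda>n. norm (fourier_coeff a (int n) * w ^ n))"
  by (rule absolutely_summable_power_series(1)[OF summable_fourier_coeff_reindex[OF inj_of_nat]])

lemma suminf_norm_fourier_coeff_le: "(\<Sum>n. norm (fourier_coeff a (int n))) \<le> norm a"
proof -
  have s: "summable (\<lambda>n. norm (fourier_coeff a (int n)))"
    by (rule summable_fourier_coeff_reindex[OF inj_of_nat])
  have "(\<Sum>n<N. norm (fourier_coeff a (int n))) \<le> norm a" for N
  proof -
    have "(\<Sum>n<N. norm (fourier_coeff a (int n))) = (\<Sum>k\<in>int ` {..<N}. norm (fourier_coeff a k))"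
      by (subst sum.reindex) (auto simp: inj_on_def)
    also have "\<dots> \<le> (\<Sum>\<^sub>\<infinity>k. norm (fourier_coeff a k))"
      by (rule finite_sum_le_infsum[OF summable_fourier_coeff]) auto
    finally show ?thesis by (simp add: norm_wiener_def)
  qed
  then show ?thesis by (rule suminf_le_const[OF s])
qed

lemma bounded_linear_plus_eval:
  assumes "norm w \<le> 1" shows "bounded_linear (\<lambda>a. plus_eval a w)"
proof (rule bounded_linear_intro)
  have s: "summable (\<lambda>n. fourier_coeff a (int n) * w ^ n)" for a
    using summable_norm_cancel[OF summable_plus_eval[OF assms]] .
  show "plus_eval (a + b) w = plus_eval a w + plus_eval b w" for a b
    by (simp add: plus_eval_def fourier_coeff_add distrib_right suminf_add s)
  show "plus_eval (r *\<^sub>R a) w = r *\<^sub>R plus_eval a w" for r a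
    unfolding plus_eval_def suminf_scaleR_right[OF s] by (simp add: fourier_coeff_scaleR)
  show "norm (plus_eval a w) \<le> norm a * 1" for a
  proof -
    have "norm (plus_eval a w) \<le> (\<Sum>n. norm (fourier_coeff a (int n) * w ^ n))"
      unfolding plus_eval_def by (rule summable_norm[OF summable_plus_eval[OF assms]])
    also have "\<dots> \<le> (\<Sum>n. norm (fourier_coeff a (int n)))"
      by (rule suminf_le[OF _ summable_plus_eval[OF assms] summable_fourier_coeff_reindex[OF inj_of_nat]])
        (use assms in \<open>simp add: norm_mult norm_power mult_left_le power_le_one\<close>)
    also have "\<dots> \<le> norm a" by (rule suminf_norm_fourier_coeff_le)
    finally show ?thesis by simp
  qed
qed

lemma abs_summable_wiener_eval:
  "norm w = 1 \<Longrightarrow> (\<lambda>n. norm (fourier_coeff a n * w powi n)) summable_on UNIV"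
  using summable_fourier_coeff[of a] by (simp add: norm_mult norm_power_int)

lemma bounded_linear_wiener_eval:
  assumes "norm w = 1" shows "bounded_linear (\<lambda>a. wiener_eval a w)"
proof (rule bounded_linear_intro)
  have s: "(\<lambda>n. fourier_coeff a n * w powi n) summable_on UNIV" for a
    using abs_summable_summable[OF abs_summable_wiener_eval[OF assms]] .
  show "wiener_eval (a + b) w = wiener_eval a w + wiener_eval b w" for a b
    unfolding wiener_eval_def fourier_coeff_add distrib_right by (rule infsum_add[OF s s])
  show "wiener_eval (r *\<^sub>R a) w = r *\<^sub>R wiener_eval a w" for r a
    unfolding wiener_eval_def fourier_coeff_scaleR mult_scaleR_left by (rule infsum_scaleR_right)
  show "norm (wiener_eval a w) \<le> norm a * 1" for a
    using norm_infsum_bound[OF abs_summable_wiener_eval[OF assms, of a]] assms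
    by (simp add: wiener_eval_def norm_wiener_def norm_mult norm_power_int)
qed

lemma wiener_eval_split:
  assumes "norm w = 1"
  shows "wiener_eval a w = plus_eval a w +
    inverse w * (\<Sum>n. fourier_coeff a (- 1 - int n) * inverse w ^ n)"
proof -
  define f where "f = (\<lambda>n. fourier_coeff a n * w powi n)"
  have sf: "f summable_on A" for A
    using abs_summable_summable[OF abs_summable_wiener_eval[OF assms, of a]] summable_on_subset_banach
    unfolding f_def by blast
  have w: "w \<noteq> 0" using assms by auto
  have inj: "inj (\<lambda>n. - 1 - int n)" by (auto simp: inj_on_def)
  have "UNIV = range int \<union> range (\<lambda>n. - 1 - int n)"
  proof -
    have "k \<in> range int \<union> range (\<lambda>n. - 1 - int n)" for k
      by (cases k rule: int_cases) (auto intro: range_eqI simp: image_iff)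
    then show ?thesis by auto
  qed
  then have "wiener_eval a w = infsum f (range int \<union> range (\<lambda>n. - 1 - int n))"
    by (simp add: wiener_eval_def f_def)
  also have "\<dots> = infsum f (range int) + infsum f (range (\<lambda>n. - 1 - int n))"
    by (rule infsum_Un_disjoint[OF sf sf]) auto
  also have "infsum f (range int) = (\<Sum>\<^sub>\<infinity>n. f (int n))"
    by (subst infsum_reindex) (auto simp: inj_on_def comp_def)
  also have "\<dots> = plus_eval a w"
  proof (rule infsumI, rule norm_summable_imp_has_sum)
    show "summable (\<lambda>n. norm (f (int n)))"
      using summable_plus_eval[of w a] assms by (simp add: f_def)
    show "(\<lambda>n. f (int n)) sums plus_eval a w"
      using summable_sums[OF summable_norm_cancel[OF summable_plus_eval[of w a]]] assms
      by (simp add: f_def plus_eval_def)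
  qed
  also have "infsum f (range (\<lambda>n. - 1 - int n)) = (\<Sum>\<^sub>\<infinity>n. f (- 1 - int n))"
    by (subst infsum_reindex[OF inj]) (simp add: comp_def)
  also have "\<dots> = inverse w * (\<Sum>n. fourier_coeff a (- 1 - int n) * inverse w ^ n)"
  proof (rule infsumI, rule norm_summable_imp_has_sum)
    have eq: "f (- 1 - int n) = inverse w * (fourier_coeff a (- 1 - int n) * inverse w ^ n)" for n
    proof -
      have "w powi (- 1 - int n) = inverse (w powi (int (Suc n)))"
        by (subst power_int_minus[symmetric]) simp
      also have "\<dots> = inverse w * inverse w ^ n"
        by (simp only: power_int_of_nat power_Suc inverse_mult_distrib power_inverse)
      finally show ?thesis by (simp add: f_def)
    qed
    have s: "summable (\<lambda>n. norm (fourier_coeff a (- 1 - int n) * inverse w ^ n))"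
      by (rule absolutely_summable_power_series(1)[OF summable_fourier_coeff_reindex[OF inj]])
        (simp add: norm_inverse assms)
    then show "summable (\<lambda>n. norm (f (- 1 - int n)))"
      unfolding eq by (subst norm_mult) (rule summable_mult)
    show "(\<lambda>n. f (- 1 - int n)) sums (inverse w * (\<Sum>n. fourier_coeff a (- 1 - int n) * inverse w ^ n))"
      unfolding eq by (rule sums_mult[OF summable_sums[OF summable_norm_cancel[OF s]]])
  qed
  finally show ?thesis .
qed

text \<open>The negative part of the series is a function outside the disc that vanishes at infinity. If it
  also extends to the inside, the extension is an entire function that tends to \<open>0\<close>.\<close>
lemma wiener_eval_eq_plus_eval:
  assumes G: "continuous_on (cball 0 1) G" "G holomorphic_on ball 0 1"
    "\<And>w. norm w = 1 \<Longrightarrow> G w = wiener_eval a w" and w: "norm w = 1"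
  shows "wiener_eval a w = plus_eval a w"
proof -
  define b where "b = (\<lambda>w. w * (\<Sum>n. fourier_coeff a (- 1 - int n) * w ^ n))"
  have inj: "inj (\<lambda>n. - 1 - int n)" by (auto simp: inj_on_def)
  have "\<forall>w\<in>cball 0 1. G w - plus_eval a w = b 0 \<and> b w = b 0"
  proof (rule disc_functions_matching_by_inversion)
    show "continuous_on (cball 0 1) b" "b holomorphic_on ball 0 1"
      unfolding b_def
      by (intro continuous_intros holomorphic_intros
          absolutely_summable_power_series[OF summable_fourier_coeff_reindex[OF inj]])+
    show "G w - plus_eval a w = b (inverse w)" if "norm w = 1" for w
      using G(3)[OF that] wiener_eval_split[OF that, of a] by (simp add: b_def)
  qed (intro continuous_intros holomorphic_intros G plus_eval_disc)+
  from bspec[OF this, of w] show ?thesis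
    using G(3)[OF w] w by (simp add: b_def)
qed

lemma bounded_linear_mat22:
  fixes a b c d :: "'a::real_normed_vector \<Rightarrow> complex"
  assumes "bounded_linear a" "bounded_linear b" "bounded_linear c" "bounded_linear d"
  shows "bounded_linear (\<lambda>x. mat22 (a x) (b x) (c x) (d x))"
proof -
  have eq: "mat22 p q r s = mat22 p 0 0 0 + mat22 0 q 0 0 + mat22 0 0 r 0 + mat22 0 0 0 s" for p q r s
    by (simp add: mat2_eq_iff)
  have "bounded_linear (\<lambda>p. mat22 p 0 0 0)" "bounded_linear (\<lambda>p. mat22 0 p 0 0)"
    "bounded_linear (\<lambda>p. mat22 0 0 p 0)" "bounded_linear (\<lambda>p. mat22 0 0 0 p)"
    unfolding linear_conv_bounded_linear[symmetric]
    by (auto intro!: linearI simp: mat2_eq_iff)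
  note c = this[THEN bounded_linear_compose]
  show ?thesis
    by (subst eq)
      (intro bounded_linear_add c(1)[OF assms(1)] c(2)[OF assms(2)] c(3)[OF assms(3)] c(4)[OF assms(4)])
qed

lemma bounded_linear_loop_nth: "bounded_linear (\<lambda>g :: loop. g $ i $ j)"
  by (rule bounded_linear_compose[OF bounded_linear_vec_nth bounded_linear_vec_nth])

definition plus_mat :: "loop \<Rightarrow> complex \<Rightarrow> mat2" where
  "plus_mat g lam = (\<chi> i j. plus_eval (g $ i $ j) lam)"

lemma plus_mat_nth: "plus_mat g lam $ i $ j = plus_eval (g $ i $ j) lam"
  by (simp add: plus_mat_def)

lemma loop_eval_nth: "loop_eval g lam $ i $ j = wiener_eval (g $ i $ j) lam"
  by (simp add: loop_eval_def)

lemma bounded_linear_plus_mat: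
  assumes "norm w \<le> 1" shows "bounded_linear (\<lambda>g. plus_mat g w)"
proof -
  have "(\<lambda>g. plus_mat g w) = (\<lambda>g. mat22 (plus_eval (g $ 1 $ 1) w) (plus_eval (g $ 1 $ 2) w)
      (plus_eval (g $ 2 $ 1) w) (plus_eval (g $ 2 $ 2) w))"
    by (simp add: fun_eq_iff mat2_eq_iff plus_mat_nth)
  then show ?thesis
    using bounded_linear_mat22[OF
      bounded_linear_compose[OF bounded_linear_plus_eval[OF assms] bounded_linear_loop_nth]
      bounded_linear_compose[OF bounded_linear_plus_eval[OF assms] bounded_linear_loop_nth]
      bounded_linear_compose[OF bounded_linear_plus_eval[OF assms] bounded_linear_loop_nth]
      bounded_linear_compose[OF bounded_linear_plus_eval[OF assms] bounded_linear_loop_nth]]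
    by simp
qed

lemma bounded_linear_loop_eval:
  assumes "norm w = 1" shows "bounded_linear (\<lambda>g. loop_eval g w)"
proof -
  have "(\<lambda>g. loop_eval g w) = (\<lambda>g. mat22 (wiener_eval (g $ 1 $ 1) w) (wiener_eval (g $ 1 $ 2) w)
      (wiener_eval (g $ 2 $ 1) w) (wiener_eval (g $ 2 $ 2) w))"
    by (simp add: fun_eq_iff mat2_eq_iff loop_eval_nth)
  then show ?thesis
    using bounded_linear_mat22[OF
      bounded_linear_compose[OF bounded_linear_wiener_eval[OF assms] bounded_linear_loop_nth]
      bounded_linear_compose[OF bounded_linear_wiener_eval[OF assms] bounded_linear_loop_nth]
      bounded_linear_compose[OF bounded_linear_wiener_eval[OF assms] bounded_linear_loop_nth]
      bounded_linear_compose[OF bounded_linear_wiener_eval[OF assms] bounded_linear_loop_nth]]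
    by simp
qed

lemma plus_mat_disc:
  "continuous_on (cball 0 1) (\<lambda>w. plus_mat g w $ i $ j)"
  "(\<lambda>w. plus_mat g w $ i $ j) holomorphic_on ball 0 1"
  unfolding plus_mat_nth by (rule plus_eval_disc)+

text \<open>All identities hold on the circle by definition and pass to the disc by the maximum principle;
  at the centre, the twisting condition makes the odd entries vanish.\<close>
lemma LSL_plusD:
  assumes g: "g \<in> LSL_plus"
  shows loop_eval_eq_plus_mat: "\<And>w. norm w = 1 \<Longrightarrow> loop_eval g w = plus_mat g w"
    and det_plus_mat: "\<And>w. norm w \<le> 1 \<Longrightarrow> det (plus_mat g w) = 1"
    and plus_mat_0_offdiag: "plus_mat g 0 $ 1 $ 2 = 0" "plus_mat g 0 $ 2 $ 1 = 0"
proof -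
  from g obtain G :: "complex \<Rightarrow> mat2" where G:
    "\<And>i j. continuous_on (cball 0 1) (\<lambda>lam. G lam $ i $ j)"
    "\<And>i j. (\<lambda>lam. G lam $ i $ j) holomorphic_on ball 0 1"
    "\<And>lam. lam \<in> sphere 0 1 \<Longrightarrow> G lam = loop_eval g lam"
    unfolding LSL_plus_def by blast
  have L: "det (loop_eval g w) = 1" "loop_eval g (- w) = sigma (loop_eval g w)" if "norm w = 1" for w
    using g that by (auto simp: LSL_plus_def LSL_def)
  show eq: "loop_eval g w = plus_mat g w" if "norm w = 1" for w
  proof -
    have "wiener_eval (g $ i $ j) w = plus_eval (g $ i $ j) w" for i j
      by (rule wiener_eval_eq_plus_eval[OF G(1,2) _ that]) (simp add: G(3) loop_eval_nth)
    then show ?thesis by (simp add: mat2_eq_iff loop_eval_nth plus_mat_nth)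
  qed
  show "det (plus_mat g w) = 1" if "norm w \<le> 1" for w
  proof (rule disc_functions_eq_if_eq_on_circle[where A = "\<lambda>w. det (plus_mat g w)" and B = "\<lambda>_. 1"
        and w = w])
    show "continuous_on (cball 0 1) (\<lambda>w. det (plus_mat g w))"
      "(\<lambda>w. det (plus_mat g w)) holomorphic_on ball 0 1"
      unfolding det22 by (intro continuous_intros holomorphic_intros plus_mat_disc)+
    show "det (plus_mat g w) = 1" if "norm w = 1" for w
      using L(1)[OF that] eq[OF that] by simp
  qed (use that in \<open>auto intro!: continuous_intros holomorphic_intros\<close>)
  have odd: "plus_mat g 0 $ i $ j = 0" if "\<And>X. sigma X $ i $ j = - X $ i $ j" for i j
  proof -
    have "plus_mat g (- 0) $ i $ j = - plus_mat g 0 $ i $ j"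
    proof (rule disc_functions_eq_if_eq_on_circle[where A = "\<lambda>w. plus_mat g (- w) $ i $ j"
          and B = "\<lambda>w. - plus_mat g w $ i $ j" and w = 0])
      show "continuous_on (cball 0 1) (\<lambda>w. plus_mat g (- w) $ i $ j)"
        by (rule continuous_on_compose2[OF plus_mat_disc(1)]) (auto intro!: continuous_intros)
      have "(\<lambda>w. plus_mat g w $ i $ j) \<circ> uminus holomorphic_on ball 0 1"
        by (rule holomorphic_on_compose_gen[OF _ plus_mat_disc(2)]) (auto intro!: holomorphic_intros)
      then show "(\<lambda>w. plus_mat g (- w) $ i $ j) holomorphic_on ball 0 1" by (simp add: comp_def)
      show "plus_mat g (- w) $ i $ j = - plus_mat g w $ i $ j" if "norm w = 1" for w
        using L(2)[OF that] eq[of w] eq[of "- w"] that \<open>\<And>X. sigma X $ i $ j = - X $ i $ j\<close> by simp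
    qed (auto intro!: continuous_intros holomorphic_intros plus_mat_disc)
    then show ?thesis by simp
  qed
  show "plus_mat g 0 $ 1 $ 2 = 0" "plus_mat g 0 $ 2 $ 1 = 0"
    by (rule odd, simp add: sigma_eq)+
qed

lemma wiener_eval_scale_shift:
  "\<exists>b. \<forall>w. norm w = 1 \<longrightarrow> wiener_eval b w = c * w powi k * wiener_eval a w"
proof -
  have bij: "bij_betw (\<lambda>n. n - k) UNIV UNIV"
    by (rule bij_betwI[where g = "\<lambda>n. n + k"]) auto
  have "(\<lambda>n. norm (c * fourier_coeff a (n - k))) summable_on UNIV"
    unfolding norm_mult
    using summable_on_reindex_bij_betw[OF bij, of "\<lambda>n. norm (fourier_coeff a n)"] summable_fourier_coeff[of a]
    by (intro summable_on_cmult_right) simp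
  then have b: "fourier_coeff (Abs_wiener (\<lambda>n. c * fourier_coeff a (n - k))) = (\<lambda>n. c * fourier_coeff a (n - k))"
    by (simp add: Abs_wiener_inverse)
  show ?thesis
  proof (intro exI allI impI)
    fix w :: complex assume "norm w = 1"
    then have w: "w \<noteq> 0" by auto
    have "wiener_eval (Abs_wiener (\<lambda>n. c * fourier_coeff a (n - k))) w
        = (\<Sum>\<^sub>\<infinity>n. c * w powi k * (fourier_coeff a (n - k) * w powi (n - k)))"
      unfolding wiener_eval_def b using w by (intro infsum_cong) (simp add: power_int_diff)
    also have "\<dots> = c * w powi k * (\<Sum>\<^sub>\<infinity>n. fourier_coeff a (n - k) * w powi (n - k))"
      by (rule infsum_cmult_right')
    also have "(\<Sum>\<^sub>\<infinity>n. fourier_coeff a (n - k) * w powi (n - k)) = wiener_eval a w"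
      unfolding wiener_eval_def by (rule infsum_reindex_bij_betw[OF bij])
    finally show "wiener_eval (Abs_wiener (\<lambda>n. c * fourier_coeff a (n - k))) w = c * w powi k * wiener_eval a w" .
  qed
qed

lemma loop_of_wiener_entries:
  "\<exists>h :: loop. \<forall>lam. loop_eval h lam =
    mat22 (wiener_eval a lam) (wiener_eval b lam) (wiener_eval c lam) (wiener_eval d lam)"
proof (intro exI allI)
  show "loop_eval (vector [vector [a, b], vector [c, d]]) lam =
    mat22 (wiener_eval a lam) (wiener_eval b lam) (wiener_eval c lam) (wiener_eval d lam)" for lam
    by (simp add: mat2_eq_iff loop_eval_nth)
qed

lemma loop_mult_diag:
  "\<exists>h. \<forall>lam. norm lam = 1 \<longrightarrow> loop_eval h lam = loop_eval g lam ** mat22 p 0 0 q"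
proof -
  obtain a where a: "\<And>w. norm w = 1 \<Longrightarrow> wiener_eval a w = p * w powi 0 * wiener_eval (g $ 1 $ 1) w"
    using wiener_eval_scale_shift[of "p" "0" "g $ 1 $ 1"] by blast
  obtain b where b: "\<And>w. norm w = 1 \<Longrightarrow> wiener_eval b w = q * w powi 0 * wiener_eval (g $ 1 $ 2) w"
    using wiener_eval_scale_shift[of "q" "0" "g $ 1 $ 2"] by blast
  obtain c where c: "\<And>w. norm w = 1 \<Longrightarrow> wiener_eval c w = p * w powi 0 * wiener_eval (g $ 2 $ 1) w"
    using wiener_eval_scale_shift[of "p" "0" "g $ 2 $ 1"] by blast
  obtain d where d: "\<And>w. norm w = 1 \<Longrightarrow> wiener_eval d w = q * w powi 0 * wiener_eval (g $ 2 $ 2) w"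
    using wiener_eval_scale_shift[of "q" "0" "g $ 2 $ 2"] by blast
  obtain h where h: "\<And>lam. loop_eval h lam =
      mat22 (wiener_eval a lam) (wiener_eval b lam) (wiener_eval c lam) (wiener_eval d lam)"
    using loop_of_wiener_entries[of a b c d] by blast
  show ?thesis
    by (intro exI[of _ h]) (simp add: h a b c d mat2_eq_iff mult22_nth loop_eval_nth mult.commute)
qed

lemma loop_mult_omega0:
  "\<exists>h. \<forall>lam. norm lam = 1 \<longrightarrow> loop_eval h lam = loop_eval g lam ** omega0 lam"
proof -
  obtain a where a: "\<And>w. norm w = 1 \<Longrightarrow> wiener_eval a w = - 1 * w powi 1 * wiener_eval (g $ 1 $ 2) w"
    using wiener_eval_scale_shift[of "- 1" "1" "g $ 1 $ 2"] by blast
  obtain b where b: "\<And>w. norm w = 1 \<Longrightarrow> wiener_eval b w = 1 * w powi (- 1) * wiener_eval (g $ 1 $ 1) w"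
    using wiener_eval_scale_shift[of "1" "(- 1)" "g $ 1 $ 1"] by blast
  obtain c where c: "\<And>w. norm w = 1 \<Longrightarrow> wiener_eval c w = - 1 * w powi 1 * wiener_eval (g $ 2 $ 2) w"
    using wiener_eval_scale_shift[of "- 1" "1" "g $ 2 $ 2"] by blast
  obtain d where d: "\<And>w. norm w = 1 \<Longrightarrow> wiener_eval d w = 1 * w powi (- 1) * wiener_eval (g $ 2 $ 1) w"
    using wiener_eval_scale_shift[of "1" "(- 1)" "g $ 2 $ 1"] by blast
  obtain h where h: "\<And>lam. loop_eval h lam =
      mat22 (wiener_eval a lam) (wiener_eval b lam) (wiener_eval c lam) (wiener_eval d lam)"
    using loop_of_wiener_entries[of a b c d] by blast
  show ?thesis
    by (intro exI[of _ h])
      (simp add: h a b c d mat2_eq_iff mult22_nth loop_eval_nth omega0_def power_int_minus mult.commute)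
qed

section \<open>The minimal surface of an extended frame\<close>

text \<open>The isometric action of \<open>SL2\<close> on the space of Hermitian matrices. For \<open>q = 0\<close> the Sym formula is the
  orbit map of the identity matrix.\<close>
definition conj_act :: "mat2 \<Rightarrow> mat2 \<Rightarrow> mat2" where
  "conj_act P X = P ** X ** adj P"

lemma det_adj: "det (adj P) = cnj (det P)"
  by (simp add: det22 mult.commute)

lemma adj_conj_act: "adj (conj_act P X) = conj_act P (adj X)"
  by (simp add: mat2_eq_iff conj_act_def mult22_nth algebra_simps)

lemma det_conj_act: "det P = 1 \<Longrightarrow> det (conj_act P X) = det X"
  by (simp add: conj_act_def det_mul det_adj)

lemma conj_act_add: "conj_act P (X + Y) = conj_act P X + conj_act P Y"
  by (simp add: mat2_eq_iff conj_act_def mult22_nth algebra_simps)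

lemma lorentz_conj_act: "det P = 1 \<Longrightarrow> lorentz (conj_act P X) (conj_act P Y) = lorentz X Y"
  by (simp add: lorentz_def det_conj_act conj_act_add[symmetric])

lemma conj_act_inject:
  assumes "det P = 1" "conj_act P X = conj_act P Y" shows "X = Y"
proof -
  have "adjugate P ** conj_act P Z ** adjugate (adj P) = Z" for Z
  proof -
    have "adjugate P ** conj_act P Z ** adjugate (adj P) =
        (adjugate P ** P) ** Z ** (adj P ** adjugate (adj P))"
      by (simp add: conj_act_def matrix_mul_assoc)
    then show ?thesis
      using assms(1) by (simp add: mult_adjugate det_adj)
  qed
  then show ?thesis using assms(2) by metis
qed

lemma has_derivative_conj_act:
  assumes P: "(P has_derivative (\<lambda>h. P z ** W h)) (at z)" and X: "(X has_derivative X') (at z)"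
  shows "((\<lambda>z. conj_act (P z) (X z)) has_derivative
    (\<lambda>h. conj_act (P z) (W h ** X z + X' h + X z ** adj (W h)))) (at z)"
proof -
  have "((\<lambda>z. adj (P z)) has_derivative (\<lambda>h. adj (P z ** W h))) (at z)"
    by (rule bounded_linear.has_derivative[OF bounded_linear_adj P])
  note bounded_bilinear.FDERIV[OF bounded_bilinear_mat2_mult
      bounded_bilinear.FDERIV[OF bounded_bilinear_mat2_mult P X] this]
  then show ?thesis
    unfolding conj_act_def
    by (rule has_derivative_eq_rhs)
      (simp add: fun_eq_iff adj_mult matrix_mul_assoc matrix_add_ldistrib
        mat2_eq_iff mult22_nth algebra_simps)
qed

lemma smooth_on_conj_act:
  assumes "open S" "smooth_on S P" "smooth_on S X"
  shows "smooth_on S (\<lambda>z. conj_act (P z) (X z))"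
  unfolding conj_act_def
  by (intro smooth_on_bounded_bilinear[OF assms(1) bounded_bilinear_mat2_mult]
      smooth_on_bounded_linear[OF assms(1) bounded_linear_adj] assms)

lemma conj_act_mat1_in_H3:
  assumes "det P = 1" shows "conj_act P (mat 1) \<in> H3"
proof -
  have "adj (mat 1) = mat 1" by (simp add: mat2_eq_iff)
  moreover have "Re (trace (conj_act P (mat 1))) > 0"
  proof -
    have "Re (trace (conj_act P (mat 1))) = (cmod (P $ 1 $ 1))\<^sup>2 + (cmod (P $ 1 $ 2))\<^sup>2 +
        (cmod (P $ 2 $ 1))\<^sup>2 + (cmod (P $ 2 $ 2))\<^sup>2"
      unfolding cmod_power2
      by (simp add: trace_def sum_2 conj_act_def mult22_nth power2_eq_square)
    moreover have "P $ 1 $ 1 \<noteq> 0 \<or> P $ 1 $ 2 \<noteq> 0"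
      using assms by (auto simp: det22)
    then have "(cmod (P $ 1 $ 1))\<^sup>2 + (cmod (P $ 1 $ 2))\<^sup>2 > 0"
      by (auto simp: add_pos_nonneg add_nonneg_pos)
    ultimately show ?thesis
      by (smt (verit) zero_le_power2)
  qed
  ultimately show ?thesis
    using assms by (simp add: H3_def Her2_def adj_conj_act det_conj_act)
qed

lemma lorentz_offdiag:
  "lorentz (mat22 0 a (cnj a) 0) (mat22 0 b (cnj b) 0) = Re (a * cnj b)"
  by (simp add: lorentz_def det22 algebra_simps)

lemma lorentz_diag: "lorentz X (mat22 1 0 0 (-1)) = Re (X $ 1 $ 1 - X $ 2 $ 2) / 2"
  by (simp add: lorentz_def det22 algebra_simps)

lemma calH_0: "calH 0 = \<i>"
  by (simp add: calH_def)

text \<open>The connection form of an extended frame with \<open>q = 0\<close>, evaluated on the tangent vector \<open>h\<close>.\<close>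
definition frame_form :: "(complex \<Rightarrow> real) \<Rightarrow> (complex \<Rightarrow> complex) \<Rightarrow> complex \<Rightarrow> complex \<Rightarrow> complex \<Rightarrow> mat2"
  where
  "frame_form u Q z lam h = cscale h (frame_U 0 u Q z lam) + cscale (cnj h) (frame_V 0 u Q z lam)"

lemma frame_form_nth:
  "frame_form u Q z lam h $ 1 $ 1 = h * dz_real u z / 4 - cnj h * cnj (dz_real u z) / 4"
  "frame_form u Q z lam h $ 2 $ 2 = - h * dz_real u z / 4 + cnj h * cnj (dz_real u z) / 4"
  "frame_form u Q z lam h $ 1 $ 2 = - (\<i> / 2) * of_real (exp (u z / 2)) * h * inverse lam
     - \<i> * cnj (Q z) * of_real (exp (- u z / 2)) * cnj h * lam"
  "frame_form u Q z lam h $ 2 $ 1 = - \<i> * Q z * of_real (exp (- u z / 2)) * h * inverse lam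
     + (\<i> / 2) * of_real (exp (u z / 2)) * cnj h * lam"
  by (simp_all add: frame_form_def frame_U_def frame_V_def calH_0 algebra_simps)

text \<open>The off-diagonal Hermitian matrix that represents the derivative of the surface in direction
  \<open>h\<close>, pulled back to the identity by the frame.\<close>
definition tangent_form :: "(complex \<Rightarrow> real) \<Rightarrow> complex \<Rightarrow> complex \<Rightarrow> complex \<Rightarrow> mat2" where
  "tangent_form u lam h z =
     mat22 0 (- \<i> * cnj lam * h * of_real (exp (u z / 2))) (\<i> * lam * cnj h * of_real (exp (u z / 2))) 0"

lemma frame_form_add_adj:
  assumes "norm lam = 1"
  shows "frame_form u Q z lam h + adj (frame_form u Q z lam h) = tangent_form u lam h z"
proof -
  have "lam * cnj lam = 1" using assms complex_norm_square[of lam] by simp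
  then have "inverse lam = cnj lam" by (rule inverse_unique)
  then show ?thesis
    by (simp add: mat2_eq_iff frame_form_nth tangent_form_def algebra_simps)
qed

text \<open>Pairing with \<open>diag(1, -1)\<close> sees only the diagonal, to which the derivative \<open>X\<close> of the tangent
  form does not contribute. In the remaining products the terms with \<open>h\<close> and \<open>cnj k\<close> cancel, and what
  is left is the real part of a form that is complex bilinear in \<open>h\<close> and \<open>k\<close>.\<close>
lemma second_fundamental_form:
  assumes lam: "norm lam = 1" and X: "X $ 1 $ 1 = 0" "X $ 2 $ 2 = 0"
  shows "lorentz (frame_form u Q z lam k ** tangent_form u lam h z + X +
      tangent_form u lam h z ** adj (frame_form u Q z lam k)) (mat22 1 0 0 (-1)) =
    2 * Re (Q z * (cnj lam)\<^sup>2 * h * k)"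
proof -
  define E E' where "E = complex_of_real (exp (u z / 2))" "E' = complex_of_real (exp (- (u z / 2)))"
  have ll: "lam * cnj lam = 1" using lam complex_norm_square[of lam] by simp
  then have inv: "inverse lam = cnj lam" by (rule inverse_unique)
  have EE: "E * E' = 1"
    by (simp add: E_E'_def of_real_mult[symmetric] exp_add[symmetric] del: of_real_mult)
  have cE: "cnj E = E" "cnj E' = E'" by (simp_all add: E_E'_def)
  define c where "c = - \<i> * cnj lam * h * E"
  define p where "p = frame_form u Q z lam k $ 1 $ 2"
  define q where "q = frame_form u Q z lam k $ 2 $ 1"
  have T: "tangent_form u lam h z = mat22 0 c (cnj c) 0"
    by (simp add: tangent_form_def c_def E_E'_def)
  have "p * cnj c = (- (\<i> / 2) * E * k * cnj lam - \<i> * cnj (Q z) * E' * cnj k * lam) *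
      (\<i> * lam * cnj h * E)"
    by (simp add: p_def frame_form_nth E_E'_def[symmetric] inv c_def cE)
  also have "\<dots> = (lam * cnj lam) * (E * E * k * cnj h / 2) +
      (E * E') * (lam * lam * cnj k * cnj h * cnj (Q z))"
    by (simp add: algebra_simps)
  finally have pc: "p * cnj c = E * E * k * cnj h / 2 + lam * lam * cnj k * cnj h * cnj (Q z)"
    by (simp add: ll EE)
  have "q * c = (- \<i> * Q z * E' * k * cnj lam + (\<i> / 2) * E * cnj k * lam) * (- \<i> * cnj lam * h * E)"
    by (simp add: q_def frame_form_nth E_E'_def[symmetric] inv c_def)
  also have "\<dots> = (lam * cnj lam) * (E * E * cnj k * h / 2) -
      (E * E') * (cnj lam * cnj lam * k * h * Q z)"
    by (simp add: algebra_simps)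
  finally have qc: "q * c = E * E * cnj k * h / 2 - cnj lam * cnj lam * k * h * Q z"
    by (simp add: ll EE)
  have "lorentz (frame_form u Q z lam k ** tangent_form u lam h z + X +
      tangent_form u lam h z ** adj (frame_form u Q z lam k)) (mat22 1 0 0 (-1)) =
      Re ((p * cnj c + cnj (p * cnj c)) - (q * c + cnj (q * c))) / 2"
    unfolding lorentz_diag T by (simp add: mult22_nth X p_def q_def mult.commute)
  also have "\<dots> = Re (p * cnj c) - Re (q * c)"
    by simp
  also have "\<dots> = Re (lam * lam * cnj k * cnj h * cnj (Q z)) + Re (cnj lam * cnj lam * k * h * Q z)
      + (Re (E * E * k * cnj h / 2) - Re (E * E * cnj k * h / 2))"
    unfolding pc qc by (simp only: plus_complex.sel minus_complex.sel)
  also have "E * E * cnj k * h / 2 = cnj (E * E * k * cnj h / 2)"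
    by (simp add: cE)
  also have "lam * lam * cnj k * cnj h * cnj (Q z) = cnj (cnj lam * cnj lam * k * h * Q z)"
    by simp
  finally have "lorentz (frame_form u Q z lam k ** tangent_form u lam h z + X +
      tangent_form u lam h z ** adj (frame_form u Q z lam k)) (mat22 1 0 0 (-1)) =
      2 * Re (cnj lam * cnj lam * k * h * Q z)"
    by (simp only: cnj.sel)
  also have "cnj lam * cnj lam * k * h * Q z = Q z * (cnj lam)\<^sup>2 * h * k"
    by (simp add: power2_eq_square mult.commute mult.left_commute)
  finally show ?thesis .
qed

text \<open>The tangent vectors come from off-diagonal Hermitian matrices whose norm depends only on \<open>\<bar>h\<bar>\<close>, so
  the surface is conformally parametrised and \<open>diag(1, -1)\<close> gives its normal. The second fundamental
  form is the real part of a complex bilinear form, which has trace zero with respect to a conformal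
  metric: the surface is minimal.\<close>
lemma minimal_surface_of_frame:
  fixes P :: "complex \<Rightarrow> mat2"
  assumes W: "open W" and u: "smooth_on W u" and P: "smooth_on W P"
    and det: "\<And>z. z \<in> W \<Longrightarrow> det (P z) = 1" and lam: "norm lam = 1"
    and dP: "\<And>z. z \<in> W \<Longrightarrow> (P has_derivative (\<lambda>h. P z ** frame_form u Q z lam h)) (at z)"
  defines "f \<equiv> \<lambda>z. conj_act (P z) (mat 1)" and "N \<equiv> \<lambda>z. conj_act (P z) (mat22 1 0 0 (-1))"
  shows "H3_immersion W f" "conformal_metric W f u" "unit_normal W f N"
    and "z \<in> W \<Longrightarrow> mean_curvature f N z = 0" "z \<in> W \<Longrightarrow> hopf f N z = Q z * (cnj lam)\<^sup>2"
proof -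
  have df: "(f has_derivative (\<lambda>h. conj_act (P z) (tangent_form u lam h z))) (at z)" if "z \<in> W" for z
  proof -
    have "(f has_derivative (\<lambda>h. conj_act (P z) (frame_form u Q z lam h ** mat 1 + 0 +
        mat 1 ** adj (frame_form u Q z lam h)))) (at z)"
      unfolding f_def by (rule has_derivative_conj_act[OF dP[OF that] has_derivative_const])
    then show ?thesis by (simp add: frame_form_add_adj[OF lam])
  qed
  have fx: "dx f z = conj_act (P z) (tangent_form u lam 1 z)"
    and fy: "dy f z = conj_act (P z) (tangent_form u lam \<i> z)" if "z \<in> W" for z
    using dx_eq[OF df[OF that]] dy_eq[OF df[OF that]] .
  have T: "tangent_form u lam h z = mat22 0 (- \<i> * cnj lam * h * of_real (exp (u z / 2)))
      (cnj (- \<i> * cnj lam * h * of_real (exp (u z / 2)))) 0" for h z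
    by (simp add: tangent_form_def)
  have lT: "lorentz (tangent_form u lam h z) (tangent_form u lam k z) = exp (u z) * Re (h * cnj k)" for h k z
  proof -
    have ll: "cnj lam * lam = 1" using lam complex_norm_square[of lam] by (simp add: mult.commute)
    have ee: "of_real (exp (u z / 2)) * of_real (exp (u z / 2)) = complex_of_real (exp (u z))"
      by (simp add: of_real_mult[symmetric] exp_add[symmetric] del: of_real_mult)
    have "lorentz (tangent_form u lam h z) (tangent_form u lam k z) =
        Re ((cnj lam * lam) * (of_real (exp (u z / 2)) * of_real (exp (u z / 2))) * (h * cnj k))"
      unfolding T lorentz_offdiag by (simp add: algebra_simps)
    then show ?thesis unfolding ll ee by simp
  qed
  show conf: "conformal_metric W f u"
    unfolding conformal_metric_def by (simp add: fx fy lorentz_conj_act det lT)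
  show "H3_immersion W f"
    unfolding H3_immersion_def
  proof (intro conjI ballI)
    show "smooth_on W f"
      unfolding f_def by (rule smooth_on_conj_act[OF W P smooth_on_const[OF W]])
    show "f z \<in> H3" if "z \<in> W" for z
      unfolding f_def by (rule conj_act_mat1_in_H3[OF det[OF that]])
    show "inj (frechet_derivative f (at z))" if "z \<in> W" for z
    proof (rule injI)
      fix h k assume eq: "frechet_derivative f (at z) h = frechet_derivative f (at z) k"
      have "tangent_form u lam h z = tangent_form u lam k z"
        using conj_act_inject[OF det[OF that]] eq
        by (simp add: frechet_derivative_at[OF df[OF that], symmetric])
      moreover have "lam \<noteq> 0" using lam by auto
      ultimately show "h = k" by (simp add: mat2_eq_iff tangent_form_def)
    qed
  qed
  show "unit_normal W f N"
    unfolding unit_normal_def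
  proof (intro conjI ballI)
    show "smooth_on W N"
      unfolding N_def by (rule smooth_on_conj_act[OF W P smooth_on_const[OF W]])
    fix z assume z: "z \<in> W"
    show "N z \<in> Her2"
      by (simp add: N_def Her2_def adj_conj_act) (simp add: mat2_eq_iff conj_act_def mult22_nth)
    show "lorentz (N z) (N z) = 1" "lorentz (N z) (f z) = 0"
      unfolding N_def f_def lorentz_conj_act[OF det[OF z]] by (simp_all add: lorentz_def det22)
    show "lorentz (N z) (dx f z) = 0" "lorentz (N z) (dy f z) = 0"
      unfolding N_def fx[OF z] fy[OF z] lorentz_conj_act[OF det[OF z]]
      by (simp_all add: lorentz_def det22 tangent_form_def)
  qed
  have d2f: "lorentz (frechet_derivative g (at z) k) (N z) = 2 * Re (Q z * (cnj lam)\<^sup>2 * h * k)"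
    if z: "z \<in> W" and g: "\<And>z. z \<in> W \<Longrightarrow> g z = conj_act (P z) (tangent_form u lam h z)" for g z h k
  proof -
    define u' where "u' = frechet_derivative u (at z)"
    define X' where "X' = (\<lambda>k. mat22 0 (- \<i> * cnj lam * h * of_real (exp (u z / 2) * (u' k / 2)))
      (\<i> * lam * cnj h * of_real (exp (u z / 2) * (u' k / 2))) 0)"
    have du: "(u has_derivative u') (at z)"
      unfolding u'_def by (rule smooth_on_has_derivative[OF u z])
    have "((\<lambda>z. tangent_form u lam h z) has_derivative X') (at z)"
    proof (rule has_derivative_mat2I)
      have e: "((\<lambda>z. complex_of_real (exp (u z / 2))) has_derivative
          (\<lambda>k. of_real (exp (u z / 2) * (u' k / 2)))) (at z)"
        by (rule has_derivative_of_real) (auto intro!: derivative_eq_intros du)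
      show "((\<lambda>z. tangent_form u lam h z $ i $ j) has_derivative (\<lambda>k. X' k $ i $ j)) (at z)" for i j
        using exhaust_2[of i] exhaust_2[of j] has_derivative_mult_right[OF e]
        by (auto simp: tangent_form_def X'_def)
    qed
    from has_derivative_conj_act[OF dP[OF z] this]
    have "(g has_derivative (\<lambda>k. conj_act (P z) (frame_form u Q z lam k ** tangent_form u lam h z + X' k +
        tangent_form u lam h z ** adj (frame_form u Q z lam k)))) (at z)"
      by (rule has_derivative_transform_within_open[OF _ W z]) (simp add: g)
    from fun_cong[OF frechet_derivative_at[OF this], of k] have "frechet_derivative g (at z) k =
        conj_act (P z) (frame_form u Q z lam k ** tangent_form u lam h z + X' k +
        tangent_form u lam h z ** adj (frame_form u Q z lam k))"
      by (rule sym)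
    then show ?thesis
      by (simp add: N_def lorentz_conj_act det z second_fundamental_form[OF lam] X'_def)
  qed
  have II: "lorentz (dx (dx f) z) (N z) = 2 * Re (Q z * (cnj lam)\<^sup>2)"
    "lorentz (dx (dy f) z) (N z) = 2 * Re (Q z * (cnj lam)\<^sup>2 * \<i>)"
    "lorentz (dy (dy f) z) (N z) = - 2 * Re (Q z * (cnj lam)\<^sup>2)" if "z \<in> W" for z
    unfolding dx_def[of "dx f"] dx_def[of "dy f"] dy_def[of "dy f"]
    using d2f[OF that fx, of 1] d2f[OF that fy, of 1] d2f[OF that fy, of \<i>]
    by (simp_all add: mult.assoc)
  show "mean_curvature f N z = 0" if "z \<in> W"
    using conf that
    by (simp add: mean_curvature_def conformal_metric_def II Let_def distrib_left right_diff_distrib)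
  show "hopf f N z = Q z * (cnj lam)\<^sup>2" if "z \<in> W"
    by (simp add: hopf_def II[OF that] complex_eq_iff)
qed

section \<open>The Maurer-Cartan form of an Iwasawa factor\<close>

text \<open>The matrix functions to which the reflection argument applies entrywise.\<close>
definition disc_matrix :: "(complex \<Rightarrow> mat2) \<Rightarrow> bool" where
  "disc_matrix M \<longleftrightarrow> (\<forall>i j. continuous_on (cball 0 1) (\<lambda>w. M w $ i $ j) \<and>
     (\<lambda>w. M w $ i $ j) holomorphic_on ball 0 1)"

lemma disc_matrixD:
  assumes "disc_matrix M"
  shows "continuous_on (cball 0 1) (\<lambda>w. M w $ i $ j)" "(\<lambda>w. M w $ i $ j) holomorphic_on ball 0 1"
  using assms by (simp_all add: disc_matrix_def)

lemma disc_matrix_const: "disc_matrix (\<lambda>w. M)"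
  by (simp add: disc_matrix_def)

lemma disc_matrix_add: "disc_matrix M \<Longrightarrow> disc_matrix N \<Longrightarrow> disc_matrix (\<lambda>w. M w + N w)"
  by (simp add: disc_matrix_def continuous_on_add holomorphic_on_add)

lemma disc_matrix_mult: "disc_matrix M \<Longrightarrow> disc_matrix N \<Longrightarrow> disc_matrix (\<lambda>w. M w ** N w)"
  by (simp add: disc_matrix_def mult22_nth continuous_on_add continuous_on_mult
      holomorphic_on_add holomorphic_on_mult)

lemma disc_matrix_cscale:
  assumes "f holomorphic_on UNIV" "disc_matrix M" shows "disc_matrix (\<lambda>w. cscale (f w) (M w))"
proof -
  have "continuous_on (cball 0 1) f" "f holomorphic_on ball 0 1"
    using holomorphic_on_imp_continuous_on[OF assms(1)] assms(1)
      continuous_on_subset holomorphic_on_subset by blast+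
  then show ?thesis
    using assms(2) by (simp add: disc_matrix_def continuous_on_mult holomorphic_on_mult)
qed

lemma disc_matrix_adjugate: "disc_matrix M \<Longrightarrow> disc_matrix (\<lambda>w. adjugate (M w))"
  by (simp add: disc_matrix_def forall_2 continuous_on_minus holomorphic_on_minus)

lemma disc_matrix_plus_mat: "disc_matrix (plus_mat g)"
  by (simp add: disc_matrix_def plus_mat_disc)

lemma cscale_1: "cscale 1 A = A"
  by (simp add: mat2_eq_iff)

lemma cscale_mult: "cscale k A ** B = cscale k (A ** B)" "A ** cscale k B = cscale k (A ** B)"
  by (simp_all add: mat2_eq_iff mult22_nth algebra_simps)

lemma bounded_linear_cscale: "bounded_linear (cscale k)"
  unfolding linear_conv_bounded_linear[symmetric]
  by (auto intro!: linearI simp: mat2_eq_iff algebra_simps)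

text \<open>Here \<open>r\<close> is the logarithmic derivative of \<open>g\<close>. The modulus sees only its real part and the phase only its
  imaginary part.\<close>
lemma modulus_phase_derivative:
  fixes g :: "complex \<Rightarrow> complex"
  assumes g: "(g has_derivative (\<lambda>h. g z * r h)) (at z)" and nz: "g z \<noteq> 0"
  shows "((\<lambda>z. cmod (g z)) has_derivative (\<lambda>h. cmod (g z) * Re (r h))) (at z)"
    and "((\<lambda>z. \<kappa> * g z / of_real (cmod (g z))) has_derivative
      (\<lambda>h. \<kappa> * g z / of_real (cmod (g z)) * (\<i> * of_real (Im (r h))))) (at z)"
proof -
  have "((\<lambda>z. cmod (g z)) has_derivative (\<lambda>h. (g z * r h) \<bullet> sgn (g z))) (at z)"
    by (rule has_derivative_compose[OF g has_derivative_norm[OF nz]])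
  moreover have "(g z * r h) \<bullet> sgn (g z) = cmod (g z) * Re (r h)" for h
  proof -
    have "(g z * r h) \<bullet> sgn (g z) = Re ((g z * cnj (g z)) * r h) / cmod (g z)"
      by (simp add: inner_complex_def sgn_div_norm algebra_simps divide_inverse)
    also have "g z * cnj (g z) = of_real ((cmod (g z))\<^sup>2)"
      by (rule complex_norm_square[symmetric])
    finally show ?thesis
      using nz by (simp add: power2_eq_square)
  qed
  ultimately show m: "((\<lambda>z. cmod (g z)) has_derivative (\<lambda>h. cmod (g z) * Re (r h))) (at z)"
    by simp
  have "((\<lambda>z. \<kappa> * g z / of_real (cmod (g z))) has_derivative (\<lambda>h.
      - (\<kappa> * g z) * (inverse (of_real (cmod (g z))) * of_real (cmod (g z) * Re (r h)) *
      inverse (of_real (cmod (g z)))) + \<kappa> * (g z * r h) / of_real (cmod (g z)))) (at z)"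
    by (rule has_derivative_divide[OF has_derivative_mult_right[OF g] has_derivative_of_real[OF m]])
      (use nz in simp)
  then show "((\<lambda>z. \<kappa> * g z / of_real (cmod (g z))) has_derivative
      (\<lambda>h. \<kappa> * g z / of_real (cmod (g z)) * (\<i> * of_real (Im (r h))))) (at z)"
  proof (rule has_derivative_eq_rhs)
    have "- (\<kappa> * g z) * (inverse (of_real (cmod (g z))) * of_real (cmod (g z) * Re (r h)) *
      inverse (of_real (cmod (g z)))) + \<kappa> * (g z * r h) / of_real (cmod (g z)) =
      \<kappa> * g z / of_real (cmod (g z)) * (r h - of_real (Re (r h)))" for h
      using nz by (simp add: field_simps)
    moreover have "x - of_real (Re x) = \<i> * of_real (Im x)" for x
      by (simp add: complex_eq_iff)
    ultimately show "(\<lambda>h. - (\<kappa> * g z) * (inverse (of_real (cmod (g z))) * of_real (cmod (g z) * Re (r h)) *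
      inverse (of_real (cmod (g z)))) + \<kappa> * (g z * r h) / of_real (cmod (g z))) =
      (\<lambda>h. \<kappa> * g z / of_real (cmod (g z)) * (\<i> * of_real (Im (r h))))"
      by (simp only:)
  qed
qed

text \<open>The modulus is written as \<open>exp (ln (\<bar>g\<bar>\<^sup>2) / 2)\<close>, where \<open>\<bar>g\<bar>\<^sup>2\<close> is bilinear in \<open>g\<close> and its conjugate.\<close>
lemma smooth_on_cmod:
  fixes g :: "complex \<Rightarrow> complex"
  assumes S: "open S" and g: "smooth_on S g" and nz: "\<And>z. z \<in> S \<Longrightarrow> g z \<noteq> 0"
  shows "smooth_on S (\<lambda>z. cmod (g z))"
proof -
  have sq: "smooth_on S (\<lambda>z. Re (g z * cnj (g z)))"
    by (intro smooth_on_bounded_linear[OF S bounded_linear_Re]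
        smooth_on_bounded_bilinear[OF S bounded_bilinear_mult]
        smooth_on_bounded_linear[OF S bounded_linear_cnj] g)
  have Re: "Re (g z * cnj (g z)) = (cmod (g z))\<^sup>2" for z
    unfolding complex_norm_square[symmetric] by simp
  have "smooth_on S (\<lambda>z. exp ((1 / 2) *\<^sub>R ln ((cmod (g z))\<^sup>2)))"
    by (intro smooth_on_exp[OF S] smooth_on_bounded_linear[OF S bounded_linear_scaleR_right]
        smooth_on_ln[OF S] sq[unfolded Re]) (simp add: nz)
  then show ?thesis
  proof (rule smooth_on_cong[OF S, rotated])
    fix z assume "z \<in> S"
    then have "cmod (g z) > 0" using nz by simp
    then show "exp ((1 / 2) *\<^sub>R ln ((cmod (g z))\<^sup>2)) = cmod (g z)"
      by (simp add: ln_realpow)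
  qed
qed

lemma trace_of_derivative_of_unimodular:
  fixes P :: "complex \<Rightarrow> mat2"
  assumes S: "open S" "z \<in> S" and det: "\<And>z. z \<in> S \<Longrightarrow> det (P z) = 1"
    and dP: "(P has_derivative (\<lambda>h. P z ** W h)) (at z)"
  shows "W h $ 2 $ 2 = - W h $ 1 $ 1"
proof -
  have e: "((\<lambda>z. P z $ i $ j) has_derivative (\<lambda>h. (P z ** W h) $ i $ j)) (at z)" for i j
    by (rule bounded_linear.has_derivative[OF bounded_linear_mat2_nth dP])
  have "((\<lambda>z. det (P z)) has_derivative (\<lambda>h. det (P z) * (W h $ 1 $ 1 + W h $ 2 $ 2))) (at z)"
    unfolding det22
    by (rule has_derivative_eq_rhs, rule has_derivative_diff; (rule has_derivative_mult, rule e, rule e)?)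
      (simp add: fun_eq_iff mult22_nth algebra_simps)
  moreover have "((\<lambda>z. det (P z)) has_derivative (\<lambda>h. 0)) (at z)"
    by (rule has_derivative_transform_within_open[OF has_derivative_const S]) (simp add: det)
  ultimately have "(\<lambda>h. det (P z) * (W h $ 1 $ 1 + W h $ 2 $ 2)) = (\<lambda>h. 0)"
    by (rule has_derivative_unique)
  then have "W h $ 1 $ 1 + W h $ 2 $ 2 = 0"
    using det[OF S(2)] by (simp add: fun_eq_iff)
  then show ?thesis by (simp add: add_eq_0_iff)
qed

lemma lambda_eta_entire:
  assumes pot: "holomorphic_potential D e" and z: "z \<in> D"
  shows "(\<lambda>lam. lambda_eta e z lam $ i $ j) holomorphic_on UNIV"
proof -
  have "(\<lambda>lam. lambda_eta e z lam $ i $ j) field_differentiable (at lam)" for lam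
  proof -
    obtain a b where "((\<lambda>(z, lam). lambda_eta e z lam $ i $ j) has_derivative
        (\<lambda>h. a * fst h + b * snd h)) (at (z, lam))"
      using pot z unfolding holomorphic_potential_def holomorphic2_on_def by blast
    then have "((\<lambda>l. (\<lambda>(z, lam). lambda_eta e z lam $ i $ j) (z, l)) has_derivative
        (\<lambda>h. a * fst (0 :: complex, h) + b * snd (0 :: complex, h))) (at lam)"
      by (rule has_derivative_compose[rotated]) (auto intro!: derivative_eq_intros)
    then have "((\<lambda>l. lambda_eta e z l $ i $ j) has_field_derivative b) (at lam)"
      by (simp add: has_field_derivative_def)
    then show ?thesis by (auto simp: field_differentiable_def)
  qed
  then show ?thesis by (simp add: holomorphic_on_def)
qed

lemma continuous_on_lambda_eta:
  assumes pot: "holomorphic_potential D e"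
  shows "continuous_on (D \<times> UNIV) (\<lambda>(z, lam). lambda_eta e z lam $ i $ j)"
proof (rule continuous_at_imp_continuous_on, rule ballI)
  fix p assume "p \<in> D \<times> (UNIV :: complex set)"
  then obtain a b where "((\<lambda>(z, lam). lambda_eta e z lam $ i $ j) has_derivative
        (\<lambda>h. a * fst h + b * snd h)) (at p)"
    using pot unfolding holomorphic_potential_def holomorphic2_on_def by blast
  then show "isCont (\<lambda>(z, lam). lambda_eta e z lam $ i $ j) p"
    by (rule has_derivative_continuous)
qed

lemma lambda_eta_0: "lambda_eta e z 0 = e (- 1) z"
proof -
  have "(\<Sum>n. 0 ^ n * e (int n - 1) z $ r $ s) = e (- 1) z $ r $ s" for r s
    using powser_zero[of "\<lambda>n. e (int n - 1) z $ r $ s"] by (simp add: mult.commute)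
  then show ?thesis by (simp add: lambda_eta_def vec_eq_iff)
qed

text \<open>The common situation of both cells. The loop \<open>F\<close> is the first factor, multiplied by \<open>omega0\<close> in
  the second cell; since \<open>tau4\<close> changes the sign of \<open>omega0\<close>, the reality condition carries a sign
  \<open>eps\<close>, which disappears from the Maurer-Cartan form. The square root \<open>s\<close> of the upper right entry
  of the leading coefficient exists whenever \<open>D\<close> is simply connected. It provides a
  single-valued smooth gauge on \<open>S\<close>, whatever the topology of \<open>S\<close>.\<close>
locale iwasawa_frame =
  fixes D S :: "complex set" and e :: "int \<Rightarrow> complex \<Rightarrow> mat2"
    and C F :: "complex \<Rightarrow> complex \<Rightarrow> mat2" and V :: "complex \<Rightarrow> loop"
    and eps :: complex and s :: "complex \<Rightarrow> complex"
  assumes D: "open D" and S: "open S" "S \<subseteq> D"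
    and potential: "holomorphic_potential D e"
    and s_hol: "s holomorphic_on D" and s_sq: "\<And>z. z \<in> D \<Longrightarrow> e (- 1) z $ 1 $ 2 = (s z)\<^sup>2"
    and C_ode: "\<And>lam z i j. lam \<noteq> 0 \<Longrightarrow> z \<in> D \<Longrightarrow>
      ((\<lambda>z. C z lam $ i $ j) has_field_derivative (C z lam ** eta e z lam) $ i $ j) (at z)"
    and C_hol: "\<And>z i j. z \<in> D \<Longrightarrow> (\<lambda>lam. C z lam $ i $ j) holomorphic_on - {0}"
    and V_smooth: "smooth_on S V" and V_plus: "\<And>z. z \<in> S \<Longrightarrow> V z \<in> LSL_plus"
    and F_loop: "\<And>z. z \<in> S \<Longrightarrow> \<exists>g\<in>LSL. \<forall>lam\<in>sphere 0 1. F z lam = loop_eval g lam"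
    and F_smooth: "\<And>lam. norm lam = 1 \<Longrightarrow> smooth_on S (\<lambda>z. F z lam)"
    and eps: "eps * eps = 1"
    and F_tau4: "\<And>z lam. z \<in> S \<Longrightarrow> norm lam = 1 \<Longrightarrow> tau4 (F z) lam = cscale eps (F z lam)"
    and C_eq: "\<And>z lam. z \<in> S \<Longrightarrow> norm lam = 1 \<Longrightarrow> C z lam = F z lam ** loop_eval (V z) lam"
begin

definition G :: "complex \<Rightarrow> complex \<Rightarrow> mat2" where "G z = plus_mat (V z)"

definition dG :: "complex \<Rightarrow> complex \<Rightarrow> complex \<Rightarrow> mat2" where
  "dG z h = plus_mat (frechet_derivative V (at z) h)"

definition v :: "complex \<Rightarrow> complex" where "v z = G z 0 $ 1 $ 1"

text \<open>The diagonal gauge, \<open>c = e\<close> to the \<open>\<i>\<theta>\<close>. It is the phase of \<open>s v\<close>, rotated by an eighth of a turn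
  so that the upper right entry of the leading coefficient of the gauged form becomes a negative
  multiple of \<open>\<i>\<close>.\<close>
definition c :: "complex \<Rightarrow> complex" where
  "c z = cis (pi / 4) * (s z * v z) / of_real (cmod (s z * v z))"

definition u :: "complex \<Rightarrow> real" where "u z = 2 * ln (2 * (cmod (s z * v z))\<^sup>2)"

definition Q :: "complex \<Rightarrow> complex" where "Q z = - 2 * e (- 1) z $ 1 $ 2 * e (- 1) z $ 2 $ 1"

definition phase_gauge :: "complex \<Rightarrow> mat2" where "phase_gauge z = mat22 (c z) 0 0 (cnj (c z))"

text \<open>The gauged first factor, written as \<open>C\<close> times the inverse of the plus factor. In this form it makes
  sense in the punctured disc.\<close>
definition inner_frame :: "complex \<Rightarrow> complex \<Rightarrow> mat2" where
  "inner_frame z lam = C z lam ** adjugate (G z lam) ** phase_gauge z"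

text \<open>The logarithmic derivative of \<open>s v\<close>. Its real part governs the metric and its imaginary part the
  gauge.\<close>
definition r :: "complex \<Rightarrow> complex \<Rightarrow> complex" where
  "r z h = deriv s z / s z * h + dG z h 0 $ 1 $ 1 / v z"

lemma det_G: "z \<in> S \<Longrightarrow> norm lam \<le> 1 \<Longrightarrow> det (G z lam) = 1"
  by (simp add: G_def det_plus_mat V_plus)

lemma G_0: "z \<in> S \<Longrightarrow> G z 0 $ 1 $ 2 = 0" "z \<in> S \<Longrightarrow> G z 0 $ 2 $ 1 = 0"
  by (simp_all add: G_def plus_mat_0_offdiag V_plus)

lemma v_mult: "z \<in> S \<Longrightarrow> v z * G z 0 $ 2 $ 2 = 1"
  using det_G[of z 0] by (simp add: det22 G_0 v_def)

lemma v_nz: "z \<in> S \<Longrightarrow> v z \<noteq> 0"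
  using v_mult[of z] by auto

lemma s_nz: "z \<in> D \<Longrightarrow> s z \<noteq> 0"
  using potential s_sq[of z] by (auto simp: holomorphic_potential_def)

lemma sv_nz: "z \<in> S \<Longrightarrow> s z * v z \<noteq> 0"
  using v_nz s_nz S(2) by auto

lemma G_derivative:
  "z \<in> S \<Longrightarrow> norm lam \<le> 1 \<Longrightarrow> ((\<lambda>z. G z lam) has_derivative (\<lambda>h. dG z h lam)) (at z)"
  unfolding G_def dG_def
  by (rule bounded_linear.has_derivative[OF bounded_linear_plus_mat
        smooth_on_has_derivative[OF V_smooth]])

lemma sv_derivative:
  assumes z: "z \<in> S"
  shows "((\<lambda>z. s z * v z) has_derivative (\<lambda>h. s z * v z * r z h)) (at z)"
proof -
  have zD: "z \<in> D" using z S by blast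
  have ds: "(s has_derivative (\<lambda>h. deriv s z * h)) (at z)"
    using holomorphic_derivI[OF s_hol D zD] by (simp add: has_field_derivative_def)
  have dv: "(v has_derivative (\<lambda>h. dG z h 0 $ 1 $ 1)) (at z)"
    unfolding v_def[abs_def]
    by (rule bounded_linear.has_derivative[OF bounded_linear_mat2_nth G_derivative[OF z]]) simp
  show ?thesis
    by (rule has_derivative_eq_rhs[OF has_derivative_mult[OF ds dv]])
      (use s_nz[OF zD] v_nz[OF z] in \<open>simp add: r_def fun_eq_iff field_simps\<close>)
qed

lemma c_derivative:
  "z \<in> S \<Longrightarrow> (c has_derivative (\<lambda>h. c z * (\<i> * of_real (Im (r z h))))) (at z)"
  unfolding c_def[abs_def] by (rule modulus_phase_derivative(2)[OF sv_derivative sv_nz])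

lemma u_derivative:
  assumes "z \<in> S" shows "(u has_derivative (\<lambda>h. 4 * Re (r z h))) (at z)"
proof -
  have nz: "cmod (s z * v z) \<noteq> 0" using sv_nz[OF assms] by simp
  then have "((\<lambda>z. 2 * ln (2 * (cmod (s z * v z))\<^sup>2)) has_derivative
      (\<lambda>h. 2 * (2 * (2 * (cmod (s z * v z) * (cmod (s z * v z) * Re (r z h)))) *
        inverse (2 * (cmod (s z * v z))\<^sup>2)))) (at z)"
    by (auto intro!: derivative_eq_intros modulus_phase_derivative(1)[OF sv_derivative[OF assms] sv_nz[OF assms]]
        simp: fun_eq_iff power2_eq_square field_simps simp del: norm_mult)
  then show ?thesis
    unfolding u_def[abs_def]
    by (rule has_derivative_eq_rhs) (use nz in \<open>simp add: fun_eq_iff power2_eq_square field_simps\<close>)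
qed

lemma exp_u: "z \<in> S \<Longrightarrow> exp (u z / 2) = 2 * (cmod (s z * v z))\<^sup>2"
  using sv_nz[of z] by (simp add: u_def)

lemma sv_smooth: "smooth_on S (\<lambda>z. s z * v z)"
proof -
  have "bounded_linear (\<lambda>a. plus_eval a 0)"
    by (rule bounded_linear_plus_eval) simp
  from bounded_linear_compose[OF this bounded_linear_loop_nth[of 1 1]]
  have "smooth_on S (\<lambda>z. plus_eval (V z $ 1 $ 1) 0)"
    by (rule smooth_on_bounded_linear[OF S(1) _ V_smooth])
  then have "smooth_on S v"
    by (simp only: v_def[abs_def] G_def plus_mat_nth)
  then show ?thesis
    by (rule smooth_on_bounded_bilinear[OF S(1) bounded_bilinear_mult
          smooth_on_holomorphic[OF S(1) holomorphic_on_subset[OF s_hol S(2)]]])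
qed

lemma u_smooth: "smooth_on S u"
proof -
  have m: "smooth_on S (\<lambda>z. cmod (s z * v z))"
    by (rule smooth_on_cmod[OF S(1) sv_smooth sv_nz])
  have "smooth_on S (\<lambda>z. 2 *\<^sub>R ln (2 *\<^sub>R (cmod (s z * v z) * cmod (s z * v z))))"
    by (intro smooth_on_bounded_linear[OF S(1) bounded_linear_scaleR_right] smooth_on_ln[OF S(1)]
        smooth_on_bounded_bilinear[OF S(1) bounded_bilinear_mult] m)
      (use sv_nz in simp)
  then show ?thesis
    by (simp add: u_def[abs_def] power2_eq_square)
qed

lemma c_smooth: "smooth_on S c"
proof -
  have m: "smooth_on S (\<lambda>z. cmod (s z * v z))"
    by (rule smooth_on_cmod[OF S(1) sv_smooth sv_nz])
  have "smooth_on S (\<lambda>z. inverse (cmod (s z * v z)) *\<^sub>R (cis (pi / 4) * (s z * v z)))"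
    by (intro smooth_on_bounded_bilinear[OF S(1) bounded_bilinear_scaleR] smooth_on_inverse[OF S(1) m]
        smooth_on_bounded_linear[OF S(1) bounded_linear_mult_right] sv_smooth)
      (use sv_nz in simp)
  then show ?thesis
    unfolding c_def[abs_def] scaleR_conv_of_real of_real_inverse divide_inverse mult.commute[of "inverse _"] .
qed

lemma norm_c: "z \<in> S \<Longrightarrow> norm (c z) = 1"
  using sv_nz[of z] by (simp add: c_def norm_divide norm_mult)

lemma c_cnj: "z \<in> S \<Longrightarrow> c z * cnj (c z) = 1"
  using norm_c[of z] complex_norm_square[of "c z"] by simp

lemma det_phase_gauge: "z \<in> S \<Longrightarrow> det (phase_gauge z) = 1"
  by (simp add: phase_gauge_def det22 c_cnj)

lemma bounded_linear_phase_gauge: "bounded_linear (\<lambda>w. mat22 w 0 0 (cnj w))"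
  unfolding linear_conv_bounded_linear[symmetric]
  by (auto intro!: linearI simp: mat2_eq_iff)

lemma phase_gauge_derivative:
  assumes "z \<in> S"
  shows "(phase_gauge has_derivative (\<lambda>h. phase_gauge z ** mat22 (\<i> * of_real (Im (r z h))) 0 0
    (- \<i> * of_real (Im (r z h))))) (at z)"
  unfolding phase_gauge_def[abs_def]
  by (rule has_derivative_eq_rhs[OF bounded_linear.has_derivative[OF bounded_linear_phase_gauge c_derivative[OF assms]]])
    (simp add: fun_eq_iff mat2_eq_iff mult22_nth)

lemma phase_gauge_smooth: "smooth_on S phase_gauge"
  unfolding phase_gauge_def[abs_def] by (rule smooth_on_bounded_linear[OF S(1) bounded_linear_phase_gauge c_smooth])

text \<open>The Maurer-Cartan form of the gauged frame on the tangent vector \<open>h\<close>. The summands come from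
  \<open>dC = C \<eta>\<close>, from the plus factor and from the gauge.\<close>
definition form :: "complex \<Rightarrow> complex \<Rightarrow> complex \<Rightarrow> mat2" where
  "form z h lam = adjugate (phase_gauge z) ** (G z lam ** cscale h (eta e z lam) ** adjugate (G z lam) +
     G z lam ** adjugate (dG z h lam)) ** phase_gauge z +
     mat22 (\<i> * of_real (Im (r z h))) 0 0 (- \<i> * of_real (Im (r z h)))"

lemma inner_frame_derivative:
  assumes z: "z \<in> S" and lam: "lam \<noteq> 0" "norm lam \<le> 1"
  shows "((\<lambda>z. inner_frame z lam) has_derivative (\<lambda>h. inner_frame z lam ** form z h lam)) (at z)"
proof -
  have zD: "z \<in> D" using z S by blast
  have dC: "((\<lambda>z. C z lam) has_derivative (\<lambda>h. C z lam ** cscale h (eta e z lam))) (at z)"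
  proof (rule has_derivative_mat2I)
    show "((\<lambda>z. C z lam $ i $ j) has_derivative (\<lambda>h. (C z lam ** cscale h (eta e z lam)) $ i $ j)) (at z)"
      for i j
      by (rule has_derivative_eq_rhs[OF C_ode[OF lam(1) zD, unfolded has_field_derivative_def]])
        (simp add: cscale_mult fun_eq_iff mult.commute)
  qed
  have dA: "((\<lambda>z. adjugate (G z lam)) has_derivative (\<lambda>h. adjugate (dG z h lam))) (at z)"
    by (rule bounded_linear.has_derivative[OF bounded_linear_adjugate G_derivative[OF z lam(2)]])
  have GG: "adjugate (G z lam) ** G z lam = mat 1"
    and DD: "phase_gauge z ** adjugate (phase_gauge z) = mat 1"
    using mult_adjugate det_G[OF z lam(2)] det_phase_gauge[OF z] by blast+
  note bounded_bilinear.FDERIV[OF bounded_bilinear_mat2_mult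
      bounded_bilinear.FDERIV[OF bounded_bilinear_mat2_mult dC dA] phase_gauge_derivative[OF z]]
  then show ?thesis
    unfolding inner_frame_def
  proof (rule has_derivative_eq_rhs, intro ext)
    fix h
    define R where "R = mat22 (\<i> * of_real (Im (r z h))) 0 0 (- \<i> * of_real (Im (r z h)))"
    define E where "E = cscale h (eta e z lam)"
    have "C z lam ** adjugate (G z lam) ** phase_gauge z ** form z h lam =
        C z lam ** (adjugate (G z lam) ** ((phase_gauge z ** adjugate (phase_gauge z)) **
          (G z lam ** E ** adjugate (G z lam) + G z lam ** adjugate (dG z h lam)))) ** phase_gauge z +
        C z lam ** adjugate (G z lam) ** (phase_gauge z ** R)"
      by (simp add: form_def R_def E_def matrix_add_ldistrib matrix_mul_assoc)
    also have "\<dots> = C z lam ** ((adjugate (G z lam) ** G z lam) ** E ** adjugate (G z lam) +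
          (adjugate (G z lam) ** G z lam) ** adjugate (dG z h lam)) ** phase_gauge z +
        C z lam ** adjugate (G z lam) ** (phase_gauge z ** R)"
      unfolding DD by (simp add: matrix_add_ldistrib matrix_mul_assoc)
    also have "\<dots> = C z lam ** (E ** adjugate (G z lam) + adjugate (dG z h lam)) ** phase_gauge z +
        C z lam ** adjugate (G z lam) ** (phase_gauge z ** R)"
      unfolding GG by simp
    also have "\<dots> = C z lam ** adjugate (G z lam) ** (phase_gauge z ** R) +
       (C z lam ** adjugate (dG z h lam) + C z lam ** E ** adjugate (G z lam)) ** phase_gauge z"
      by (simp add: matrix_add_ldistrib matrix_mul_assoc add.commute)
    finally show "C z lam ** adjugate (G z lam) ** (phase_gauge z ** mat22 (\<i> * of_real (Im (r z h))) 0 0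
          (- \<i> * of_real (Im (r z h)))) +
       (C z lam ** adjugate (dG z h lam) + C z lam ** cscale h (eta e z lam) ** adjugate (G z lam)) ** phase_gauge z =
       C z lam ** adjugate (G z lam) ** phase_gauge z ** form z h lam"
      unfolding R_def E_def by (rule sym)
  qed
qed

lemma inner_frame_circle:
  assumes z: "z \<in> S" and lam: "norm lam = 1"
  shows "inner_frame z lam = F z lam ** phase_gauge z"
proof -
  have "C z lam ** adjugate (G z lam) = F z lam ** (G z lam ** adjugate (G z lam))"
    using C_eq[OF z lam] loop_eval_eq_plus_mat[OF V_plus[OF z] lam] by (simp add: G_def matrix_mul_assoc)
  then show ?thesis
    using det_G[OF z] lam by (simp add: inner_frame_def mult_adjugate)
qed

lemma det_F: "z \<in> S \<Longrightarrow> norm lam = 1 \<Longrightarrow> det (F z lam) = 1"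
  using F_loop[of z] by (auto simp: LSL_def)

lemma det_inner_frame: "z \<in> S \<Longrightarrow> norm lam = 1 \<Longrightarrow> det (inner_frame z lam) = 1"
  by (simp add: inner_frame_circle det_mul det_F det_phase_gauge)

lemma inner_frame_sigma:
  assumes z: "z \<in> S" and lam: "norm lam = 1"
  shows "inner_frame z (- lam) = sigma (inner_frame z lam)"
proof -
  obtain g where g: "g \<in> LSL" "\<And>lam. lam \<in> sphere 0 1 \<Longrightarrow> F z lam = loop_eval g lam"
    using F_loop[OF z] by blast
  have "F z (- lam) = sigma (F z lam)"
    using g lam by (simp add: LSL_def)
  moreover have "sigma (phase_gauge z) = phase_gauge z"
    by (simp add: sigma_eq phase_gauge_def mat2_eq_iff)
  ultimately show ?thesis
    using lam by (simp add: inner_frame_circle z sigma_mult)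
qed

lemma reflect_inner_frame:
  assumes z: "z \<in> S" and lam: "norm lam = 1"
  shows "reflect (inner_frame z (\<i> * lam)) = cscale eps (inner_frame z lam)"
proof -
  have "lam * cnj lam = 1" using lam complex_norm_square[of lam] by simp
  moreover have "lam \<noteq> 0" using lam by auto
  ultimately have i: "\<i> / cnj lam = \<i> * lam" by (simp add: field_simps)
  have "tau4 (F z) lam = reflect (F z (\<i> * lam))"
    using tau4_eq_reflect[of "F z" lam] det_F[OF z, of "\<i> * lam"] lam by (simp add: i norm_mult)
  then have "reflect (F z (\<i> * lam)) = cscale eps (F z lam)"
    using F_tau4[OF z lam] by simp
  moreover have "reflect (phase_gauge z) = phase_gauge z"
    by (simp add: phase_gauge_def mat2_eq_iff)
  ultimately show ?thesis
    using lam by (simp add: inner_frame_circle z reflect_mult cscale_mult norm_mult)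
qed

lemma form_trace:
  assumes "z \<in> S" "norm lam = 1" shows "form z h lam $ 2 $ 2 = - form z h lam $ 1 $ 1"
proof -
  have "lam \<noteq> 0" using assms(2) by auto
  from trace_of_derivative_of_unimodular[OF S(1) assms(1) _ inner_frame_derivative[OF assms(1) this]]
  show ?thesis using assms(2) det_inner_frame by simp
qed

text \<open>Twisting passes to the Maurer-Cartan form by differentiating it on the circle and cancelling the
  frame.\<close>
lemma form_sigma:
  assumes z: "z \<in> S" and lam: "norm lam = 1"
  shows "form z h (- lam) = sigma (form z h lam)"
proof -
  have nz: "lam \<noteq> 0" "- lam \<noteq> 0" using lam by auto
  have "((\<lambda>z. sigma (inner_frame z lam)) has_derivative
      (\<lambda>h. sigma (inner_frame z lam ** form z h lam))) (at z)"
    by (rule bounded_linear.has_derivative[OF bounded_linear_sigma inner_frame_derivative[OF z nz(1)]])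
      (simp add: lam)
  then have "((\<lambda>z. inner_frame z (- lam)) has_derivative
      (\<lambda>h. sigma (inner_frame z lam ** form z h lam))) (at z)"
    by (rule has_derivative_transform_within_open[OF _ S(1) z]) (simp add: inner_frame_sigma lam)
  moreover have "((\<lambda>z. inner_frame z (- lam)) has_derivative
      (\<lambda>h. inner_frame z (- lam) ** form z h (- lam))) (at z)"
    by (rule inner_frame_derivative[OF z nz(2)]) (simp add: lam)
  ultimately have "(\<lambda>h. sigma (inner_frame z lam ** form z h lam)) =
      (\<lambda>h. inner_frame z (- lam) ** form z h (- lam))"
    by (rule has_derivative_unique)
  from fun_cong[OF this, of h]
  have "inner_frame z (- lam) ** form z h (- lam) = inner_frame z (- lam) ** sigma (form z h lam)"
    by (simp add: sigma_mult inner_frame_sigma z lam)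
  then show ?thesis
    by (rule mat2_left_cancel[rotated]) (simp add: det_inner_frame z lam)
qed

text \<open>The reality condition on the circle is differentiated in \<open>z\<close>; as \<open>reflect\<close> is multiplicative and
  linear, the frame cancels on both sides together with the sign \<open>eps\<close>.\<close>
lemma form_reflect:
  assumes z: "z \<in> S" and lam: "norm lam = 1"
  shows "form z h lam = reflect (form z h (\<i> * lam))"
proof -
  have nz: "lam \<noteq> 0" "\<i> * lam \<noteq> 0" using lam by auto
  have "((\<lambda>z. reflect (inner_frame z (\<i> * lam))) has_derivative
      (\<lambda>h. reflect (inner_frame z (\<i> * lam) ** form z h (\<i> * lam)))) (at z)"
    by (rule bounded_linear.has_derivative[OF bounded_linear_reflect inner_frame_derivative[OF z nz(2)]])
      (simp add: lam norm_mult)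
  then have "((\<lambda>z. cscale eps (inner_frame z lam)) has_derivative
      (\<lambda>h. reflect (inner_frame z (\<i> * lam) ** form z h (\<i> * lam)))) (at z)"
    by (rule has_derivative_transform_within_open[OF _ S(1) z]) (simp add: reflect_inner_frame lam)
  moreover have "((\<lambda>z. cscale eps (inner_frame z lam)) has_derivative
      (\<lambda>h. cscale eps (inner_frame z lam ** form z h lam))) (at z)"
    by (rule bounded_linear.has_derivative[OF bounded_linear_cscale inner_frame_derivative[OF z nz(1)]])
      (simp add: lam)
  ultimately have "(\<lambda>h. reflect (inner_frame z (\<i> * lam) ** form z h (\<i> * lam))) =
      (\<lambda>h. cscale eps (inner_frame z lam ** form z h lam))"
    by (rule has_derivative_unique)
  from fun_cong[OF this, of h]
  have "cscale eps (inner_frame z lam ** form z h lam) =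
      cscale eps (inner_frame z lam ** reflect (form z h (\<i> * lam)))"
    by (simp add: reflect_mult reflect_inner_frame z lam cscale_mult)
  then have "cscale eps (cscale eps (inner_frame z lam ** form z h lam)) =
      cscale eps (cscale eps (inner_frame z lam ** reflect (form z h (\<i> * lam))))"
    by (rule arg_cong)
  moreover have "cscale eps (cscale eps X) = X" for X
    by (simp add: mat2_eq_iff eps mult.assoc[symmetric])
  ultimately have "inner_frame z lam ** form z h lam = inner_frame z lam ** reflect (form z h (\<i> * lam))"
    by (simp only:)
  then show ?thesis
    by (rule mat2_left_cancel[rotated]) (simp add: det_inner_frame z lam)
qed

end

section \<open>Reflection of the frame in the unit circle\<close>

lemma reflection_of_punctured_disc:
  assumes "continuous_on (cball 0 1 - {0}) f" "f holomorphic_on ball 0 1 - {0}"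
  shows "continuous_on {w. 1 \<le> norm w} (\<lambda>w. cnj (f (\<i> / cnj w)))"
    and "(\<lambda>w. cnj (f (\<i> / cnj w))) holomorphic_on {w. 1 < norm w}"
proof -
  show "continuous_on {w. 1 \<le> norm w} (\<lambda>w. cnj (f (\<i> / cnj w)))"
    by (intro continuous_on_cnj continuous_on_compose2[OF assms(1)])
      (auto intro!: continuous_intros simp: norm_divide divide_le_eq)
  have "cnj ` (ball 0 1 - {0}) = ball 0 1 - {0}"
    by (auto simp: in_image_cnj_iff)
  then have 1: "cnj \<circ> f \<circ> cnj holomorphic_on ball 0 1 - {0}"
    using holomorphic_on_compose_cnj_cnj[of f "ball 0 1 - {0}"] assms(2) by (simp add: open_Diff)
  have 2: "(\<lambda>w. - \<i> / w) holomorphic_on {w. 1 < norm w}"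
    by (intro holomorphic_intros) auto
  have 3: "(\<lambda>w. - \<i> / w) ` {w. 1 < norm w} \<subseteq> ball 0 1 - {0}"
    by (auto simp: norm_divide divide_less_eq)
  from holomorphic_on_compose_gen[OF 2 1 3] show "(\<lambda>w. cnj (f (\<i> / cnj w))) holomorphic_on {w. 1 < norm w}"
    by (simp add: comp_def)
qed

text \<open>The form of an extended frame has the reality condition built in, on all of the punctured plane.\<close>
lemma reflect_frame_form:
  assumes "lam \<noteq> 0"
  shows "reflect (frame_form u Q z (\<i> / cnj lam) h) = frame_form u Q z lam h"
  using assms by (simp add: mat2_eq_iff frame_form_nth field_simps)

context iwasawa_frame
begin

text \<open>The Maurer-Cartan form with its pole at \<open>0\<close> removed.\<close>
definition lambda_form :: "complex \<Rightarrow> complex \<Rightarrow> complex \<Rightarrow> mat2" where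
  "lambda_form z h lam = adjugate (phase_gauge z) ** (G z lam ** cscale h (lambda_eta e z lam) ** adjugate (G z lam) +
     cscale lam (G z lam ** adjugate (dG z h lam))) ** phase_gauge z +
     cscale lam (mat22 (\<i> * of_real (Im (r z h))) 0 0 (- \<i> * of_real (Im (r z h))))"

lemma lambda_form_eq: "lam \<noteq> 0 \<Longrightarrow> lambda_form z h lam = cscale lam (form z h lam)"
proof -
  assume "lam \<noteq> 0"
  then have "lambda_eta e z lam = cscale lam (eta e z lam)"
    by (simp add: eta_def mat2_eq_iff)
  moreover have "cscale h (cscale lam X) = cscale lam (cscale h X)" for X
    by (simp add: mat2_eq_iff)
  moreover have "cscale lam X + cscale lam Y = cscale lam (X + Y)" for X Y
    by (simp add: mat2_eq_iff distrib_left)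
  ultimately show ?thesis
    by (simp add: lambda_form_def form_def cscale_mult)
qed

lemma disc_matrix_lambda_eta: "z \<in> D \<Longrightarrow> disc_matrix (lambda_eta e z)"
proof -
  assume "z \<in> D"
  note h = lambda_eta_entire[OF potential this]
  show ?thesis
    unfolding disc_matrix_def
    using holomorphic_on_subset[OF h] continuous_on_subset[OF holomorphic_on_imp_continuous_on[OF h]]
    by blast
qed

lemma disc_matrix_G: "disc_matrix (G z)" "disc_matrix (dG z h)"
  by (simp_all add: G_def dG_def disc_matrix_plus_mat)

lemma disc_matrix_lambda_form: "z \<in> D \<Longrightarrow> disc_matrix (lambda_form z h)"
  unfolding lambda_form_def[abs_def]
  by (intro disc_matrix_add disc_matrix_mult disc_matrix_const disc_matrix_adjugate disc_matrix_cscale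
      disc_matrix_lambda_eta disc_matrix_G holomorphic_intros) auto

lemma exp_minus_u: "exp (- u z / 2) = inverse (exp (u z / 2))"
  by (simp add: exp_minus[symmetric])

text \<open>The constant term is the leading coefficient of the potential, conjugated by the diagonal matrix
  of the plus factor at \<open>0\<close> and by the gauge. The choices of \<open>c\<close> and \<open>u\<close> bring the upper right entry
  into the form required of an extended frame. Conjugation by diagonal matrices preserves the
  product of the two off-diagonal entries, so \<open>Q\<close> is a multiple of that product for the potential
  and is holomorphic.\<close>
lemma lambda_form_0:
  assumes z: "z \<in> S"
  shows "lambda_form z h 0 $ 1 $ 1 = 0" "lambda_form z h 0 $ 2 $ 2 = 0"
    and "lambda_form z h 0 $ 1 $ 2 = - (\<i> / 2) * of_real (exp (u z / 2)) * h"
    and "lambda_form z h 0 $ 2 $ 1 = - \<i> * Q z * of_real (exp (- u z / 2)) * h"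
proof -
  have zD: "z \<in> D" using z S by blast
  define E where "E = e (- 1) z"
  have E: "E $ 1 $ 1 = 0" "E $ 2 $ 2 = 0"
    using potential[unfolded holomorphic_potential_def, THEN conjunct1, THEN spec, of "- 1",
        THEN mp, OF order_refl, THEN conjunct2] zD
    by (simp_all add: E_def)
  define t where "t = G z 0 $ 2 $ 2"
  define g where "g = s z * v z"
  define m where "m = complex_of_real (cmod g)"
  have vt: "v z * t = 1" using v_mult[OF z] by (simp add: t_def)
  have gm: "m \<noteq> 0" "g * cnj g = m * m"
    using sv_nz[OF z] complex_norm_square[of g] by (simp_all add: g_def m_def power2_eq_square)
  have k: "cis (pi / 4) * cis (pi / 4) = \<i>"
    by (simp add: cis_mult)
  then have k': "cnj (cis (pi / 4)) * cnj (cis (pi / 4)) = - \<i>"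
    by (metis complex_cnj_i complex_cnj_mult)
  have cc: "c z * c z = \<i> * g * g / (m * m)"
  proof -
    have "c z * c z = (cis (pi / 4) * cis (pi / 4)) * (g * g) / (m * m)"
      by (simp add: c_def g_def m_def)
    then show ?thesis by (simp only: k mult.assoc)
  qed
  have cc': "cnj (c z) * cnj (c z) = - \<i> * cnj g * cnj g / (m * m)"
  proof -
    have "cnj (c z) * cnj (c z) = cnj (c z * c z)" by simp
    also have "\<dots> = - \<i> * cnj g * cnj g / (m * m)"
      unfolding cc by (simp add: m_def)
    finally show ?thesis .
  qed
  have ex: "complex_of_real (exp (u z / 2)) = 2 * (m * m)"
    by (simp add: exp_u[OF z] m_def g_def power2_eq_square)
  have G0: "G z 0 = mat22 (v z) 0 0 t"
    by (simp add: mat2_eq_iff v_def t_def G_0 z)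
  have L: "lambda_form z h 0 = adjugate (phase_gauge z) ** (G z 0 ** cscale h E ** adjugate (G z 0)) ** phase_gauge z"
    by (simp add: lambda_form_def lambda_eta_0 E_def mat2_eq_iff mult22_nth)
  show "lambda_form z h 0 $ 1 $ 1 = 0" "lambda_form z h 0 $ 2 $ 2 = 0"
    by (simp_all add: L G0 phase_gauge_def mult22_nth E)
  have "lambda_form z h 0 $ 1 $ 2 = (cnj (c z) * cnj (c z)) * ((s z)\<^sup>2 * v z * v z) * h"
    using s_sq[OF zD] by (simp add: L G0 phase_gauge_def mult22_nth E E_def[symmetric])
  also have "(s z)\<^sup>2 * v z * v z = g * g" by (simp add: g_def power2_eq_square)
  also have "cnj (c z) * cnj (c z) * (g * g) = - \<i> * ((g * cnj g) * (g * cnj g)) / (m * m)"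
    by (simp add: cc' )
  also have "\<dots> = - \<i> * (m * m)"
    unfolding gm(2) using gm(1) by simp
  finally show "lambda_form z h 0 $ 1 $ 2 = - (\<i> / 2) * of_real (exp (u z / 2)) * h"
    by (simp add: ex)
  have "lambda_form z h 0 $ 2 $ 1 = (c z * c z) * (t * t * E $ 2 $ 1) * h"
    by (simp add: L G0 phase_gauge_def mult22_nth E)
  also have "\<dots> = \<i> * (v z * t) * (v z * t) * (s z)\<^sup>2 * E $ 2 $ 1 / (m * m) * h"
    by (simp add: cc g_def power2_eq_square)
  also have "\<dots> = \<i> * (s z)\<^sup>2 * E $ 2 $ 1 / (m * m) * h"
    unfolding vt by simp
  also have "\<dots> = - \<i> * Q z * inverse (2 * (m * m)) * h"
    using gm(1) by (simp add: Q_def s_sq[OF zD, symmetric] E_def field_simps)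
  finally show "lambda_form z h 0 $ 2 $ 1 = - \<i> * Q z * of_real (exp (- u z / 2)) * h"
    by (simp only: exp_minus_u of_real_inverse ex)
qed

lemma lambda_form_laurent:
  assumes z: "z \<in> S" and w: "norm w \<le> 1"
  shows "lambda_form z h w $ 1 $ 1 = deriv (\<lambda>w. lambda_form z h w $ 1 $ 1) 0 * w"
    and "lambda_form z h w $ 1 $ 2 = lambda_form z h 0 $ 1 $ 2 +
      deriv (\<lambda>w. lambda_form z h w $ 1 $ 2) 0 * w - cnj (lambda_form z h 0 $ 2 $ 1) * w\<^sup>2"
    and "lambda_form z h w $ 2 $ 1 = lambda_form z h 0 $ 2 $ 1 +
      deriv (\<lambda>w. lambda_form z h w $ 2 $ 1) 0 * w + cnj (lambda_form z h 0 $ 1 $ 2) * w\<^sup>2"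
    and "lambda_form z h w $ 2 $ 2 = deriv (\<lambda>w. lambda_form z h w $ 2 $ 2) 0 * w"
proof -
  have zD: "z \<in> D" using z S by blast
  note disc = disc_matrixD[OF disc_matrix_lambda_form[OF zD, of h]]
  have q: "lambda_form z h w $ i $ j / w = form z h w $ i $ j" if "norm w = 1" for w i j
  proof -
    have "w \<noteq> 0" using that by auto
    then show ?thesis by (simp add: lambda_form_eq)
  qed
  have refl: "lambda_form z h w $ i $ j / w =
      k * cnj (lambda_form z h (\<i> * w) $ i' $ j' / (\<i> * w))"
    if "norm w = 1" "\<And>X. reflect X $ i $ j = k * cnj (X $ i' $ j')" for w i j i' j' k
    using that form_reflect[OF z that(1), of h] q[of w i j] q[of "\<i> * w" i' j'] by (simp add: norm_mult)
  note laurent = laurent_polynomial_of_reflection[OF disc disc refl w]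
  show "lambda_form z h w $ 1 $ 1 = deriv (\<lambda>w. lambda_form z h w $ 1 $ 1) 0 * w"
    using laurent[of 1 1 1 2 2] by (simp add: lambda_form_0 z)
  show "lambda_form z h w $ 2 $ 2 = deriv (\<lambda>w. lambda_form z h w $ 2 $ 2) 0 * w"
    using laurent[of 2 2 1 1 1] by (simp add: lambda_form_0 z)
  show "lambda_form z h w $ 1 $ 2 = lambda_form z h 0 $ 1 $ 2 +
      deriv (\<lambda>w. lambda_form z h w $ 1 $ 2) 0 * w - cnj (lambda_form z h 0 $ 2 $ 1) * w\<^sup>2"
    using laurent[of 1 2 \<i> 2 1] by simp
  show "lambda_form z h w $ 2 $ 1 = lambda_form z h 0 $ 2 $ 1 +
      deriv (\<lambda>w. lambda_form z h w $ 2 $ 1) 0 * w + cnj (lambda_form z h 0 $ 1 $ 2) * w\<^sup>2"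
    using laurent[of 2 1 "- \<i>" 1 2] by simp
qed

text \<open>The off-diagonal entries of the Maurer-Cartan form are odd in the spectral parameter.\<close>
lemma lambda_form_offdiag_linear_term:
  assumes z: "z \<in> S"
  shows "deriv (\<lambda>w. lambda_form z h w $ 1 $ 2) 0 = 0" "deriv (\<lambda>w. lambda_form z h w $ 2 $ 1) 0 = 0"
proof -
  have "lambda_form z h (- 1) = - sigma (lambda_form z h 1)"
    using form_sigma[OF z, of 1 h] by (simp add: lambda_form_eq mat2_eq_iff sigma_eq)
  then have e: "lambda_form z h (- 1) $ 1 $ 2 = lambda_form z h 1 $ 1 $ 2"
    "lambda_form z h (- 1) $ 2 $ 1 = lambda_form z h 1 $ 2 $ 1"
    by (simp_all add: sigma_eq)
  show "deriv (\<lambda>w. lambda_form z h w $ 1 $ 2) 0 = 0"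
    using e(1) lambda_form_laurent(2)[OF z, of 1 h] lambda_form_laurent(2)[OF z, of "- 1" h]
    by (simp add: eq_neg_iff_add_eq_0)
  show "deriv (\<lambda>w. lambda_form z h w $ 2 $ 1) 0 = 0"
    using e(2) lambda_form_laurent(3)[OF z, of 1 h] lambda_form_laurent(3)[OF z, of "- 1" h]
    by (simp add: eq_neg_iff_add_eq_0)
qed

text \<open>The term of order \<open>0\<close> of the Maurer-Cartan form is a complex linear function of \<open>h\<close>, plus the
  logarithmic derivative of \<open>1 / v\<close> and of the gauge. By reality it is imaginary. Taking real
  parts determines the complex linear function: its coefficient \<open>deriv N 0\<close>, increased by the
  logarithmic derivative of \<open>s\<close>, is half of the derivative of \<open>u\<close> with respect to \<open>z\<close>.\<close>
lemma lambda_form_diag_linear_term: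
  assumes z: "z \<in> S"
  shows "deriv (\<lambda>w. lambda_form z h w $ 1 $ 1) 0 = h * dz_real u z / 4 - cnj h * cnj (dz_real u z) / 4"
proof -
  have zD: "z \<in> D" using z S by blast
  define \<beta> where "\<beta> = (\<lambda>h. deriv (\<lambda>w. lambda_form z h w $ 1 $ 1) 0)"
  define N where "N = (\<lambda>w. (G z w ** lambda_eta e z w ** adjugate (G z w)) $ 1 $ 1)"
  define Y where "Y = (\<lambda>h w. (G z w ** adjugate (dG z h w)) $ 1 $ 1)"
  have L: "lambda_form z h w $ 1 $ 1 = h * N w + w * (Y h w + \<i> * of_real (Im (r z h)))" for h w
  proof -
    have "lambda_form z h w $ 1 $ 1 = (c z * cnj (c z)) * (h * N w + w * Y h w) + w * (\<i> * of_real (Im (r z h)))"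
      unfolding lambda_form_def N_def Y_def
      by (simp add: phase_gauge_def mult22_nth algebra_simps)
    then show ?thesis by (simp add: c_cnj z algebra_simps)
  qed
  have N: "(N has_field_derivative deriv N 0) (at 0)"
  proof -
    have "N holomorphic_on ball 0 1"
      unfolding N_def by (intro disc_matrixD(2) disc_matrix_mult disc_matrix_adjugate disc_matrix_G
          disc_matrix_lambda_eta zD)
    then show ?thesis by (rule holomorphic_derivI) auto
  qed
  have "(Y h has_field_derivative deriv (Y h) 0) (at 0)" for h
  proof -
    have "Y h holomorphic_on ball 0 1"
      unfolding Y_def by (intro disc_matrixD(2) disc_matrix_mult disc_matrix_adjugate disc_matrix_G)
    then show ?thesis by (rule holomorphic_derivI) auto
  qed
  then have "((\<lambda>w. h * N w + w * (Y h w + \<i> * of_real (Im (r z h)))) has_field_derivative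
      (h * deriv N 0 + (Y h 0 + \<i> * of_real (Im (r z h))))) (at 0)" for h
    by (auto intro!: derivative_eq_intros N)
  note dL = this
  have \<beta>1: "\<beta> h = h * deriv N 0 + Y h 0 + \<i> * of_real (Im (r z h))" for h
    unfolding \<beta>_def L DERIV_imp_deriv[OF dL] by (simp add: add.assoc)
  have Y0: "Y h 0 = - dG z h 0 $ 1 $ 1 / v z" for h
  proof -
    have d: "((\<lambda>z. G z 0 $ i $ j) has_derivative (\<lambda>h. dG z h 0 $ i $ j)) (at z)" for i j
      by (rule bounded_linear.has_derivative[OF bounded_linear_mat2_nth G_derivative[OF z]]) simp
    have "((\<lambda>z. v z * G z 0 $ 2 $ 2) has_derivative
        (\<lambda>h. v z * dG z h 0 $ 2 $ 2 + dG z h 0 $ 1 $ 1 * G z 0 $ 2 $ 2)) (at z)"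
      unfolding v_def by (rule has_derivative_mult[OF d d])
    moreover have "((\<lambda>z. v z * G z 0 $ 2 $ 2) has_derivative (\<lambda>h. 0)) (at z)"
      by (rule has_derivative_transform_within_open[OF has_derivative_const S(1) z]) (simp add: v_mult)
    ultimately have "(\<lambda>h. v z * dG z h 0 $ 2 $ 2 + dG z h 0 $ 1 $ 1 * G z 0 $ 2 $ 2) = (\<lambda>h. 0)"
      by (rule has_derivative_unique)
    from fun_cong[OF this, of h]
    have "v z * dG z h 0 $ 2 $ 2 = - dG z h 0 $ 1 $ 1 * G z 0 $ 2 $ 2"
      by (simp add: add_eq_0_iff2)
    moreover have "G z 0 $ 2 $ 2 = 1 / v z"
      using v_mult[OF z] v_nz[OF z] by (simp add: field_simps)
    ultimately show ?thesis
      by (simp add: Y_def mult22_nth G_0 z v_def[symmetric])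
  qed
  \<comment> \<open>On the circle the reality condition makes the diagonal of the form imaginary.\<close>
  have im: "Re (\<beta> h) = 0" for h
  proof -
    have f: "form z h w $ 1 $ 1 = \<beta> h" if "norm w = 1" for w
    proof -
      have "w \<noteq> 0" using that by auto
      then show ?thesis
        using lambda_form_laurent(1)[OF z, of w h] that by (simp add: \<beta>_def lambda_form_eq)
    qed
    have "\<beta> h = cnj (form z h \<i> $ 2 $ 2)"
      using form_reflect[OF z, of 1 h] f[of 1] by simp
    also have "\<dots> = - cnj (\<beta> h)"
      using form_trace[OF z, of \<i> h] f[of \<i>] by simp
    finally have "Re (\<beta> h) = - Re (\<beta> h)"
      by (metis complex_cnj(1) uminus_complex.sel(1) cnj.sel(1))
    then show ?thesis by simp
  qed
  define T where "T = deriv N 0 + deriv s z / s z"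
  have re: "Re (r z h) = Re (h * T)" for h
  proof -
    have "Re (h * deriv N 0) = Re (dG z h 0 $ 1 $ 1 / v z)"
      using im[of h] unfolding \<beta>1 Y0 by simp
    then show ?thesis
      by (simp add: r_def T_def distrib_left mult.commute)
  qed
  have du: "(u has_derivative (\<lambda>h. 4 * Re (h * T))) (at z)"
    using u_derivative[OF z] unfolding re .
  have dzu: "dz_real u z = 2 * T"
    by (simp add: dz_real_def dx_eq[OF du] dy_eq[OF du] complex_eq_iff)
  have "\<beta> h = \<i> * of_real (Im (h * T))"
  proof -
    have "Im (\<beta> h) = Im (h * T)"
      unfolding \<beta>1 Y0 by (simp add: r_def T_def distrib_left mult.commute)
    then show ?thesis using im[of h] by (simp add: complex_eq_iff)
  qed
  also have "\<dots> = h * dz_real u z / 4 - cnj h * cnj (dz_real u z) / 4"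
    unfolding dzu by (simp add: complex_eq_iff field_simps)
  finally show ?thesis by (simp add: \<beta>_def)
qed

lemma form_eq_frame_form:
  assumes z: "z \<in> S" and w: "w \<noteq> 0" "norm w \<le> 1"
  shows "form z h w = frame_form u Q z w h"
proof -
  have f: "form z h w $ i $ j = lambda_form z h w $ i $ j / w" for i j
    using w(1) by (simp add: lambda_form_eq)
  have "form z h 1 $ 2 $ 2 = - form z h 1 $ 1 $ 1"
    by (rule form_trace[OF z]) simp
  then have d22: "deriv (\<lambda>w. lambda_form z h w $ 2 $ 2) 0 = - deriv (\<lambda>w. lambda_form z h w $ 1 $ 1) 0"
    using lambda_form_laurent(1,4)[OF z, of 1 h] by (simp add: lambda_form_eq)
  show ?thesis
    unfolding mat2_eq_iff f frame_form_nth lambda_form_laurent[OF z w(2)] d22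
      lambda_form_offdiag_linear_term[OF z] lambda_form_diag_linear_term[OF z] lambda_form_0[OF z]
    using w(1) by (simp add: field_simps power2_eq_square)
qed

text \<open>Outside the closed disc the frame is defined by the reality condition.\<close>
definition extended :: "complex \<Rightarrow> complex \<Rightarrow> mat2" where
  "extended z lam = (if norm lam \<le> 1 then inner_frame z lam
     else cscale eps (reflect (inner_frame z (\<i> / cnj lam))))"

lemma extended_derivative:
  assumes z: "z \<in> S" and lam: "lam \<noteq> 0"
  shows "((\<lambda>z. extended z lam) has_derivative (\<lambda>h. extended z lam ** frame_form u Q z lam h)) (at z)"
proof (cases "norm lam \<le> 1")
  case True
  then show ?thesis
    using inner_frame_derivative[OF z lam True] by (simp add: extended_def form_eq_frame_form z lam)
next
  case False
  define mu where "mu = \<i> / cnj lam"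
  have mu: "mu \<noteq> 0" "norm mu \<le> 1"
    using False lam by (auto simp: mu_def norm_divide divide_le_eq)
  have "((\<lambda>z. cscale eps (reflect (inner_frame z mu))) has_derivative
      (\<lambda>h. cscale eps (reflect (inner_frame z mu ** form z h mu)))) (at z)"
    by (rule bounded_linear.has_derivative[OF bounded_linear_cscale
          bounded_linear.has_derivative[OF bounded_linear_reflect inner_frame_derivative[OF z mu]]])
  moreover have "reflect (form z h mu) = frame_form u Q z lam h" for h
    using reflect_frame_form[OF lam] by (simp add: form_eq_frame_form[OF z mu]) (simp add: mu_def)
  ultimately show ?thesis
    using False by (simp add: extended_def reflect_mult cscale_mult mu_def[symmetric])
qed

text \<open>The two definitions agree on the circle, again by the reality condition, so they paste to a
  function that is holomorphic on the punctured plane.\<close>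
lemma extended_holomorphic:
  assumes z: "z \<in> S"
  shows "(\<lambda>lam. extended z lam $ i $ j) holomorphic_on - {0}"
proof -
  have zD: "z \<in> D" using z S by blast
  have A: "continuous_on (cball 0 1 - {0}) (\<lambda>w. inner_frame z w $ i $ j)"
    "(\<lambda>w. inner_frame z w $ i $ j) holomorphic_on ball 0 1 - {0}" for i j
  proof -
    have M: "disc_matrix (\<lambda>w. adjugate (G z w) ** phase_gauge z)"
      by (intro disc_matrix_mult disc_matrix_adjugate disc_matrix_G disc_matrix_const)
    have eq: "inner_frame z w $ i $ j = C z w $ i $ 1 * (adjugate (G z w) ** phase_gauge z) $ 1 $ j +
        C z w $ i $ 2 * (adjugate (G z w) ** phase_gauge z) $ 2 $ j" for w
      unfolding inner_frame_def matrix_mul_assoc[symmetric] by (rule mult22_nth)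
    have hC: "(\<lambda>w. C z w $ i $ k) holomorphic_on ball 0 1 - {0}"
      "continuous_on (cball 0 1 - {0}) (\<lambda>w. C z w $ i $ k)" for k
      using holomorphic_on_subset[OF C_hol[OF zD]]
        continuous_on_subset[OF holomorphic_on_imp_continuous_on[OF C_hol[OF zD]]] by blast+
    have hM: "(\<lambda>w. (adjugate (G z w) ** phase_gauge z) $ k $ j) holomorphic_on ball 0 1 - {0}"
      "continuous_on (cball 0 1 - {0}) (\<lambda>w. (adjugate (G z w) ** phase_gauge z) $ k $ j)" for k
      using holomorphic_on_subset[OF disc_matrixD(2)[OF M]] continuous_on_subset[OF disc_matrixD(1)[OF M]]
      by blast+
    show "continuous_on (cball 0 1 - {0}) (\<lambda>w. inner_frame z w $ i $ j)"
      unfolding eq by (intro continuous_on_add continuous_on_mult hC hM)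
    show "(\<lambda>w. inner_frame z w $ i $ j) holomorphic_on ball 0 1 - {0}"
      unfolding eq by (intro holomorphic_on_add holomorphic_on_mult hC hM)
  qed
  have circle: "inner_frame z w = cscale eps (reflect (inner_frame z (\<i> / cnj w)))" if "norm w = 1" for w
  proof -
    have "w * cnj w = 1" using that complex_norm_square[of w] by simp
    moreover have "w \<noteq> 0" using that by auto
    ultimately have i: "\<i> / cnj w = \<i> * w" by (simp add: field_simps)
    show ?thesis
      unfolding i reflect_inner_frame[OF z that]
      by (simp add: mat2_eq_iff eps mult.assoc[symmetric])
  qed
  obtain k i' j' where k: "\<And>X. reflect X $ i $ j = k * cnj (X $ i' $ j')"
  proof -
    have "\<exists>k i' j'. \<forall>X. reflect X $ i $ j = k * cnj (X $ i' $ j')"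
      using exhaust_2[of i] exhaust_2[of j]
      by (elim disjE; simp; metis mult_1_left mult_minus_left)
    then show ?thesis using that by blast
  qed
  have "(\<lambda>w. if norm w \<le> 1 then inner_frame z w $ i $ j
      else eps * (k * cnj (inner_frame z (\<i> / cnj w) $ i' $ j'))) holomorphic_on - {0}"
  proof (rule holomorphic_on_paste_across_circle[OF A])
    show "continuous_on {w. 1 \<le> norm w} (\<lambda>w. eps * (k * cnj (inner_frame z (\<i> / cnj w) $ i' $ j')))"
      "(\<lambda>w. eps * (k * cnj (inner_frame z (\<i> / cnj w) $ i' $ j'))) holomorphic_on {w. 1 < norm w}"
      by (intro continuous_on_mult holomorphic_on_mult continuous_on_const holomorphic_on_const
          reflection_of_punctured_disc A)+
    show "inner_frame z w $ i $ j = eps * (k * cnj (inner_frame z (\<i> / cnj w) $ i' $ j'))"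
      if "norm w = 1" for w
      using arg_cong[OF circle[OF that], of "\<lambda>X. X $ i $ j"] by (simp add: k)
  qed
  moreover have "(\<lambda>lam. extended z lam $ i $ j) = (\<lambda>w. if norm w \<le> 1 then inner_frame z w $ i $ j
      else eps * (k * cnj (inner_frame z (\<i> / cnj w) $ i' $ j')))"
    by (simp add: extended_def fun_eq_iff k)
  ultimately show ?thesis by simp
qed

lemma extended_circle: "z \<in> S \<Longrightarrow> norm lam = 1 \<Longrightarrow> extended z lam = F z lam ** phase_gauge z"
  by (simp add: extended_def inner_frame_circle)

lemma extended_loop:
  assumes z: "z \<in> S"
  shows "\<exists>g\<in>LSL. \<forall>lam\<in>sphere 0 1. extended z lam = loop_eval g lam"
proof -
  obtain g where g: "\<And>lam. norm lam = 1 \<Longrightarrow> F z lam = loop_eval g lam"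
    using F_loop[OF z] by auto
  obtain h where "\<And>lam. norm lam = 1 \<Longrightarrow> loop_eval h lam = loop_eval g lam ** mat22 (c z) 0 0 (cnj (c z))"
    using loop_mult_diag by blast
  then have h: "extended z lam = loop_eval h lam" if "norm lam = 1" for lam
    using that g by (simp add: extended_circle z phase_gauge_def)
  have "h \<in> LSL"
    unfolding LSL_def
  proof (intro CollectI ballI conjI)
    fix lam :: complex assume "lam \<in> sphere 0 1"
    then have lam: "norm lam = 1" by simp
    have e: "extended z mu = inner_frame z mu" if "norm mu = 1" for mu
      using that by (simp add: extended_def)
    show "det (loop_eval h lam) = 1"
      using det_inner_frame[OF z lam] h[OF lam] e[OF lam] by simp
    show "loop_eval h (- lam) = sigma (loop_eval h lam)"
      using inner_frame_sigma[OF z lam] h[of lam] h[of "- lam"] e[of lam] e[of "- lam"] lam by simp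
  qed
  then show ?thesis using h by auto
qed

text \<open>The angle \<open>\<theta>\<close> is a branch of the argument of \<open>c\<close>; it may jump, but \<open>cis \<theta> = c\<close> is smooth. The
  coordinate is unchanged.\<close>
lemma cmc_frame: "cmc_frame_up_to_gauge 0 S F"
proof -
  define \<theta> where "\<theta> = (\<lambda>z. Arg (c z))"
  have cis: "cis (\<theta> z) = c z" "cis (- \<theta> z) = cnj (c z)" if "z \<in> S" for z
  proof -
    show c: "cis (\<theta> z) = c z"
      using norm_c[OF that] cis_Arg_unique[of "c z"] rcis_cmod_Arg[of "c z"] by (simp add: \<theta>_def rcis_def)
    then show "cis (- \<theta> z) = cnj (c z)" by (metis cis_cnj)
  qed
  have hol: "Q holomorphic_on S"
  proof -
    have "(\<lambda>z. e (- 1) z $ i $ j) holomorphic_on S" for i j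
      using potential[unfolded holomorphic_potential_def, THEN conjunct1, THEN spec, of "- 1",
          THEN mp, OF order_refl, THEN conjunct1] holomorphic_on_subset[OF _ S(2)] by simp
    then show ?thesis unfolding Q_def[abs_def] by (intro holomorphic_intros)
  qed
  have smooth: "smooth_on S (\<lambda>z. extended z lam)" if "norm lam = 1" for lam
    by (rule smooth_on_cong[OF S(1) _ smooth_on_bounded_bilinear[OF S(1) bounded_bilinear_mat2_mult
            F_smooth[OF that] phase_gauge_smooth]])
      (simp add: extended_circle that)
  have frame: "extended_frame 0 S u Q extended"
    unfolding extended_frame_def frame_form_def[symmetric]
    by (intro conjI ballI allI impI order_refl S(1) u_smooth hol extended_loop extended_holomorphic
        extended_derivative)
  have sym: "sym_formula 0 extended lam = (\<lambda>z. conj_act (extended z lam) (mat 1))" for lam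
  proof -
    have "mat22 1 0 0 1 = mat 1" by (simp add: mat2_eq_iff)
    then show ?thesis by (simp add: fun_eq_iff sym_formula_def conj_act_def)
  qed
  have surface: "H3_immersion S (sym_formula 0 extended lam) \<and>
      conformal_metric S (sym_formula 0 extended lam) u \<and>
      (\<exists>N. unit_normal S (sym_formula 0 extended lam) N \<and>
        (\<forall>z\<in>S. mean_curvature (sym_formula 0 extended lam) N z = 0 \<and>
          (lam = 1 \<longrightarrow> hopf (sym_formula 0 extended lam) N z = Q z)))"
    if lam: "norm lam = 1" for lam
  proof -
    have nz: "lam \<noteq> 0" using lam by auto
    have det: "det (extended z lam) = 1" if "z \<in> S" for z
      using det_inner_frame[OF that lam] lam by (simp add: extended_def)
    note * = minimal_surface_of_frame[OF S(1) u_smooth smooth[OF lam] det lam extended_derivative[OF _ nz],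
        folded sym]
    show ?thesis
      using * by (intro conjI exI[of _ "\<lambda>z. conj_act (extended z lam) (mat22 1 0 0 (- 1))"]) auto
  qed
  have "extended_frame_of_cmc_surface 0 S extended"
    unfolding extended_frame_of_cmc_surface_def
    by (rule exI[of _ 0], rule exI[of _ u], rule exI[of _ Q]) (use frame surface in simp)
  moreover have "smooth_on S (\<lambda>z. cis (\<theta> z))"
    by (rule smooth_on_cong[OF S(1) _ c_smooth]) (simp add: cis)
  ultimately show ?thesis
    unfolding cmc_frame_up_to_gauge_def
    by (intro exI[of _ \<theta>] exI[of _ "\<lambda>z. z"] exI[of _ extended])
      (simp add: extended_circle cis phase_gauge_def)
qed

end

section \<open>The two open cells\<close>

lemma LSL_I:
  assumes "\<And>lam. norm lam = 1 \<Longrightarrow> det (loop_eval g lam) = 1"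
    and "\<And>lam. norm lam = 1 \<Longrightarrow> loop_eval g (- lam) = sigma (loop_eval g lam)"
  shows "g \<in> LSL"
  using assms by (simp add: LSL_def)

lemma LSL_D:
  assumes "g \<in> LSL" "norm lam = 1"
  shows "det (loop_eval g lam) = 1" "loop_eval g (- lam) = sigma (loop_eval g lam)"
  using assms by (simp_all add: LSL_def)

text \<open>The last identity says that \<open>omega0\<close> satisfies the reality condition up to sign. This is why the
  second cell leads to the same Maurer-Cartan equation as the first.\<close>
lemma omega0_symmetries:
  assumes "lam \<noteq> 0"
  shows "det (omega0 lam) = 1" "omega0 (- lam) = sigma (omega0 lam)"
    "reflect (omega0 (\<i> / cnj lam)) = cscale (- 1) (omega0 lam)"
  using assms by (simp_all add: omega0_def det22 sigma_eq mat2_eq_iff divide_inverse)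

lemma LSL_mult_omega0:
  assumes g: "g \<in> LSL"
  shows "\<exists>h\<in>LSL. \<forall>lam\<in>sphere 0 1. loop_eval g lam ** omega0 lam = loop_eval h lam"
proof -
  obtain h where h: "\<And>lam. norm lam = 1 \<Longrightarrow> loop_eval h lam = loop_eval g lam ** omega0 lam"
    using loop_mult_omega0[of g] by blast
  have "h \<in> LSL"
  proof (rule LSL_I)
    fix lam :: complex assume lam: "norm lam = 1"
    then have nz: "lam \<noteq> 0" by auto
    show "det (loop_eval h lam) = 1"
      by (simp add: h lam det_mul LSL_D[OF g lam] omega0_symmetries[OF nz])
    show "loop_eval h (- lam) = sigma (loop_eval h lam)"
      using lam by (simp add: h sigma_mult LSL_D[OF g lam] omega0_symmetries[OF nz])
  qed
  then show ?thesis by (intro bexI[of _ h]) (simp_all add: h)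
qed

lemma tau4_mult_omega0:
  assumes g: "g \<in> LSL_tau4" and lam: "norm lam = 1"
  shows "tau4 (\<lambda>lam. loop_eval g lam ** omega0 lam) lam = cscale (- 1) (loop_eval g lam ** omega0 lam)"
proof -
  define mu where "mu = \<i> / cnj lam"
  have nz: "lam \<noteq> 0" and mu: "norm mu = 1" "mu \<noteq> 0"
    using lam by (auto simp: mu_def norm_divide)
  have gL: "g \<in> LSL" and t: "tau4 (loop_eval g) lam = loop_eval g lam"
    using g lam by (auto simp: LSL_tau4_def)
  have dg: "det (loop_eval g mu) = 1" by (rule LSL_D(1)[OF gL mu(1)])
  have "tau4 (\<lambda>lam. loop_eval g lam ** omega0 lam) lam = reflect (loop_eval g mu ** omega0 mu)"
    unfolding mu_def
    by (rule tau4_eq_reflect) (simp add: det_mul dg omega0_symmetries mu mu_def[symmetric])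
  also have "\<dots> = reflect (loop_eval g mu) ** cscale (- 1) (omega0 lam)"
    using omega0_symmetries(3)[OF nz] by (simp add: reflect_mult mu_def)
  also have "reflect (loop_eval g mu) = loop_eval g lam"
    using tau4_eq_reflect[of "loop_eval g" lam] dg t by (simp add: mu_def)
  finally show ?thesis by (simp add: cscale_mult)
qed

theorem theorem9p5:
  fixes D D1 D2 :: "complex set" and zs :: complex
    and e :: "int \<Rightarrow> complex \<Rightarrow> mat2"
    and C :: "complex \<Rightarrow> complex \<Rightarrow> mat2"
    and Phi1 V1 Phi2 V2 :: "complex \<Rightarrow> loop"
  assumes D: "open D" "connected D" "simply_connected D" "zs \<in> D"
    and potential: "holomorphic_potential D e"
    and C_ode: "\<And>lam z r s. lam \<noteq> 0 \<Longrightarrow> z \<in> D \<Longrightarrow>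
        ((\<lambda>z. C z lam $ r $ s) has_field_derivative (C z lam ** eta e z lam) $ r $ s) (at z)"
    and C_init: "\<And>lam. lam \<noteq> 0 \<Longrightarrow> C zs lam = mat 1"
    and D1: "D1 = {z \<in> D. \<exists>F\<in>LSL_tau4. \<exists>V\<in>LSL_plus. \<forall>lam\<in>sphere 0 1.
        C z lam = loop_eval F lam ** loop_eval V lam}"
    and D2: "D2 = {z \<in> D. \<exists>F\<in>LSL_tau4. \<exists>V\<in>LSL_plus. \<forall>lam\<in>sphere 0 1.
        C z lam = loop_eval F lam ** omega0 lam ** loop_eval V lam}"
    and opens: "open D1" "open D2"
    and Phi1: "smooth_on D1 Phi1" "\<And>z. z \<in> D1 \<Longrightarrow> Phi1 z \<in> LSL_tau4"
    and V1: "smooth_on D1 V1" "\<And>z. z \<in> D1 \<Longrightarrow> V1 z \<in> LSL_plus"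
    and Iwasawa1: "\<And>z lam. z \<in> D1 \<Longrightarrow> lam \<in> sphere 0 1 \<Longrightarrow>
        C z lam = loop_eval (Phi1 z) lam ** loop_eval (V1 z) lam"
    and Phi2: "smooth_on D2 Phi2" "\<And>z. z \<in> D2 \<Longrightarrow> Phi2 z \<in> LSL_tau4"
    and V2: "smooth_on D2 V2" "\<And>z. z \<in> D2 \<Longrightarrow> V2 z \<in> LSL_plus"
    and Iwasawa2: "\<And>z lam. z \<in> D2 \<Longrightarrow> lam \<in> sphere 0 1 \<Longrightarrow>
        C z lam = loop_eval (Phi2 z) lam ** omega0 lam ** loop_eval (V2 z) lam"
  shows "\<exists>H. 0 \<le> H \<and> H < 1 \<and>
      cmc_frame_up_to_gauge H D1 (\<lambda>z. loop_eval (Phi1 z)) \<and>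
      cmc_frame_up_to_gauge H D2 (\<lambda>z lam. loop_eval (Phi2 z) lam ** omega0 lam)"
proof -
  have C_hol: "(\<lambda>lam. C z lam $ i $ j) holomorphic_on - {0}" if z: "z \<in> D" for z i j
  proof (rule linear_ode_holomorphic_in_parameter[where D = D and zs = zs and A = "eta e"])
    show "continuous_on (D \<times> - {0}) (\<lambda>(z, lam). eta e z lam $ i $ j)" for i j
      unfolding eta_def cscale_nth split_beta
      by (intro continuous_intros continuous_on_subset[OF continuous_on_lambda_eta[OF potential, unfolded split_beta]])
        auto
    show "(\<lambda>lam. eta e z lam $ i $ j) holomorphic_on - {0}" if "z \<in> D" for z i j
      unfolding eta_def cscale_nth
      by (intro holomorphic_intros holomorphic_on_subset[OF lambda_eta_entire[OF potential that]]) auto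
    show "(\<lambda>lam. C zs lam $ i $ j) holomorphic_on - {0}" for i j
      by (rule holomorphic_transform[OF holomorphic_on_const[of "(mat 1 :: mat2) $ i $ j"]])
        (simp add: C_init)
    show "((\<lambda>z. C z lam $ i $ j) has_field_derivative (C z lam ** eta e z lam) $ i $ j) (at z)"
      if "z \<in> D" "lam \<in> - {0}" for z lam i j
      by (rule C_ode) (use that in auto)
  qed (use D z in \<open>auto simp: open_Compl\<close>)
  obtain s where s: "s holomorphic_on D" "\<And>z. z \<in> D \<Longrightarrow> e (- 1) z $ 1 $ 2 = (s z)\<^sup>2"
  proof (rule simply_connected_imp_holomorphic_sqrt)
    show "(\<lambda>z. e (- 1) z $ 1 $ 2) holomorphic_on D"
      using potential[unfolded holomorphic_potential_def, THEN conjunct1, THEN spec, of "- 1",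
          THEN mp, OF order_refl, THEN conjunct1] by simp
    show "e (- 1) z $ 1 $ 2 \<noteq> 0" if "z \<in> D" for z
      using potential that by (simp add: holomorphic_potential_def)
  qed (use D open_imp_locally_path_connected in auto)
  have sub: "D1 \<subseteq> D" "D2 \<subseteq> D" using D1 D2 by auto
  have LSL: "Phi1 z \<in> LSL" if "z \<in> D1" for z using Phi1(2)[OF that] by (simp add: LSL_tau4_def)
  have LSL2: "Phi2 z \<in> LSL" if "z \<in> D2" for z using Phi2(2)[OF that] by (simp add: LSL_tau4_def)
  have "iwasawa_frame D D1 e C (\<lambda>z. loop_eval (Phi1 z)) V1 1 s"
  proof
    show "\<exists>g\<in>LSL. \<forall>lam\<in>sphere 0 1. loop_eval (Phi1 z) lam = loop_eval g lam" if "z \<in> D1" for z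
      using LSL[OF that] by blast
    show "smooth_on D1 (\<lambda>z. loop_eval (Phi1 z) lam)" if "norm lam = 1" for lam
      by (rule smooth_on_bounded_linear[OF opens(1) bounded_linear_loop_eval[OF that] Phi1(1)])
    show "tau4 (loop_eval (Phi1 z)) lam = cscale 1 (loop_eval (Phi1 z) lam)"
      if "z \<in> D1" "norm lam = 1" for z lam
      using Phi1(2)[OF that(1)] that(2) by (simp add: LSL_tau4_def cscale_1)
  qed (use D(1) opens sub potential s C_ode C_hol V1 Iwasawa1 in auto)
  then have 1: "cmc_frame_up_to_gauge 0 D1 (\<lambda>z. loop_eval (Phi1 z))"
    by (rule iwasawa_frame.cmc_frame)
  have "iwasawa_frame D D2 e C (\<lambda>z lam. loop_eval (Phi2 z) lam ** omega0 lam) V2 (- 1) s"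
  proof
    show "\<exists>g\<in>LSL. \<forall>lam\<in>sphere 0 1. loop_eval (Phi2 z) lam ** omega0 lam = loop_eval g lam"
      if "z \<in> D2" for z
      by (rule LSL_mult_omega0[OF LSL2[OF that]])
    show "smooth_on D2 (\<lambda>z. loop_eval (Phi2 z) lam ** omega0 lam)" if "norm lam = 1" for lam
      by (rule smooth_on_bounded_bilinear[OF opens(2) bounded_bilinear_mat2_mult
            smooth_on_bounded_linear[OF opens(2) bounded_linear_loop_eval[OF that] Phi2(1)]
            smooth_on_const[OF opens(2)]])
    show "tau4 (\<lambda>lam. loop_eval (Phi2 z) lam ** omega0 lam) lam =
        cscale (- 1) (loop_eval (Phi2 z) lam ** omega0 lam)" if "z \<in> D2" "norm lam = 1" for z lam
      by (rule tau4_mult_omega0[OF Phi2(2)[OF that(1)] that(2)])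
  qed (use D(1) opens sub potential s C_ode C_hol V2 Iwasawa2 in auto)
  then have 2: "cmc_frame_up_to_gauge 0 D2 (\<lambda>z lam. loop_eval (Phi2 z) lam ** omega0 lam)"
    by (rule iwasawa_frame.cmc_frame)
  show ?thesis
    using 1 2 by (intro exI[of _ 0]) simp
qed

end
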